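(* For every $\mu\ge0$, the linearised operator $L_\mu=-A_\mu+K_\mu$ on $H=L^2((0,\infty);\sqrt\omega\,d\omega)$ satisfies the following. (i) $-L_\mu$ is symmetric and nonnegative on $H$, and is a bounded linear operator from $H$ into itself. (ii) Consequently, it generates a semigroup of contractions $S_t=e^{tL_\mu}$ on $H$ such that $$\|L_\mu(S_tf)\|_H\le\frac{\|f\|_H}{e\,t}\quad\text{for all } f\in H,\ t>0,\qquad \lim_{t\to\infty}\|S_t(I-\Pi)f\|_H=0\quad\text{for all } f\in H,$$ where $\Pi$ is the orthogonal projection of $H$ onto $\operatorname{Ker}(L_\mu)$. (iii) For every $\mu\ge0$, the operator $K_\mu$ is not a compact operator from $H$ into itself. (iv) For every $\mu>0$, the linear operator possesses a spectral gap: there exists $\lambda_\mu>0$ such that $$D_\mu(g):=-\langle L_\mu g,g\rangle_H\ge\lambda_\mu\|(I-\Pi)g\|_H^2\qquad\text{for all } g\in H.$$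
   Context: $H=L^2((0,\infty);\sqrt\omega\,d\omega)$ (real-valued functions) with its natural inner product. For $\mu\ge0$ let $n(\omega)=\frac1{\omega+\mu}$. For $\omega>0$ let $D(\omega)=\{(\omega_1,\omega_2):\omega_1\ge0,\ \omega_2\ge0,\ \omega_1+\omega_2\ge\omega\}$, $\omega_3=\omega_1+\omega_2-\omega$, $\Omega=\min(\sqrt\omega,\sqrt{\omega_1},\sqrt{\omega_2},\sqrt{\omega_3})/\sqrt\omega$, and $n_i=n(\omega_i)$, $g_i=g(\omega_i)$ for $i=1,2,3$. For $g\in C_c^\infty(0,\infty)$, $$L_\mu g(\omega)=\iint_{D(\omega)}\Omega\,n_1n_2n_3\Big[-\frac{g(\omega)}{n(\omega)}-\frac{g_3}{n_3}+\frac{g_1}{n_1}+\frac{g_2}{n_2}\Big]d\omega_1d\omega_2=-[A_\mu g](\omega)+[K_\mu g](\omega),$$ where $[A_\mu g](\omega)=a_\mu(\omega)g(\omega)$ with $a_\mu(\omega)=\frac1{n(\omega)}\iint_{D(\omega)}\Omega\,n_1n_2n_3\,d\omega_1d\omega_2$ is the multiplication part, and $$[K_\mu g](\omega)=\iint_{D(\omega)}\Omega\,n_1n_2n_3\Big[-\frac{g_3}{n_3}+\frac{g_1}{n_1}+\frac{g_2}{n_2}\Big]d\omega_1d\omega_2$$ is the integral operator containing the remaining three terms. These operators are extended to $H$ by density of $C_c^\infty(0,\infty)$ (the boundedness of $L_\mu$ being part of assertion (i)). *)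

theory Defs
  imports "HOL-Analysis.Analysis"
begin

text \<open>The type \<open>wL2\<close> below is the Hilbert space \<open>L\<^sup>2((0,\<infinity>); sqrt \<omega> d\<omega>)\<close>. Its elements are represented by
  functions on all of \<open>\<real>\<close>, whose values on \<open>(-\<infinity>, 0]\<close> are irrelevant because \<open>wmeasure\<close> does not charge
  that set.\<close>

definition wmeasure :: "real measure" where
  "wmeasure = density lborel (\<lambda>\<omega>. ennreal (indicator {0<..} \<omega> * sqrt \<omega>))"

definition square_integrable :: "(real \<Rightarrow> real) \<Rightarrow> bool" where
  "square_integrable f \<longleftrightarrow> f \<in> borel_measurable wmeasure \<and> integrable wmeasure (\<lambda>\<omega>. (f \<omega>)\<^sup>2)"

definition l2_rel :: "(real \<Rightarrow> real) \<Rightarrow> (real \<Rightarrow> real) \<Rightarrow> bool" where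
  "l2_rel f g \<longleftrightarrow> square_integrable f \<and> square_integrable g \<and> (AE \<omega> in wmeasure. f \<omega> = g \<omega>)"

lemma square_integrable_zero: "square_integrable (\<lambda>_. 0)"
  by (simp add: square_integrable_def)

lemma square_integrable_mult:
  assumes "square_integrable f" "square_integrable g"
  shows "integrable wmeasure (\<lambda>\<omega>. f \<omega> * g \<omega>)"
proof -
  have [measurable]: "f \<in> borel_measurable wmeasure" "g \<in> borel_measurable wmeasure"
    using assms by (auto simp: square_integrable_def)
  have "integrable wmeasure (\<lambda>\<omega>. (f \<omega>)\<^sup>2 + (g \<omega>)\<^sup>2)"
    using assms by (simp add: square_integrable_def)
  then show ?thesis
  proof (rule Bochner_Integration.integrable_bound)
    have "norm (a * b) \<le> norm (a\<^sup>2 + b\<^sup>2)" for a b :: real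
    proof -
      have "2 * \<bar>a * b\<bar> \<le> a\<^sup>2 + b\<^sup>2"
        using sum_squares_bound[of "\<bar>a\<bar>" "\<bar>b\<bar>"] by (simp add: abs_mult mult.assoc)
      then show ?thesis using abs_ge_zero[of "a * b"] by simp
    qed
    then show "AE \<omega> in wmeasure. norm (f \<omega> * g \<omega>) \<le> norm ((f \<omega>)\<^sup>2 + (g \<omega>)\<^sup>2)" by simp
  qed measurable
qed

lemma square_integrable_add:
  assumes "square_integrable f" "square_integrable g"
  shows "square_integrable (\<lambda>\<omega>. f \<omega> + g \<omega>)"
  using assms square_integrable_mult[OF assms]
  by (auto simp: square_integrable_def power2_sum mult.assoc)

lemma square_integrable_scale:
  "square_integrable f \<Longrightarrow> square_integrable (\<lambda>\<omega>. c * f \<omega>)"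
  by (auto simp: square_integrable_def power_mult_distrib)

lemma square_integrable_uminus:
  "square_integrable f \<Longrightarrow> square_integrable (\<lambda>\<omega>. - f \<omega>)"
  using square_integrable_scale[of f "-1"] by simp

lemma square_integrable_diff:
  "square_integrable f \<Longrightarrow> square_integrable g \<Longrightarrow> square_integrable (\<lambda>\<omega>. f \<omega> - g \<omega>)"
  using square_integrable_add[of f "\<lambda>\<omega>. - g \<omega>"] square_integrable_uminus[of g] by simp

quotient_type wL2 = "real \<Rightarrow> real" / partial: l2_rel
proof (rule part_equivpI)
  show "\<exists>f. l2_rel f f"
    using square_integrable_zero by (auto simp: l2_rel_def)
  show "symp l2_rel"
    by (auto simp: l2_rel_def symp_def elim: eventually_mono)
  show "transp l2_rel"
    by (auto simp: l2_rel_def transp_def elim: eventually_elim2)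
qed

instantiation wL2 :: real_inner
begin

lift_definition zero_wL2 :: wL2 is "\<lambda>_. 0"
  by (simp add: l2_rel_def square_integrable_zero)

lift_definition plus_wL2 :: "wL2 \<Rightarrow> wL2 \<Rightarrow> wL2" is "\<lambda>f g \<omega>. f \<omega> + g \<omega>"
  unfolding l2_rel_def by (auto intro: square_integrable_add elim: eventually_elim2)

lift_definition uminus_wL2 :: "wL2 \<Rightarrow> wL2" is "\<lambda>f \<omega>. - f \<omega>"
  unfolding l2_rel_def by (auto intro: square_integrable_uminus elim: eventually_mono)

lift_definition minus_wL2 :: "wL2 \<Rightarrow> wL2 \<Rightarrow> wL2" is "\<lambda>f g \<omega>. f \<omega> - g \<omega>"
  unfolding l2_rel_def by (auto intro: square_integrable_diff elim: eventually_elim2)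

lift_definition scaleR_wL2 :: "real \<Rightarrow> wL2 \<Rightarrow> wL2" is "\<lambda>c f \<omega>. c * f \<omega>"
  unfolding l2_rel_def by (auto intro: square_integrable_scale elim: eventually_mono)

lift_definition inner_wL2 :: "wL2 \<Rightarrow> wL2 \<Rightarrow> real" is
  "\<lambda>f g. LINT \<omega>|wmeasure. f \<omega> * g \<omega>"
  unfolding l2_rel_def square_integrable_def
  by (intro integral_cong_AE) (auto elim: eventually_elim2)

definition norm_wL2 :: "wL2 \<Rightarrow> real" where "norm_wL2 f = sqrt (inner f f)"
definition sgn_wL2 :: "wL2 \<Rightarrow> wL2" where "sgn_wL2 f = scaleR (inverse (norm f)) f"
definition dist_wL2 :: "wL2 \<Rightarrow> wL2 \<Rightarrow> real" where "dist_wL2 f g = norm (f - g)"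
definition uniformity_wL2 :: "(wL2 \<times> wL2) filter" where
  "uniformity_wL2 = (INF e\<in>{0<..}. principal {(f, g). dist f g < e})"
definition open_wL2 :: "wL2 set \<Rightarrow> bool" where
  "open_wL2 U \<longleftrightarrow> (\<forall>f\<in>U. eventually (\<lambda>(f', g). f' = f \<longrightarrow> g \<in> U) uniformity)"

instance
proof
  fix a b :: real and x y z :: wL2
  note si = square_integrable_add square_integrable_uminus square_integrable_diff
    square_integrable_scale square_integrable_zero
  show "x + y + z = x + (y + z)"
    by transfer (auto simp: l2_rel_def add.assoc intro: si)
  show "x + y = y + x"
    by transfer (auto simp: l2_rel_def add.commute intro: si)
  show "0 + x = x"
    by transfer (auto simp: l2_rel_def intro: si)
  show "- x + x = 0"
    by transfer (auto simp: l2_rel_def intro: si)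
  show "x - y = x + - y"
    by transfer (auto simp: l2_rel_def intro: si square_integrable_add[of _ "\<lambda>\<omega>. - _ \<omega>", simplified])
  show "a *\<^sub>R (x + y) = a *\<^sub>R x + a *\<^sub>R y"
    by transfer (auto simp: l2_rel_def distrib_left intro!: si)
  show "(a + b) *\<^sub>R x = a *\<^sub>R x + b *\<^sub>R x"
    by transfer (auto simp: l2_rel_def distrib_right intro!: si)
  show "a *\<^sub>R b *\<^sub>R x = (a * b) *\<^sub>R x"
    by transfer (auto simp: l2_rel_def mult.assoc intro!: si)
  show "1 *\<^sub>R x = x"
    by transfer (auto simp: l2_rel_def)
  show "inner x y = inner y x"
    by transfer (simp add: mult.commute)
  show "inner (x + y) z = inner x z + inner y z"
    by transfer (auto simp: l2_rel_def distrib_right square_integrable_mult)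
  show "inner (a *\<^sub>R x) y = a * inner x y"
    by transfer (auto simp: mult.assoc)
  show "0 \<le> inner x x"
    by transfer simp
  show "inner x x = 0 \<longleftrightarrow> x = 0"
  proof transfer
    fix f assume "l2_rel f f"
    then have f: "square_integrable f" by (simp add: l2_rel_def)
    then have "integral\<^sup>L wmeasure (\<lambda>\<omega>. f \<omega> * f \<omega>) = 0 \<longleftrightarrow> (AE \<omega> in wmeasure. f \<omega> * f \<omega> = 0)"
      by (intro integral_nonneg_eq_0_iff_AE square_integrable_mult) auto
    then show "integral\<^sup>L wmeasure (\<lambda>\<omega>. f \<omega> * f \<omega>) = 0 \<longleftrightarrow> l2_rel f (\<lambda>_. 0)"
      using f by (simp add: l2_rel_def square_integrable_zero)
  qed
qed (simp_all add: norm_wL2_def sgn_wL2_def dist_wL2_def uniformity_wL2_def open_wL2_def)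

end

text \<open>The class of a square integrable function; only meaningful on such functions.\<close>

definition L2_class :: "(real \<Rightarrow> real) \<Rightarrow> wL2" where
  "L2_class = abs_wL2"

definition test_functions :: "(real \<Rightarrow> real) set" where
  "test_functions =
    {g. (\<forall>k. (deriv ^^ k) g differentiable_on UNIV) \<and>
        (\<exists>C. compact C \<and> C \<subseteq> {0<..} \<and> (\<forall>\<omega>. \<omega> \<notin> C \<longrightarrow> g \<omega> = 0))}"

text \<open>Since test functions are dense in \<open>wL2\<close>, a formula \<open>F\<close> has at most one bounded linear extension;
  \<open>extension F\<close> is meaningful only if one exists, i.e. if \<open>extends_formula F (extension F)\<close>.\<close>

definition extends_formula :: "((real \<Rightarrow> real) \<Rightarrow> real \<Rightarrow> real) \<Rightarrow> (wL2 \<Rightarrow> wL2) \<Rightarrow> bool" where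
  "extends_formula F T \<longleftrightarrow> bounded_linear T \<and>
    (\<forall>g\<in>test_functions. square_integrable (F g) \<and> T (L2_class g) = L2_class (F g))"

definition extension :: "((real \<Rightarrow> real) \<Rightarrow> real \<Rightarrow> real) \<Rightarrow> wL2 \<Rightarrow> wL2" where
  "extension F = (THE T. extends_formula F T)"


definition eq_n :: "real \<Rightarrow> real \<Rightarrow> real" where
  "eq_n \<mu> \<omega> = 1 / (\<omega> + \<mu>)"

definition coll_dom :: "real \<Rightarrow> (real \<times> real) set" where
  "coll_dom \<omega> = {(\<omega>1, \<omega>2). \<omega>1 \<ge> 0 \<and> \<omega>2 \<ge> 0 \<and> \<omega>1 + \<omega>2 \<ge> \<omega>}"

definition coll_weight :: "real \<Rightarrow> real \<Rightarrow> real \<Rightarrow> real" where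
  "coll_weight \<omega> \<omega>1 \<omega>2 =
    Min {sqrt \<omega>, sqrt \<omega>1, sqrt \<omega>2, sqrt (\<omega>1 + \<omega>2 - \<omega>)} / sqrt \<omega>"

text \<open>The factor \<open>\<Omega> n\<^sub>1 n\<^sub>2 n\<^sub>3\<close>, with \<open>\<omega>\<^sub>3 = \<omega>\<^sub>1 + \<omega>\<^sub>2 - \<omega>\<close>.\<close>

definition coll_kernel :: "real \<Rightarrow> real \<Rightarrow> real \<Rightarrow> real \<Rightarrow> real" where
  "coll_kernel \<mu> \<omega> \<omega>1 \<omega>2 =
    coll_weight \<omega> \<omega>1 \<omega>2 * eq_n \<mu> \<omega>1 * eq_n \<mu> \<omega>2 * eq_n \<mu> (\<omega>1 + \<omega>2 - \<omega>)"

definition L_formula :: "real \<Rightarrow> (real \<Rightarrow> real) \<Rightarrow> real \<Rightarrow> real" where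
  "L_formula \<mu> g \<omega> = (LINT (\<omega>1, \<omega>2):coll_dom \<omega>|lborel. coll_kernel \<mu> \<omega> \<omega>1 \<omega>2 *
    (let \<omega>3 = \<omega>1 + \<omega>2 - \<omega> in
      - g \<omega> / eq_n \<mu> \<omega> - g \<omega>3 / eq_n \<mu> \<omega>3 + g \<omega>1 / eq_n \<mu> \<omega>1 + g \<omega>2 / eq_n \<mu> \<omega>2))"

definition a_mult :: "real \<Rightarrow> real \<Rightarrow> real" where
  "a_mult \<mu> \<omega> = 1 / eq_n \<mu> \<omega> *
    (LINT (\<omega>1, \<omega>2):coll_dom \<omega>|lborel. coll_kernel \<mu> \<omega> \<omega>1 \<omega>2)"

definition A_formula :: "real \<Rightarrow> (real \<Rightarrow> real) \<Rightarrow> real \<Rightarrow> real" where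
  "A_formula \<mu> g \<omega> = a_mult \<mu> \<omega> * g \<omega>"

definition K_formula :: "real \<Rightarrow> (real \<Rightarrow> real) \<Rightarrow> real \<Rightarrow> real" where
  "K_formula \<mu> g \<omega> = (LINT (\<omega>1, \<omega>2):coll_dom \<omega>|lborel. coll_kernel \<mu> \<omega> \<omega>1 \<omega>2 *
    (let \<omega>3 = \<omega>1 + \<omega>2 - \<omega> in
      - g \<omega>3 / eq_n \<mu> \<omega>3 + g \<omega>1 / eq_n \<mu> \<omega>1 + g \<omega>2 / eq_n \<mu> \<omega>2))"

definition L_op :: "real \<Rightarrow> wL2 \<Rightarrow> wL2" where
  "L_op \<mu> = extension (L_formula \<mu>)"

definition A_op :: "real \<Rightarrow> wL2 \<Rightarrow> wL2" where
  "A_op \<mu> = extension (A_formula \<mu>)"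

definition K_op :: "real \<Rightarrow> wL2 \<Rightarrow> wL2" where
  "K_op \<mu> = extension (K_formula \<mu>)"

definition dissipation :: "real \<Rightarrow> wL2 \<Rightarrow> real" where
  "dissipation \<mu> g = - inner (L_op \<mu> g) g"


definition symmetric_op :: "('a::real_inner \<Rightarrow> 'a) \<Rightarrow> bool" where
  "symmetric_op T \<longleftrightarrow> (\<forall>f g. inner (T f) g = inner f (T g))"

definition nonnegative_op :: "('a::real_inner \<Rightarrow> 'a) \<Rightarrow> bool" where
  "nonnegative_op T \<longleftrightarrow> (\<forall>f. inner (T f) f \<ge> 0)"

definition compact_op :: "('a::real_normed_vector \<Rightarrow> 'b::real_normed_vector) \<Rightarrow> bool" where
  "compact_op T \<longleftrightarrow> bounded_linear T \<and> (\<forall>B. bounded B \<longrightarrow> compact (closure (T ` B)))"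

definition contraction_semigroup :: "(real \<Rightarrow> 'a::real_normed_vector \<Rightarrow> 'a) \<Rightarrow> bool" where
  "contraction_semigroup S \<longleftrightarrow>
    (\<forall>t\<ge>0. bounded_linear (S t) \<and> (\<forall>f. norm (S t f) \<le> norm f)) \<and>
    (\<forall>f. S 0 f = f) \<and>
    (\<forall>s\<ge>0. \<forall>t\<ge>0. \<forall>f. S (s + t) f = S s (S t f)) \<and>
    (\<forall>f. continuous_on {0..} (\<lambda>t. S t f))"

text \<open>The limit is required at every \<open>f\<close>, so the generator is everywhere defined and equals \<open>T\<close>.\<close>

definition generates :: "('a::real_normed_vector \<Rightarrow> 'a) \<Rightarrow> (real \<Rightarrow> 'a \<Rightarrow> 'a) \<Rightarrow> bool" where
  "generates T S \<longleftrightarrow> (\<forall>f. ((\<lambda>t. (S t f - f) /\<^sub>R t) \<longlongrightarrow> T f) (at_right 0))"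

definition op_exp :: "('a::real_normed_vector \<Rightarrow> 'a) \<Rightarrow> real \<Rightarrow> 'a \<Rightarrow> 'a" where
  "op_exp T t f = (\<Sum>k. (t ^ k / fact k) *\<^sub>R (T ^^ k) f)"

definition orthogonal_projection_onto :: "'a::real_inner set \<Rightarrow> ('a \<Rightarrow> 'a) \<Rightarrow> bool" where
  "orthogonal_projection_onto V P \<longleftrightarrow> (\<forall>f. P f \<in> V \<and> (\<forall>h\<in>V. orthogonal (f - P f) h))"

definition ker :: "('a \<Rightarrow> 'b::zero) \<Rightarrow> 'a set" where
  "ker T = {f. T f = 0}"

definition Pi_op :: "real \<Rightarrow> wL2 \<Rightarrow> wL2" where
  "Pi_op \<mu> = (THE P. orthogonal_projection_onto (ker (L_op \<mu>)) P)"

end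

theory Submission imports Defs begin

text \<open>
  Everything rests on the substitution \<open>h = g / n\<close>, which makes the linearised operator see a collision
  only through the defect \<open>h(\<omega>) + h(\<omega>\<^sub>3) - h(\<omega>\<^sub>1) - h(\<omega>\<^sub>2)\<close>. Multiplying the kernel by
  \<open>n(\<omega>) sqrt \<omega>\<close> turns it into the density
  \<open>min (sqrt \<omega>, sqrt \<omega>\<^sub>1, sqrt \<omega>\<^sub>2, sqrt \<omega>\<^sub>3) n n\<^sub>1 n\<^sub>2 n\<^sub>3\<close> of a measure on collisions that is invariant
  under \<open>\<omega>\<^sub>1 \<leftrightarrow> \<omega>\<^sub>2\<close>, under \<open>\<omega> \<leftrightarrow> \<omega>\<^sub>3\<close> and under the reversal of the collision
  (\<open>coll_measure_invariant\<close>). Two consequences give assertion (i).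

  First, all four frequencies have the same law under this measure. That law is at most
  \<open>768 n\<^sup>2 sqrt \<omega> d\<omega>\<close>, because the total collision rate at \<open>\<omega>\<close> is at most \<open>768 n(\<omega>)\<close>
  (\<open>nn_integral_coll_rate_le\<close>). So each of the four terms of \<open>L\<^sub>\<mu>\<close> is a bounded operator, by Cauchy-Schwarz
  (\<open>bounded_linear_freq_op\<close>), and density of the test functions identifies these operators with the
  extensions of the formulas (\<open>operators_eq_bounded\<close>). Secondly, symmetrising over the four frequencies gives
  \<open>\<langle>L\<^sub>\<mu> f, g\<rangle> = -1/4 \<integral> defect(f) defect(g)\<close> (\<open>L_op_form\<close>), which is visibly symmetric and nonpositive.

  Assertion (ii) holds for every bounded symmetric nonpositive \<open>T\<close> on a Hilbert space and is proved without
  the spectral theorem. The function \<open>r \<mapsto> exp (2 a r) \<parallel>exp (r T) f\<parallel>\<^sup>2\<close> is convex, and its tangent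
  at \<open>r = s\<close>, evaluated at \<open>0\<close> with \<open>a = 1/(2s)\<close>, bounds the quadratic form at time \<open>s\<close> with the
  optimal constant (\<open>op_exp_form_decay\<close>); splitting the time into two halves yields
  \<open>\<parallel>T exp (t T) f\<parallel> \<le> \<parallel>f\<parallel> / (e t)\<close> (\<open>op_exp_decay\<close>). Thus the semigroup tends to \<open>0\<close> on the range of \<open>T\<close>, which
  is dense in the orthogonal complement of the kernel (\<open>op_exp_tendsto_0\<close>).

  For assertion (iii), test \<open>K\<^sub>\<mu>\<close> on \<open>n\<close> restricted to an interval \<open>[R, R (1 + \<delta>\<^sup>2)]\<close>. The kernel of
  the two gain terms behaves like \<open>|\<omega> - \<omega>\<^sub>1|\<^bsup>-1/2\<^esup>\<close> near the diagonal, the kernel of the \<open>\<omega>\<^sub>3\<close> term is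
  bounded there. Hence for small \<open>\<delta>\<close> the gain wins, by a fixed fraction of the squared norm, however large
  \<open>R\<close> is (\<open>inner_K_packet_lower\<close>). Disjoint intervals produce an orthonormal sequence on which the form of
  \<open>K\<^sub>\<mu>\<close> stays away from \<open>0\<close>.

  For assertion (iv) let \<open>\<mu> > 0\<close>. Then \<open>n\<close> is square integrable and lies in the kernel, so it
  suffices to bound the distance of \<open>h\<close> to the constants by the energy, which is the integral of the squared
  defect. Write \<open>e(x,u) = h(u) - h(x)\<close> for \<open>1 \<le> x \<le> u \<le> 2x\<close>. If the defect vanishes then equal steps give equal
  increments and \<open>2 e(x,u) = e(u, 3u - 2x)\<close>; in general the error is a combination of three defects
  (\<open>doubling_defect_bound\<close>). The map \<open>(x,u) \<mapsto> (u, 3u - 2x)\<close> has determinant \<open>2\<close> and lowers the weight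
  \<open>x\<^bsup>-5/2\<^esup>\<close> by a factor of at most \<open>2\<^bsup>5/2\<^esup>\<close>, so the weighted square integral of the right side is at most
  \<open>2\<^bsup>3/2\<^esup> < 4\<close> times that of \<open>e\<close>, and \<open>e\<close> is controlled by the energy (\<open>ratio_energy_bound\<close>). This uses that
  the integral of \<open>e\<^sup>2\<close> is finite, which excludes the mode \<open>h(\<omega>) = \<omega>\<close>. Comparing \<open>h(u)\<close> with \<open>h(x)\<close>
  for \<open>u\<close> near \<open>2x\<close> then controls \<open>h - c\<close> on \<open>[1,\<infinity>)\<close> (\<open>tail_energy_bound\<close>) for a suitable constant \<open>c\<close>, and
  collisions of one small frequency with three moderate ones control it on \<open>(0,1]\<close> (\<open>low_energy_bound\<close>).
\<close>

section \<open>Orthogonal projections in Hilbert spaces\<close>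

text \<open>By the parallelogram law, \<open>\<parallel>v m - v n\<parallel>\<^sup>2\<close> is four times the gap between the mean squared distance of the two points to
\<open>f\<close> and the squared distance of their midpoint to \<open>f\<close>; that gap is small because midpoints cannot undercut
the infimum \<open>d\<close>.\<close>

lemma minimizing_sequence_Cauchy:
  fixes v :: "nat \<Rightarrow> 'a::real_inner"
  assumes lower: "\<And>m n. d \<le> (norm (f - (1/2) *\<^sub>R (v m + v n)))\<^sup>2"
    and upper: "\<And>n. (norm (f - v n))\<^sup>2 < d + 1 / real (Suc n)"
  shows "Cauchy v"
proof (rule metric_CauchyI)
  fix e :: real assume e: "e > 0"
  obtain N where N: "4 / e\<^sup>2 < real N" using reals_Archimedean2 by blast
  have N0: "N > 0" using N e by (cases N) (auto simp: field_simps)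
  have "dist (v m) (v n) < e" if mn: "m \<ge> N" "n \<ge> N" for m n
  proof -
    (* parallelogram law *)
    have par: "(norm (v m - v n))\<^sup>2 = 2 * (norm (f - v m))\<^sup>2 + 2 * (norm (f - v n))\<^sup>2
        - 4 * (norm (f - (1/2) *\<^sub>R (v m + v n)))\<^sup>2"
      by (simp add: power2_norm_eq_inner algebra_simps inner_commute)
    have "1 / real (Suc m) \<le> 1 / N" "1 / real (Suc n) \<le> 1 / N"
      using mn N0 by (auto simp: field_simps)
    then have "(norm (v m - v n))\<^sup>2 < 4 / N"
      using par lower[of m n] upper[of m] upper[of n] by simp
    also have "4 / N < e\<^sup>2" using N e N0 by (simp add: field_simps)
    finally show ?thesis using e by (simp add: dist_norm power2_less_imp_less)
  qed
  then show "\<exists>M. \<forall>m\<ge>M. \<forall>n\<ge>M. dist (v m) (v n) < e" by blast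
qed

text \<open>The projection is the nearest point, obtained as the limit of a minimising sequence. Optimality along each
line \<open>p + t h\<close> in \<open>V\<close> forces \<open>f - p\<close> to be orthogonal to \<open>h\<close>.\<close>

lemma orthogonal_projection_exists:
  fixes V :: "'a::{real_inner,complete_space} set"
  assumes V: "subspace V" and cl: "closed V"
  shows "\<exists>p\<in>V. \<forall>h\<in>V. orthogonal (f - p) h"
proof -
  define d where "d = (INF v\<in>V. (norm (f - v))\<^sup>2)"
  have bdd: "bdd_below ((\<lambda>v. (norm (f - v))\<^sup>2) ` V)" by (rule bdd_belowI[of _ 0]) auto
  have ne: "V \<noteq> {}" using V subspace_0 by blast
  have low: "d \<le> (norm (f - v))\<^sup>2" if "v \<in> V" for v
    unfolding d_def using bdd that by (rule cINF_lower)
  have "\<exists>v\<in>V. (norm (f - v))\<^sup>2 < d + 1 / real (Suc n)" for n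
  proof -
    have "(INF v\<in>V. (norm (f - v))\<^sup>2) < d + 1 / real (Suc n)" by (simp add: d_def)
    then show ?thesis using cINF_less_iff[OF ne bdd] by blast
  qed
  then obtain v where v: "\<And>n. v n \<in> V" "\<And>n. (norm (f - v n))\<^sup>2 < d + 1 / real (Suc n)"
    by metis
  have "Cauchy v"
    by (rule minimizing_sequence_Cauchy[where d=d and f=f])
      (intro low subspace_scale[OF V] subspace_add[OF V] v | rule v)+
  then obtain p where p: "v \<longlonglongrightarrow> p" using Cauchy_convergent convergent_def by blast
  have pV: "p \<in> V" using closed_sequentially[OF cl] v p by blast
  have "(\<lambda>n. (norm (f - v n))\<^sup>2) \<longlonglongrightarrow> (norm (f - p))\<^sup>2" by (intro tendsto_intros p)
  moreover have "(\<lambda>n. d + 1 / real (Suc n)) \<longlonglongrightarrow> d + 0"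
    by (intro tendsto_intros LIMSEQ_Suc[OF lim_1_over_n])
  ultimately have pd: "(norm (f - p))\<^sup>2 \<le> d"
    using v(2) by (intro LIMSEQ_le[of _ _ _ "d"]) (auto intro: less_imp_le)
  have "inner (f - p) h = 0" if h: "h \<in> V" for h
  proof (cases "h = 0")
    case False
    (* the minimiser of the quadratic polynomial t \<mapsto> \<parallel>f - (p + t h)\<parallel>\<^sup>2 *)
    define t where "t = inner (f - p) h / (norm h)\<^sup>2"
    have "(norm (f - p))\<^sup>2 \<le> (norm (f - (p + t *\<^sub>R h)))\<^sup>2"
      using pd low[of "p + t *\<^sub>R h"] subspace_add[OF V pV subspace_scale[OF V h, of t]] by linarith
    also have "\<dots> = (norm (f - p))\<^sup>2 - 2 * t * inner (f - p) h + t\<^sup>2 * (norm h)\<^sup>2"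
      unfolding power2_norm_eq_inner power2_eq_square[of t]
      by (simp add: algebra_simps inner_commute)
    also have "\<dots> = (norm (f - p))\<^sup>2 - (inner (f - p) h)\<^sup>2 / (norm h)\<^sup>2"
      using False by (simp add: t_def power2_eq_square)
    finally have "(inner (f - p) h)\<^sup>2 / (norm h)\<^sup>2 \<le> 0" by simp
    moreover have "(norm h)\<^sup>2 > 0" using False by simp
    ultimately have "(inner (f - p) h)\<^sup>2 \<le> 0" by (simp add: divide_le_0_iff)
    then show ?thesis by simp
  qed simp
  then show ?thesis using pV by (auto simp: orthogonal_def)
qed

lemma orthogonal_projection_onto_unique:
  assumes V: "subspace V" and P: "orthogonal_projection_onto V P" and Q: "orthogonal_projection_onto V Q"
  shows "P = Q"
proof
  fix f
  have d: "P f - Q f \<in> V"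
    using P Q V by (simp add: orthogonal_projection_onto_def subspace_diff)
  then have "inner (f - P f) (P f - Q f) = 0" "inner (f - Q f) (P f - Q f) = 0"
    using P Q by (auto simp: orthogonal_projection_onto_def orthogonal_def)
  then have "inner (P f - Q f) (P f - Q f) = 0" by (simp add: inner_diff_left)
  then show "P f = Q f" by simp
qed

lemma orthogonal_projection_onto_the:
  fixes V :: "'a::{real_inner,complete_space} set"
  assumes "subspace V" "closed V"
  shows "orthogonal_projection_onto V (THE P. orthogonal_projection_onto V P)"
proof -
  obtain P where "\<And>f. P f \<in> V \<and> (\<forall>h\<in>V. orthogonal (f - P f) h)"
    using orthogonal_projection_exists[OF assms] by metis
  then have "orthogonal_projection_onto V P" by (simp add: orthogonal_projection_onto_def)
  then show ?thesis
    using orthogonal_projection_onto_unique[OF assms(1) _ \<open>orthogonal_projection_onto V P\<close>]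
    by (rule theI)
qed

lemma orthogonal_projection_onto_nearest:
  assumes "subspace V" "orthogonal_projection_onto V P" "v \<in> V"
  shows "norm (f - P f) \<le> norm (f - v)"
proof -
  have "orthogonal (f - P f) (P f - v)"
    using assms by (simp add: orthogonal_projection_onto_def subspace_diff)
  then have "(norm (f - v))\<^sup>2 = (norm (f - P f))\<^sup>2 + (norm (P f - v))\<^sup>2"
    using norm_add_Pythagorean[of "f - P f" "P f - v"] by simp
  then show ?thesis by (metis le_add_same_cancel1 norm_ge_zero power2_le_imp_le zero_le_power2)
qed

lemma closure_subspace:
  fixes V :: "'a::real_normed_vector set"
  assumes V: "subspace V"
  shows "subspace (closure V)"
proof (rule subspaceI)
  show "0 \<in> closure V" using subspace_0[OF V] closure_subset by blast
next
  fix x y assume "x \<in> closure V" "y \<in> closure V"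
  then obtain u v where "\<And>n. u n \<in> V" "u \<longlonglongrightarrow> x" "\<And>n. v n \<in> V" "v \<longlonglongrightarrow> y"
    by (auto simp: closure_sequential)
  then show "x + y \<in> closure V" unfolding closure_sequential
    by (intro exI[of _ "\<lambda>n. u n + v n"]) (auto intro: tendsto_add subspace_add[OF V])
next
  fix c x assume "x \<in> closure V"
  then obtain u where "\<And>n. u n \<in> V" "u \<longlonglongrightarrow> x" by (auto simp: closure_sequential)
  then show "c *\<^sub>R x \<in> closure V" unfolding closure_sequential
    by (intro exI[of _ "\<lambda>n. c *\<^sub>R u n"]) (auto intro: tendsto_scaleR subspace_scale[OF V])
qed

text \<open>Projecting onto the closure of \<open>V\<close> leaves a remainder orthogonal to \<open>V\<close>, which must vanish.\<close>

lemma dense_if_orthogonal_complement_trivial: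
  fixes V :: "'a::{real_inner,complete_space} set"
  assumes V: "subspace V" and triv: "\<And>f. (\<And>v. v \<in> V \<Longrightarrow> inner f v = 0) \<Longrightarrow> f = 0"
  shows "closure V = UNIV"
proof -
  have "f \<in> closure V" for f
  proof -
    obtain p where p: "p \<in> closure V" "\<forall>h\<in>closure V. orthogonal (f - p) h"
      using orthogonal_projection_exists[OF closure_subspace[OF V] closed_closure, of f] by (elim bexE)
    have "f - p = 0"
    proof (rule triv)
      fix v assume "v \<in> V"
      then have "v \<in> closure V" by (rule subsetD[OF closure_subset])
      then show "inner (f - p) v = 0" using p(2) by (simp add: orthogonal_def)
    qed
    then show ?thesis using p by simp
  qed
  then show ?thesis by auto
qed

section \<open>Exponentials of bounded operators\<close>

lemma bounded_linear_funpow_bound: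
  fixes T :: "'a::banach \<Rightarrow> 'a"
  assumes T: "bounded_linear T"
  obtains B where "B > 0" "\<And>f. norm (T f) \<le> B * norm f" "\<And>k f. norm ((T ^^ k) f) \<le> B ^ k * norm f"
proof -
  obtain B where B: "B > 0" "\<And>f. norm (T f) \<le> B * norm f"
    using bounded_linear.pos_bounded[OF T] by (auto simp: mult.commute)
  have "norm ((T ^^ k) f) \<le> B ^ k * norm f" for k f
  proof (induction k)
    case (Suc k)
    have "norm ((T ^^ Suc k) f) \<le> B * norm ((T ^^ k) f)" using B by simp
    also have "\<dots> \<le> B * (B ^ k * norm f)" using Suc B by (intro mult_left_mono) auto
    finally show ?case by (simp add: mult.assoc)
  qed simp
  then show thesis using that B by blast
qed

lemma op_exp_sums:
  fixes T :: "'a::banach \<Rightarrow> 'a"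
  assumes T: "bounded_linear T"
  shows "(\<lambda>k. (t ^ k / fact k) *\<^sub>R (T ^^ k) f) sums op_exp T t f"
proof -
  obtain B where B: "B > 0" "\<And>k f. norm ((T ^^ k) f) \<le> B ^ k * norm f"
    using bounded_linear_funpow_bound[OF T] by metis
  have "summable (\<lambda>k. (\<bar>t\<bar> * B) ^ k / fact k * norm f)"
    using summable_exp[of "\<bar>t\<bar> * B"] by (intro summable_mult2) (simp add: divide_inverse mult.commute)
  then have "summable (\<lambda>k. (t ^ k / fact k) *\<^sub>R (T ^^ k) f)"
  proof (rule summable_comparison_test')
    fix k :: nat
    have "norm ((t ^ k / fact k) *\<^sub>R (T ^^ k) f) \<le> (\<bar>t\<bar> ^ k / fact k) * (B ^ k * norm f)"
      using B by (auto simp: power_abs intro!: divide_right_mono mult_left_mono)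
    then show "norm ((t ^ k / fact k) *\<^sub>R (T ^^ k) f) \<le> (\<bar>t\<bar> * B) ^ k / fact k * norm f"
      by (simp add: power_mult_distrib)
  qed
  then show ?thesis by (simp add: op_exp_def summable_sums)
qed

lemma op_exp_0 [simp]: "op_exp T 0 f = f"
proof -
  have "(\<lambda>k. (0 ^ k / fact k) *\<^sub>R (T ^^ k) f) sums (\<Sum>k\<in>{0}. (0 ^ k / fact k) *\<^sub>R (T ^^ k) f)"
    by (rule sums_finite) auto
  then show ?thesis by (simp add: op_exp_def sums_iff)
qed

lemma bounded_linear_funpow: "bounded_linear (T :: 'a::real_normed_vector \<Rightarrow> 'a) \<Longrightarrow> bounded_linear (T ^^ k)"
proof (induction k)
  case 0
  show ?case using bounded_linear_ident by (simp add: id_def)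
next
  case (Suc k)
  have "T ^^ Suc k = (\<lambda>x. T ((T ^^ k) x))" by (simp add: fun_eq_iff)
  then show ?case using bounded_linear_compose[OF Suc.prems Suc.IH[OF Suc.prems]] by simp
qed

lemma op_exp_add:
  fixes T :: "'a::banach \<Rightarrow> 'a"
  assumes T: "bounded_linear T"
  shows "op_exp T t (f + g) = op_exp T t f + op_exp T t g"
proof -
  have "(\<lambda>k. (t ^ k / fact k) *\<^sub>R (T ^^ k) (f + g)) sums (op_exp T t f + op_exp T t g)"
    using sums_add[OF op_exp_sums[OF T] op_exp_sums[OF T], of t f t g]
    by (simp add: bounded_linear_funpow[OF T, THEN bounded_linear.linear, THEN linear_add] scaleR_add_right)
  then show ?thesis using op_exp_sums[OF T] sums_unique2 by blast
qed

lemma op_exp_scaleR: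
  fixes T :: "'a::banach \<Rightarrow> 'a"
  assumes T: "bounded_linear T"
  shows "op_exp T t (c *\<^sub>R f) = c *\<^sub>R op_exp T t f"
proof -
  have "(\<lambda>k. (t ^ k / fact k) *\<^sub>R (T ^^ k) (c *\<^sub>R f)) sums (c *\<^sub>R op_exp T t f)"
    using sums_scaleR_right[OF op_exp_sums[OF T], of c t f]
    by (simp add: bounded_linear_funpow[OF T, THEN bounded_linear.linear, THEN linear_scale] mult.commute)
  then show ?thesis using op_exp_sums[OF T] sums_unique2 by blast
qed

lemma op_exp_commute:
  fixes T :: "'a::banach \<Rightarrow> 'a"
  assumes T: "bounded_linear T"
  shows "op_exp T t (T f) = T (op_exp T t f)"
proof -
  have "(\<lambda>k. T ((t ^ k / fact k) *\<^sub>R (T ^^ k) f)) sums T (op_exp T t f)"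
    by (rule bounded_linear.sums[OF T op_exp_sums[OF T]])
  then have "(\<lambda>k. (t ^ k / fact k) *\<^sub>R (T ^^ k) (T f)) sums T (op_exp T t f)"
    by (simp add: linear_scale[OF bounded_linear.linear[OF T]] funpow_swap1)
  then show ?thesis using op_exp_sums[OF T] sums_unique2 by blast
qed

text \<open>Termwise differentiation of the power series, justified on the ball of radius \<open>|t| + 1\<close> by the Weierstrass
M-test: the differentiated terms are dominated by a shifted exponential series.\<close>

lemma op_exp_has_derivative:
  fixes T :: "'a::banach \<Rightarrow> 'a"
  assumes T: "bounded_linear T"
  shows "((\<lambda>t. op_exp T t f) has_vector_derivative T (op_exp T t f)) (at t)"
proof -
  obtain B where B: "B > 0" "\<And>k f. norm ((T ^^ k) f) \<le> B ^ k * norm f"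
    using bounded_linear_funpow_bound[OF T] by metis
  define r where "r = \<bar>t\<bar> + 1"
  define S where "S = ball (0::real) r"
  have tS: "t \<in> S" and r: "r > 0" by (auto simp: S_def r_def)
  define c where "c k s = (if k = 0 then 0 else s ^ (k - 1) / fact (k - 1)) *\<^sub>R (T ^^ k) f" for k and s :: real
  have csum: "(\<lambda>k. c k s) sums T (op_exp T s f)" for s
  proof -
    have "(\<lambda>k. c (Suc k) s) sums T (op_exp T s f)"
      using bounded_linear.sums[OF T op_exp_sums[OF T], of s f]
      by (simp add: c_def linear_scale[OF bounded_linear.linear[OF T]])
    then show ?thesis using sums_Suc_iff[of "\<lambda>k. c k s"] by (simp add: c_def)
  qed
  define m where "m k = (if k = 0 then 0 else r ^ (k - 1) / fact (k - 1)) * (B ^ k * norm f)" for k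
  have "summable (\<lambda>k. (r * B) ^ k / fact k * (B * norm f))"
    using summable_exp[of "r * B"] by (intro summable_mult2) (simp add: divide_inverse mult.commute)
  then have "summable (\<lambda>k. m (Suc k))" by (simp add: m_def power_mult_distrib mult_ac)
  then have msum: "summable m" by (simp add: summable_Suc_iff)
  have unif: "uniform_limit S (\<lambda>n s. \<Sum>k<n. c k s) (\<lambda>s. \<Sum>k. c k s) sequentially"
  proof (rule Weierstrass_m_test[OF _ msum])
    fix k s assume "s \<in> S"
    then have s: "\<bar>s\<bar> \<le> r" by (simp add: S_def)
    have "norm (c k s) = (if k = 0 then 0 else \<bar>s\<bar> ^ (k - 1) / fact (k - 1)) * norm ((T ^^ k) f)"
      by (auto simp: c_def power_abs)
    also have "\<dots> \<le> m k" unfolding m_def using s B r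
      by (intro mult_mono) (auto intro!: divide_right_mono power_mono)
    finally show "norm (c k s) \<le> m k" .
  qed
  have "\<exists>g. \<forall>x\<in>S. (\<lambda>k. (x ^ k / fact k) *\<^sub>R (T ^^ k) f) sums g x \<and>
      (g has_derivative (\<lambda>h. h *\<^sub>R T (op_exp T x f))) (at x within S)"
  proof (rule has_derivative_series[where f' = "\<lambda>k x h. h *\<^sub>R c k x"])
    show "convex S" by (simp add: S_def)
    show "((\<lambda>x. (x ^ k / fact k) *\<^sub>R (T ^^ k) f) has_derivative (\<lambda>h. h *\<^sub>R c k x)) (at x within S)"
      for k x
    proof -
      have "((\<lambda>x. x ^ k / fact k) has_real_derivative (if k = 0 then 0 else x ^ (k - 1) / fact (k - 1))) (at x within S)"
      proof (cases k)
        case (Suc j)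
        have "((\<lambda>x. x ^ Suc j / fact (Suc j)) has_real_derivative (real (Suc j) * x ^ j) / fact (Suc j)) (at x within S)"
          using DERIV_cdivide[OF DERIV_pow[of "Suc j" x S], of "fact (Suc j)"] by simp
        then show ?thesis using Suc by (simp del: of_nat_Suc)
      qed simp
      then show ?thesis
        unfolding c_def has_real_derivative_iff_has_vector_derivative has_vector_derivative_def
        by (drule_tac has_derivative_scaleR_left[where x="(T ^^ k) f"]) simp
    qed
    fix e :: real assume "e > 0"
    then have "\<forall>\<^sub>F n in sequentially. \<forall>s\<in>S. dist (\<Sum>k<n. c k s) (\<Sum>k. c k s) < e"
      using unif by (auto simp: uniform_limit_iff)
    then show "\<forall>\<^sub>F n in sequentially. \<forall>x\<in>S. \<forall>h. norm ((\<Sum>i<n. h *\<^sub>R c i x) - h *\<^sub>R T (op_exp T x f)) \<le> e * norm h"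
    proof (rule eventually_mono, intro ballI allI)
      fix n x h assume *: "\<forall>s\<in>S. dist (\<Sum>k<n. c k s) (\<Sum>k. c k s) < e" "x \<in> S"
      have "(\<Sum>i<n. h *\<^sub>R c i x) - h *\<^sub>R T (op_exp T x f) = h *\<^sub>R ((\<Sum>i<n. c i x) - (\<Sum>k. c k x))"
        using sums_unique[OF csum] by (simp add: scaleR_sum_right scaleR_diff_right)
      also have "norm \<dots> = norm h * norm ((\<Sum>i<n. c i x) - (\<Sum>k. c k x))" by simp
      also have "\<dots> \<le> norm h * e"
      proof (rule mult_left_mono)
        show "norm ((\<Sum>i<n. c i x) - (\<Sum>k. c k x)) \<le> e"
          using bspec[OF *] by (simp add: dist_norm)
      qed simp
      finally show "norm ((\<Sum>i<n. h *\<^sub>R c i x) - h *\<^sub>R T (op_exp T x f)) \<le> e * norm h"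
        by (simp add: mult.commute)
    qed
  qed (use tS op_exp_sums[OF T] in auto)
  then obtain g where g: "\<And>x. x \<in> S \<Longrightarrow> (\<lambda>k. (x ^ k / fact k) *\<^sub>R (T ^^ k) f) sums g x"
     "(g has_derivative (\<lambda>h. h *\<^sub>R T (op_exp T t f))) (at t within S)" using tS by blast
  have gS: "g x = op_exp T x f" if "x \<in> S" for x
    using g(1)[OF that] op_exp_sums[OF T] sums_unique2 by blast
  have "open S" by (simp add: S_def)
  have "(g has_derivative (\<lambda>h. h *\<^sub>R T (op_exp T t f))) (at t)"
    using g(2) at_within_open[OF tS \<open>open S\<close>] by simp
  then have "((\<lambda>t. op_exp T t f) has_derivative (\<lambda>h. h *\<^sub>R T (op_exp T t f))) (at t)"
    by (rule has_derivative_transform_within_open[OF _ \<open>open S\<close> tS]) (simp add: gS)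
  then show ?thesis by (simp add: has_vector_derivative_def)
qed

lemma op_exp_symmetric:
  fixes T :: "'a::{real_inner,banach} \<Rightarrow> 'a"
  assumes T: "bounded_linear T" and sym: "\<And>f g. inner (T f) g = inner f (T g)"
  shows "inner (op_exp T t f) g = inner f (op_exp T t g)"
proof -
  have pow: "inner ((T ^^ k) f) g = inner f ((T ^^ k) g)" for k
    by (induction k arbitrary: f) (auto simp: sym funpow_swap1)
  have "(\<lambda>k. inner ((t ^ k / fact k) *\<^sub>R (T ^^ k) f) g) sums inner (op_exp T t f) g"
    by (rule bounded_linear.sums[OF bounded_linear_inner_left op_exp_sums[OF T]])
  moreover have "(\<lambda>k. inner f ((t ^ k / fact k) *\<^sub>R (T ^^ k) g)) sums inner f (op_exp T t g)"
    by (rule bounded_linear.sums[OF bounded_linear_inner_right op_exp_sums[OF T]])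
  ultimately show ?thesis by (simp add: pow sums_unique2)
qed

section \<open>Semigroups generated by symmetric nonpositive operators\<close>

text \<open>The derivative of \<open>\<parallel>w\<parallel>\<^sup>2\<close> is \<open>2 \<langle>T w, w\<rangle> \<le> 0\<close>. Besides the contraction property this gives uniqueness
for the differential equation \<open>w' = T w\<close>, since \<open>w 0 = 0\<close> forces \<open>w = 0\<close>.\<close>

lemma norm_nonincreasing_if_dissipative:
  fixes w :: "real \<Rightarrow> 'a::real_inner"
  assumes w: "\<And>t. t \<ge> 0 \<Longrightarrow> (w has_vector_derivative T (w t)) (at t)"
    and neg: "\<And>f. inner (T f) f \<le> 0" and t: "0 \<le> t"
  shows "norm (w t) \<le> norm (w 0)"
proof -
  have "((\<lambda>t. inner (w t) (w t)) has_real_derivative 2 * inner (T (w s)) (w s)) (at s)" if "s \<ge> 0" for s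
  proof -
    have "((\<lambda>t. inner (w t) (w t)) has_vector_derivative (inner (w s) (T (w s)) + inner (T (w s)) (w s))) (at s)"
      using bounded_bilinear.has_vector_derivative[OF bounded_bilinear_inner w[OF that] w[OF that]] .
    then show ?thesis by (simp add: has_real_derivative_iff_has_vector_derivative inner_commute)
  qed
  moreover have "2 * inner (T (w s)) (w s) \<le> 0" for s using neg[of "w s"] by simp
  ultimately have "\<exists>y. ((\<lambda>t. inner (w t) (w t)) has_real_derivative y) (at s) \<and> y \<le> 0" if "s \<ge> 0" for s
    using that by blast
  then have "inner (w t) (w t) \<le> inner (w 0) (w 0)"
    using t by (intro DERIV_nonpos_imp_nonincreasing[of 0 t "\<lambda>t. inner (w t) (w t)"]) auto
  then show ?thesis by (simp add: norm_eq_sqrt_inner)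
qed

context
  fixes T :: "'a::{real_inner,banach} \<Rightarrow> 'a"
  assumes T: "bounded_linear T"
    and sym: "\<And>f g. inner (T f) g = inner f (T g)"
    and neg: "\<And>f. inner (T f) f \<le> 0"
begin

lemma op_exp_contraction: "t \<ge> 0 \<Longrightarrow> norm (op_exp T t f) \<le> norm f"
  using norm_nonincreasing_if_dissipative[of "\<lambda>t. op_exp T t f" T t] op_exp_has_derivative[OF T] neg
  by simp

text \<open>Both sides solve \<open>w' = T w\<close> in the variable \<open>s\<close> and agree at \<open>s = 0\<close>.\<close>

lemma op_exp_semigroup:
  assumes s: "s \<ge> 0" and t: "t \<ge> 0"
  shows "op_exp T (s + t) f = op_exp T s (op_exp T t f)"
proof -
  define w where "w r = op_exp T (r + t) f - op_exp T r (op_exp T t f)" for r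
  have "(w has_vector_derivative T (w r)) (at r)" for r
  proof -
    have "((\<lambda>r. op_exp T (r + t) f) has_vector_derivative T (op_exp T (r + t) f)) (at r)"
    proof -
      have "((\<lambda>r. r + t) has_vector_derivative 1) (at r)" by (auto intro!: derivative_eq_intros)
      from vector_diff_chain_at[OF this op_exp_has_derivative[OF T, of f "r + t"]]
      show ?thesis by (simp add: comp_def)
    qed
    then show ?thesis unfolding w_def
      by (auto intro!: derivative_eq_intros op_exp_has_derivative[OF T]
          simp: linear_diff[OF bounded_linear.linear[OF T]])
  qed
  then have "norm (w s) \<le> norm (w 0)" using neg s by (intro norm_nonincreasing_if_dissipative) auto
  then show ?thesis by (simp add: w_def)
qed

lemma bounded_linear_op_exp: "t \<ge> 0 \<Longrightarrow> bounded_linear (op_exp T t)"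
  by (rule bounded_linear_intro[of _ 1])
    (auto simp: op_exp_add[OF T] op_exp_scaleR[OF T] op_exp_contraction)

lemma contraction_semigroup_op_exp: "contraction_semigroup (op_exp T)"
  unfolding contraction_semigroup_def
proof (intro conjI allI impI)
  show "continuous_on {0..} (\<lambda>t. op_exp T t f)" for f
    using op_exp_has_derivative[OF T] by (intro continuous_at_imp_continuous_on ballI has_vector_derivative_continuous)
qed (auto intro: bounded_linear_op_exp op_exp_contraction op_exp_semigroup)

lemma generates_op_exp: "generates T (op_exp T)"
proof -
  have "((\<lambda>t. (op_exp T t f - f) /\<^sub>R t) \<longlongrightarrow> T f) (at_right 0)" for f
  proof -
    have "((\<lambda>t. op_exp T t f) has_vector_derivative T f) (at 0 within {0<..})"
      using op_exp_has_derivative[OF T, of f 0] by (simp add: has_vector_derivative_at_within)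
    then have "((\<lambda>t. norm (op_exp T t f - f - t *\<^sub>R T f) / \<bar>t\<bar>) \<longlongrightarrow> 0) (at_right 0)"
      unfolding has_vector_derivative_def has_derivative_iff_norm by simp
    moreover have "\<forall>\<^sub>F t in at_right 0. norm (op_exp T t f - f - t *\<^sub>R T f) / \<bar>t\<bar> = norm ((op_exp T t f - f) /\<^sub>R t - T f)"
      using eventually_at_right_less[of "0::real"]
    proof eventually_elim
      case (elim t)
      have "(op_exp T t f - f) /\<^sub>R t - T f = (op_exp T t f - f - t *\<^sub>R T f) /\<^sub>R t"
        using elim by (simp add: scaleR_diff_right)
      moreover have "\<bar>inverse t\<bar> = 1 / \<bar>t\<bar>" by (simp add: divide_inverse)
      ultimately show ?case by (simp only: norm_scaleR) simp
    qed
    ultimately have "((\<lambda>t. norm ((op_exp T t f - f) /\<^sub>R t - T f)) \<longlongrightarrow> 0) (at_right 0)"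
      by (rule Lim_transform_eventually)
    from tendsto_norm_zero_cancel[OF this] show ?thesis by (rule LIM_zero_cancel)
  qed
  then show ?thesis by (simp add: generates_def)
qed

text \<open>The constant is optimal: \<open>\<lambda> exp (-2 \<lambda> s)\<close> has maximum \<open>1 / (2 e s)\<close> over \<open>\<lambda> \<ge> 0\<close>, attained at
\<open>\<lambda> = 1/(2s)\<close>. This value enters as the shift \<open>a\<close>, and convexity of the shifted energy \<open>\<psi>\<close> replaces
the maximisation over the spectrum: its tangent at \<open>s\<close> lies below \<open>\<psi> 0 = \<parallel>f\<parallel>\<^sup>2\<close> at \<open>0\<close>, and with this
\<open>a\<close> only the quadratic form survives in that tangent value.\<close>

lemma op_exp_form_decay:
  assumes s: "s > 0"
  shows "- inner (T (op_exp T s f)) (op_exp T s f) \<le> (norm f)\<^sup>2 / (2 * exp 1 * s)"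
proof -
  define u where "u r = op_exp T r f" for r
  define a where "a = 1 / (2 * s)"
  define \<psi> where "\<psi> r = exp (2 * a * r) * inner (u r) (u r)" for r
  define B where "B r = a *\<^sub>R u r + T (u r)" for r
  define \<psi>' where "\<psi>' r = 2 * exp (2 * a * r) * inner (B r) (u r)" for r
  define \<psi>'' where "\<psi>'' r = 4 * exp (2 * a * r) * (norm (B r))\<^sup>2" for r
  have u': "(u has_vector_derivative T (u r)) (at r)" for r
    unfolding u_def by (rule op_exp_has_derivative[OF T])
  have Tu': "((\<lambda>r. T (u r)) has_vector_derivative T (T (u r))) (at r)" for r
    using bounded_linear.has_vector_derivative[OF T u'] .
  have inner': "((\<lambda>r. inner (p r) (q r)) has_real_derivative (inner (p r) q' + inner p' (q r))) (at r)"
    if "(p has_vector_derivative p') (at r)" "(q has_vector_derivative q') (at r)" for p q p' q' r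
    using bounded_bilinear.has_vector_derivative[OF bounded_bilinear_inner that]
    by (simp add: has_real_derivative_iff_has_vector_derivative)
  have d1: "(\<psi> has_real_derivative \<psi>' r) (at r)" for r
    unfolding \<psi>_def
    by (rule derivative_eq_intros inner'[OF u' u'] refl)+
       (simp add: \<psi>'_def B_def inner_add_left inner_commute algebra_simps)
  have d2: "(\<psi>' has_real_derivative \<psi>'' r) (at r)" for r
  proof -
    have "((\<lambda>r. B r) has_vector_derivative (a *\<^sub>R T (u r) + T (T (u r)))) (at r)"
      unfolding B_def by (auto intro!: derivative_eq_intros u' Tu')
    note B' = inner'[OF this u']
    show ?thesis unfolding \<psi>'_def
      by (rule derivative_eq_intros B' refl)+
        (simp add: \<psi>''_def B_def power2_norm_eq_inner inner_add_left inner_add_right sym inner_commute algebra_simps)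
  qed
  (* r \<mapsto> \<psi> r - r \<psi>' r is the value at 0 of the tangent at r; it decreases since its derivative
     is - r \<psi>'' r. *)
  have "\<psi> s - s * \<psi>' s \<le> \<psi> 0 - 0 * \<psi>' 0"
  proof (rule DERIV_nonpos_imp_nonincreasing[of 0 s "\<lambda>r. \<psi> r - r * \<psi>' r"])
    fix r assume r: "0 \<le> r" "r \<le> s"
    have "((\<lambda>r. \<psi> r - r * \<psi>' r) has_real_derivative - r * \<psi>'' r) (at r)"
      by (rule derivative_eq_intros d1 d2 refl)+ simp
    moreover have "- r * \<psi>'' r \<le> 0" using r by (simp add: \<psi>''_def)
    ultimately show "\<exists>y. ((\<lambda>r. \<psi> r - r * \<psi>' r) has_real_derivative y) (at r) \<and> y \<le> 0" by blast
  qed (use s in auto)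
  moreover have "\<psi> s - s * \<psi>' s = - (2 * exp 1 * s * inner (T (u s)) (u s))"
    using s by (simp add: \<psi>_def \<psi>'_def B_def a_def inner_add_left field_simps)
  moreover have "\<psi> 0 = (norm f)\<^sup>2" by (simp add: \<psi>_def u_def power2_norm_eq_inner)
  ultimately show ?thesis using s by (simp add: u_def field_simps)
qed

text \<open>The form is semidefinite on the plane spanned by \<open>f\<close> and \<open>g\<close>, so its determinant there is nonnegative. When
\<open>\<langle>T g, g\<rangle> = 0\<close> the restriction is affine in the coefficient of \<open>g\<close>, and boundedness above kills the mixed term.\<close>

lemma symmetric_nonpositive_Cauchy_Schwarz:
  "(inner (T f) g)\<^sup>2 \<le> inner (T f) f * inner (T g) g"
proof -
  have q: "a\<^sup>2 * inner (T f) f + 2 * a * b * inner (T f) g + b\<^sup>2 * inner (T g) g \<le> 0" for a b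
    using neg[of "a *\<^sub>R f + b *\<^sub>R g"] sym[of g f]
    by (simp add: linear_add[OF bounded_linear.linear[OF T]] linear_scale[OF bounded_linear.linear[OF T]]
        inner_add_left inner_add_right power2_eq_square algebra_simps inner_commute)
  show ?thesis
  proof (cases "inner (T g) g = 0")
    case True
    have "inner (T f) g = 0"
    proof (rule ccontr)
      assume n: "inner (T f) g \<noteq> 0"
      show False
        using q[of 1 "(1 - inner (T f) f) / (2 * inner (T f) g)"] n True by (simp add: field_simps)
    qed
    then show ?thesis using True by simp
  next
    case False
    then have lt: "inner (T g) g < 0" using neg[of g] by simp
    have "inner (T g) g * (inner (T f) f * inner (T g) g - (inner (T f) g)\<^sup>2) \<le> 0"
      using q[of "inner (T g) g" "- inner (T f) g"] by (simp add: power2_eq_square algebra_simps)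
    then show ?thesis using lt by (simp add: mult_le_0_iff)
  qed
qed

lemma kernel_if_form_zero: "inner (T f) f = 0 \<Longrightarrow> T f = 0"
  using symmetric_nonpositive_Cauchy_Schwarz[of f "T f"] by simp

text \<open>Let \<open>y = T (exp (t T) f)\<close>. Moving half of the time to the other side gives
\<open>\<parallel>y\<parallel>\<^sup>2 = \<langle>T (H f), H y\<rangle>\<close> with \<open>H = exp ((t/2) T)\<close>; Cauchy-Schwarz for the form and the form decay at time
\<open>t/2\<close>, applied to \<open>f\<close> and to \<open>y\<close>, bound this by \<open>\<parallel>f\<parallel> \<parallel>y\<parallel> / (e t)\<close>.\<close>

lemma op_exp_decay:
  assumes t: "t > 0"
  shows "norm (T (op_exp T t f)) \<le> norm f / (exp 1 * t)"
proof -
  define c where "c = 1 / (exp 1 * t)"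
  have c: "c > 0" using t by (simp add: c_def)
  define H where "H f = op_exp T (t / 2) f" for f
  have HH: "op_exp T t f = H (H f)" for f
    using op_exp_semigroup[of "t / 2" "t / 2"] t by (simp add: H_def)
  have form: "- inner (T (H f)) (H f) \<le> c * (norm f)\<^sup>2" for f
    using op_exp_form_decay[of "t / 2" f] t by (simp add: H_def c_def mult.commute)
  define y where "y = T (op_exp T t f)"
  have "inner (T (H f)) (H y) = inner y y"
    using op_exp_symmetric[OF T sym, of "t / 2" "T (H f)" y] op_exp_commute[OF T, of "t / 2" "H f"]
    by (simp add: y_def HH) (simp add: H_def)
  then have "(norm y)\<^sup>2 * (norm y)\<^sup>2 = (inner (T (H f)) (H y))\<^sup>2"
    unfolding power2_norm_eq_inner by (simp only: power2_eq_square)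
  also have "\<dots> \<le> inner (T (H f)) (H f) * inner (T (H y)) (H y)"
    by (rule symmetric_nonpositive_Cauchy_Schwarz)
  also have "\<dots> = (- inner (T (H f)) (H f)) * (- inner (T (H y)) (H y))" by simp
  also have "\<dots> \<le> (c * (norm f)\<^sup>2) * (c * (norm y)\<^sup>2)"
    using form neg c by (intro mult_mono) auto
  finally have *: "(norm y)\<^sup>2 * (norm y)\<^sup>2 \<le> (c * norm f)\<^sup>2 * (norm y)\<^sup>2"
    by (simp add: power_mult_distrib power2_eq_square mult_ac)
  have "norm y \<le> c * norm f"
  proof (cases "y = 0")
    case False
    then have "(norm y)\<^sup>2 \<le> (c * norm f)\<^sup>2" using mult_right_le_imp_le[OF *] by simp
    then show ?thesis by (rule power2_le_imp_le) (use c in simp)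
  qed (use c in simp)
  then show ?thesis by (simp add: y_def c_def)
qed

lemma subspace_ker: "subspace (ker T)" and closed_ker: "closed (ker T)"
proof -
  show "subspace (ker T)" unfolding ker_def
    by (rule subspaceI) (auto simp: linear_0[OF bounded_linear.linear[OF T]]
      linear_add[OF bounded_linear.linear[OF T]] linear_scale[OF bounded_linear.linear[OF T]])
  have "continuous_on UNIV T" by (simp add: T linear_continuous_on)
  then show "closed (ker T)" unfolding ker_def
    using continuous_closed_vimage[of "{0}" T] by (auto simp: vimage_def continuous_on_eq_continuous_at)
qed

text \<open>For symmetric \<open>T\<close> the remainder \<open>f - p\<close> of the projection onto the closed range is in the kernel, because
\<open>\<parallel>T (f - p)\<parallel>\<^sup>2 = \<langle>f - p, T (T (f - p))\<rangle> = 0\<close>. So \<open>f - p\<close> is orthogonal both to \<open>f\<close> and to \<open>p\<close>.\<close>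

lemma orthogonal_kernel_in_closure_range:
  assumes f: "\<And>k. T k = 0 \<Longrightarrow> inner f k = 0"
  shows "f \<in> closure (range T)"
proof -
  have sub: "subspace (range T)"
    using linear_subspace_image[OF bounded_linear.linear[OF T] subspace_UNIV] .
  obtain p where p: "p \<in> closure (range T)" "\<forall>h\<in>closure (range T). orthogonal (f - p) h"
    using orthogonal_projection_exists[OF closure_subspace[OF sub] closed_closure, of f] by (elim bexE)
  have "inner (T (f - p)) (T (f - p)) = inner (f - p) (T (T (f - p)))" by (rule sym)
  also have "\<dots> = 0"
  proof -
    have "T (T (f - p)) \<in> closure (range T)" by (rule subsetD[OF closure_subset rangeI])
    from bspec[OF p(2) this] show ?thesis unfolding orthogonal_def .
  qed
  finally have "T (f - p) = 0" by simp
  then have "inner f (f - p) = 0" by (rule f)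
  moreover have "inner (f - p) p = 0" using p by (simp add: orthogonal_def)
  ultimately have "inner (f - p) (f - p) = 0" by (simp add: inner_diff_left inner_diff_right inner_commute)
  then show ?thesis using p(1) by simp
qed

text \<open>On the range the decay estimate gives the rate \<open>\<parallel>h\<parallel> / (e t)\<close> at \<open>T h\<close>, and the contraction property
carries the convergence over to its closure.\<close>

lemma op_exp_tendsto_0:
  assumes f: "\<And>k. T k = 0 \<Longrightarrow> inner f k = 0"
  shows "((\<lambda>t. norm (op_exp T t f)) \<longlongrightarrow> 0) at_top"
proof (rule tendstoI)
  fix e :: real assume e: "e > 0"
  have "f \<in> closure (range T)" by (rule orthogonal_kernel_in_closure_range) (rule f)
  then obtain h where h: "dist (T h) f < e / 2"
    using e unfolding closure_approachable by (auto dest!: spec[of _ "e / 2"])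
  (* from this time on the decay estimate for T h is below e / 2 *)
  define t0 where "t0 = 2 * norm h / (exp 1 * e) + 1"
  show "\<forall>\<^sub>F t in at_top. dist (norm (op_exp T t f)) 0 < e"
    using eventually_ge_at_top[of t0]
  proof eventually_elim
    case (elim t)
    have t0: "t0 > 0" using e by (simp add: t0_def add_nonneg_pos)
    then have t: "t > 0" using elim by simp
    have "op_exp T t f = op_exp T t (f - T h) + op_exp T t (T h)"
      using op_exp_add[OF T, of t "f - T h" "T h"] by simp
    then have "norm (op_exp T t f) \<le> norm (op_exp T t (f - T h)) + norm (op_exp T t (T h))"
      by (simp add: norm_triangle_ineq)
    also have "norm (op_exp T t (f - T h)) < e / 2"
      using op_exp_contraction[of t "f - T h"] t h by (simp add: dist_norm norm_minus_commute)
    also have "norm (op_exp T t (T h)) \<le> norm h / (exp 1 * t)"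
      using op_exp_decay[OF t, of h] by (simp add: op_exp_commute[OF T])
    also have "norm h / (exp 1 * t) \<le> e / 2"
    proof -
      have "2 * norm h / (exp 1 * e) \<le> t" using elim by (simp add: t0_def)
      then show ?thesis using e t by (simp add: field_simps)
    qed
    finally show ?case by simp
  qed
qed

end

section \<open>Square integrable functions and completeness\<close>

lemma sets_wmeasure [simp, measurable_cong]: "sets wmeasure = sets borel"
  by (simp add: wmeasure_def)

lemma space_wmeasure [simp]: "space wmeasure = UNIV"
  by (simp add: wmeasure_def)

lemma square_integrable_borel: "square_integrable f \<Longrightarrow> f \<in> borel_measurable borel"
  by (simp add: square_integrable_def measurable_cong_sets[OF sets_wmeasure refl])

lemma AE_wmeasure_iff: "(AE x in wmeasure. P x) \<longleftrightarrow> (AE x in lborel. x > 0 \<longrightarrow> P x)"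
  unfolding wmeasure_def
  by (subst AE_density) (auto simp: indicator_def intro!: AE_cong split: if_splits)

lemma nn_integral_wmeasure:
  assumes [measurable]: "f \<in> borel_measurable borel"
  shows "(\<integral>\<^sup>+x. f x \<partial>wmeasure) = (\<integral>\<^sup>+x. ennreal (indicator {0<..} x * sqrt x) * f x \<partial>lborel)"
  unfolding wmeasure_def by (subst nn_integral_density) auto

lemma square_integrable_rep [simp]: "square_integrable (rep_wL2 f)"
  using Quotient_rep_reflp[OF Quotient_wL2, of f] by (simp add: l2_rel_def)

lemma L2_class_rep [simp]: "L2_class (rep_wL2 f) = f"
  unfolding L2_class_def by (rule Quotient_abs_rep[OF Quotient_wL2])

lemma AE_rep_L2_class: "square_integrable f \<Longrightarrow> AE x in wmeasure. rep_wL2 (L2_class f) x = f x"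
  using Quotient_rep_abs[OF Quotient_wL2, of f] by (simp add: l2_rel_def L2_class_def)

text \<open>With \<open>L2_class_rep\<close>, \<open>AE_rep_L2_class\<close> and \<open>L2_class_arith\<close> this is the interface to the quotient type: from
here on vectors are handled through square integrable representatives.\<close>

lemma L2_class_eqI:
  "square_integrable f \<Longrightarrow> square_integrable g \<Longrightarrow> (AE x in wmeasure. f x = g x) \<Longrightarrow> L2_class f = L2_class g"
  unfolding L2_class_def by (rule Quotient_rel_abs[OF Quotient_wL2]) (simp add: l2_rel_def)

lemma L2_class_arith:
  assumes "square_integrable f" "square_integrable g"
  shows "L2_class f + L2_class g = L2_class (\<lambda>x. f x + g x)"
    "L2_class f - L2_class g = L2_class (\<lambda>x. f x - g x)"
    "- L2_class f = L2_class (\<lambda>x. - f x)"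
    "c *\<^sub>R L2_class f = L2_class (\<lambda>x. c * f x)"
    "0 = L2_class (\<lambda>x. 0)"
    "inner (L2_class f) (L2_class g) = (LINT x|wmeasure. f x * g x)"
  using assms
  by (auto simp: L2_class_def plus_wL2.abs_eq minus_wL2.abs_eq uminus_wL2.abs_eq scaleR_wL2.abs_eq
      zero_wL2.abs_eq inner_wL2.abs_eq l2_rel_def eq_onp_def)

lemma norm_L2_class:
  assumes "square_integrable f"
  shows "(norm (L2_class f))\<^sup>2 = (LINT x|wmeasure. (f x)\<^sup>2)"
  unfolding power2_norm_eq_inner by (simp add: L2_class_arith[OF assms assms] power2_eq_square)

lemma square_integrable_iff_nn_integral:
  "square_integrable f \<longleftrightarrow> f \<in> borel_measurable borel \<and> (\<integral>\<^sup>+x. ennreal ((f x)\<^sup>2) \<partial>wmeasure) < \<infinity>"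
proof -
  have "integrable wmeasure (\<lambda>x. (f x)\<^sup>2) \<longleftrightarrow> (\<integral>\<^sup>+x. ennreal ((f x)\<^sup>2) \<partial>wmeasure) < \<infinity>"
    if "f \<in> borel_measurable borel"
    using that by (simp add: integrable_iff_bounded)
  then show ?thesis by (auto simp: square_integrable_def measurable_cong_sets[OF sets_wmeasure refl])
qed

lemma nn_integral_norm_L2_class:
  assumes "square_integrable f"
  shows "(\<integral>\<^sup>+x. ennreal ((f x)\<^sup>2) \<partial>wmeasure) = ennreal ((norm (L2_class f))\<^sup>2)"
  using assms by (subst nn_integral_eq_integral) (auto simp: norm_L2_class square_integrable_def)

text \<open>Bounds on functions are obtained as inequalities between nonnegative integrals; this converts them into
membership in the space and a bound on the norm.\<close>

lemma norm_L2_class_le: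
  assumes f: "f \<in> borel_measurable borel" and le: "(\<integral>\<^sup>+x. ennreal ((f x)\<^sup>2) \<partial>wmeasure) \<le> ennreal (c\<^sup>2)"
    and c: "c \<ge> 0"
  shows "square_integrable f" "norm (L2_class f) \<le> c"
proof -
  show sq: "square_integrable f"
    using f le by (auto simp: square_integrable_iff_nn_integral intro: le_less_trans)
  have "(norm (L2_class f))\<^sup>2 \<le> c\<^sup>2"
    using le nn_integral_norm_L2_class[OF sq] by (simp add: ennreal_le_iff)
  then show "norm (L2_class f) \<le> c" using c by (rule power2_le_imp_le)
qed

lemma square_integrable_abs: "square_integrable f \<Longrightarrow> square_integrable (\<lambda>x. \<bar>f x\<bar>)"
  unfolding square_integrable_iff_nn_integral by (auto intro: borel_measurable_abs)

lemma norm_L2_class_abs: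
  assumes "square_integrable f"
  shows "norm (L2_class (\<lambda>x. \<bar>f x\<bar>)) = norm (L2_class f)"
proof -
  have "(norm (L2_class (\<lambda>x. \<bar>f x\<bar>)))\<^sup>2 = (norm (L2_class f))\<^sup>2"
    using assms by (simp add: norm_L2_class square_integrable_abs)
  then show ?thesis by simp
qed

lemma square_integrable_sum:
  assumes "\<And>k. k \<in> A \<Longrightarrow> square_integrable (f k)"
  shows "square_integrable (\<lambda>x. \<Sum>k\<in>A. f k x)" "L2_class (\<lambda>x. \<Sum>k\<in>A. f k x) = (\<Sum>k\<in>A. L2_class (f k))"
proof -
  have "square_integrable (\<lambda>x. \<Sum>k\<in>A. f k x) \<and> L2_class (\<lambda>x. \<Sum>k\<in>A. f k x) = (\<Sum>k\<in>A. L2_class (f k))"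
    using assms
  proof (induction A rule: infinite_finite_induct)
    case (insert a A)
    then show ?case
      using square_integrable_add[of "f a" "\<lambda>x. \<Sum>k\<in>A. f k x"] L2_class_arith(1)[of "f a" "\<lambda>x. \<Sum>k\<in>A. f k x"]
      by simp
  qed (simp_all add: square_integrable_zero L2_class_arith(5)[OF square_integrable_zero square_integrable_zero])
  then show "square_integrable (\<lambda>x. \<Sum>k\<in>A. f k x)" "L2_class (\<lambda>x. \<Sum>k\<in>A. f k x) = (\<Sum>k\<in>A. L2_class (f k))"
    by auto
qed

text \<open>The sum of \<open>|f (k+1) - f k|\<close> has norm at most \<open>2\<close>, by monotone convergence, so it is finite almost everywhere
and the telescoping series converges there.\<close>

lemma fast_Cauchy_AE_convergent:
  assumes sq: "\<And>n. square_integrable (f n)"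
    and fast: "\<And>n. norm (L2_class (f (Suc n)) - L2_class (f n)) \<le> (1/2) ^ n"
  shows "AE x in wmeasure. convergent (\<lambda>n. f n x)"
proof -
  note [measurable] = square_integrable_borel[OF sq]
  define G where "G N x = (\<Sum>k<N. \<bar>f (Suc k) x - f k x\<bar>)" for N x
  have d: "square_integrable (\<lambda>x. f (Suc k) x - f k x)" for k
    by (rule square_integrable_diff[OF sq sq])
  have [measurable]: "G N \<in> borel_measurable borel" for N unfolding G_def by measurable
  have bound: "(\<integral>\<^sup>+x. ennreal ((G N x)\<^sup>2) \<partial>wmeasure) \<le> ennreal 4" for N
  proof -
    have sG: "square_integrable (G N)" and "L2_class (G N) = (\<Sum>k<N. L2_class (\<lambda>x. \<bar>f (Suc k) x - f k x\<bar>))"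
      using square_integrable_sum[of "{..<N}" "\<lambda>k x. \<bar>f (Suc k) x - f k x\<bar>"] square_integrable_abs[OF d]
      by (auto simp: G_def[abs_def])
    then have "norm (L2_class (G N)) \<le> (\<Sum>k<N. norm (L2_class (\<lambda>x. \<bar>f (Suc k) x - f k x\<bar>)))"
      by (simp add: norm_sum)
    also have "\<dots> \<le> (\<Sum>k<N. (1/2) ^ k)"
    proof (rule sum_mono)
      fix k
      have "norm (L2_class (\<lambda>x. \<bar>f (Suc k) x - f k x\<bar>)) = norm (L2_class (f (Suc k)) - L2_class (f k))"
        by (simp add: norm_L2_class_abs[OF d] L2_class_arith[OF sq sq])
      then show "norm (L2_class (\<lambda>x. \<bar>f (Suc k) x - f k x\<bar>)) \<le> (1/2) ^ k" using fast by simp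
    qed
    also have "\<dots> \<le> 2" by (subst sum_gp_strict) (auto simp: field_simps)
    finally have "norm (L2_class (G N)) \<le> 2" .
    then have "(norm (L2_class (G N)))\<^sup>2 \<le> 2\<^sup>2" by (intro power_mono) auto
    then have "(norm (L2_class (G N)))\<^sup>2 \<le> 4" by simp
    then show ?thesis unfolding nn_integral_norm_L2_class[OF sG] by (rule ennreal_leI)
  qed
  have mono: "incseq (\<lambda>N x. ennreal ((G N x)\<^sup>2))"
    by (auto simp: incseq_def le_fun_def G_def intro!: ennreal_leI power_mono sum_mono2 sum_nonneg)
  have "(\<integral>\<^sup>+x. (SUP N. ennreal ((G N x)\<^sup>2)) \<partial>wmeasure) = (SUP N. \<integral>\<^sup>+x. ennreal ((G N x)\<^sup>2) \<partial>wmeasure)"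
    by (rule nn_integral_monotone_convergence_SUP[OF mono]) simp
  also have "\<dots> \<le> ennreal 4" using bound by (rule SUP_least)
  finally have fin: "(\<integral>\<^sup>+x. (SUP N. ennreal ((G N x)\<^sup>2)) \<partial>wmeasure) \<noteq> \<infinity>"
    by (metis ennreal_less_top infinity_ennreal_def less_le_not_le top.extremum)
  have "AE x in wmeasure. (SUP N. ennreal ((G N x)\<^sup>2)) \<noteq> \<infinity>"
    by (rule nn_integral_PInf_AE[OF _ fin]) simp
  then show ?thesis
  proof eventually_elim
    case (elim x)
    then obtain b where b: "(SUP N. ennreal ((G N x)\<^sup>2)) = ennreal b" "b \<ge> 0"
      by (cases "SUP N. ennreal ((G N x)\<^sup>2)") (auto simp: top_ennreal_def)
    have "(G N x)\<^sup>2 \<le> b" for N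
      using SUP_upper[of N UNIV "\<lambda>N. ennreal ((G N x)\<^sup>2)"] b by (simp add: ennreal_le_iff)
    then have "(G N x)\<^sup>2 \<le> (sqrt b)\<^sup>2" for N using b by simp
    then have "G N x \<le> sqrt b" for N by (rule power2_le_imp_le) (use b in simp)
    then have "summable (\<lambda>k. \<bar>f (Suc k) x - f k x\<bar>)"
      by (intro summableI_nonneg_bounded[of _ "sqrt b"]) (auto simp: G_def)
    then have "summable (\<lambda>k. f (Suc k) x - f k x)" by (rule summable_rabs_cancel)
    then have "(\<lambda>N. \<Sum>k<N. f (Suc k) x - f k x) \<longlonglongrightarrow> (\<Sum>k. f (Suc k) x - f k x)"
      by (rule summable_LIMSEQ)
    then have "(\<lambda>N. f N x - f 0 x) \<longlonglongrightarrow> (\<Sum>k. f (Suc k) x - f k x)"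
      by (simp only: sum_lessThan_telescope[of "\<lambda>n. f n x"])
    then have "(\<lambda>N. (f N x - f 0 x) + f 0 x) \<longlonglongrightarrow> (\<Sum>k. f (Suc k) x - f k x) + f 0 x"
      by (intro tendsto_add tendsto_const)
    then show ?case by (auto simp: convergent_def)
  qed
qed

text \<open>The Riesz-Fischer argument. A subsequence with geometrically small steps converges almost everywhere; Fatou's
lemma bounds the distance from its members to the pointwise limit, and the Cauchy property extends the
convergence to the whole sequence.\<close>

instance wL2 :: complete_space
proof
  fix X :: "nat \<Rightarrow> wL2" assume X: "Cauchy X"
  have "\<exists>N. \<forall>m\<ge>N. \<forall>n\<ge>N. norm (X m - X n) < (1/2) ^ k" for k
    using X[unfolded Cauchy_iff] by (meson half_gt_zero_iff zero_less_one zero_less_power)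
  then obtain M where M: "\<And>k m n. m \<ge> M k \<Longrightarrow> n \<ge> M k \<Longrightarrow> norm (X m - X n) < (1/2) ^ k" by metis
  (* any index sequence above M would do; the sum makes r k dominate all M i with i \<le> k *)
  define r where "r k = (\<Sum>i\<le>k. M i)" for k
  have r_ge: "r m \<ge> M k" if "k \<le> m" for k m
    unfolding r_def using that by (intro member_le_sum) auto
  define f where "f k = rep_wL2 (X (r k))" for k
  have sq: "square_integrable (f k)" and cl: "L2_class (f k) = X (r k)" for k by (auto simp: f_def)
  have tail: "norm (X (r m) - X (r k)) \<le> (1/2) ^ k" if "k \<le> m" for k m
    using M[of k "r m" "r k"] r_ge that by (simp add: less_imp_le)
  have AEc: "AE x in wmeasure. convergent (\<lambda>n. f n x)"
    using fast_Cauchy_AE_convergent[OF sq] tail by (simp add: cl)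
  note [measurable] = square_integrable_borel[OF sq]
  define F where "F x = lim (\<lambda>n. f n x)" for x
  have [measurable]: "F \<in> borel_measurable borel" unfolding F_def by measurable
  have est: "square_integrable (\<lambda>x. F x - f k x) \<and> norm (L2_class (\<lambda>x. F x - f k x)) \<le> (1/2) ^ k" for k
  proof -
    have "(\<integral>\<^sup>+x. ennreal ((F x - f k x)\<^sup>2) \<partial>wmeasure) = (\<integral>\<^sup>+x. liminf (\<lambda>m. ennreal ((f m x - f k x)\<^sup>2)) \<partial>wmeasure)"
    proof (rule nn_integral_cong_AE)
      show "AE x in wmeasure. ennreal ((F x - f k x)\<^sup>2) = liminf (\<lambda>m. ennreal ((f m x - f k x)\<^sup>2))"
        using AEc
      proof eventually_elim
        case (elim x)
        then have "(\<lambda>n. f n x) \<longlonglongrightarrow> F x" by (simp add: F_def convergent_LIMSEQ_iff)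
        then have "(\<lambda>m. ennreal ((f m x - f k x)\<^sup>2)) \<longlonglongrightarrow> ennreal ((F x - f k x)\<^sup>2)"
          by (intro tendsto_ennrealI tendsto_intros)
        then show ?case by (intro lim_imp_Liminf[OF _, symmetric]) simp
      qed
    qed
    also have "\<dots> \<le> liminf (\<lambda>m. \<integral>\<^sup>+x. ennreal ((f m x - f k x)\<^sup>2) \<partial>wmeasure)"
      by (rule nn_integral_liminf) simp
    also have "\<dots> \<le> limsup (\<lambda>m. \<integral>\<^sup>+x. ennreal ((f m x - f k x)\<^sup>2) \<partial>wmeasure)"
      by (rule Liminf_le_Limsup) simp
    also have "\<dots> \<le> ennreal (((1/2) ^ k)\<^sup>2)"
    proof (rule Limsup_bounded)
      show "\<forall>\<^sub>F m in sequentially. (\<integral>\<^sup>+x. ennreal ((f m x - f k x)\<^sup>2) \<partial>wmeasure) \<le> ennreal (((1/2) ^ k)\<^sup>2)"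
        using eventually_ge_at_top[of k]
      proof eventually_elim
        case (elim m)
        have "(\<integral>\<^sup>+x. ennreal ((f m x - f k x)\<^sup>2) \<partial>wmeasure) = ennreal ((norm (X (r m) - X (r k)))\<^sup>2)"
          by (subst nn_integral_norm_L2_class[OF square_integrable_diff[OF sq sq]])
            (simp add: L2_class_arith[OF sq sq, symmetric] cl)
        also have "\<dots> \<le> ennreal (((1/2) ^ k)\<^sup>2)"
          using tail[OF elim] by (intro ennreal_leI power_mono) auto
        finally show ?case .
      qed
    qed
    finally show ?thesis
      using norm_L2_class_le[of "\<lambda>x. F x - f k x" "(1/2) ^ k"] by simp
  qed
  have sqF: "square_integrable F"
    using square_integrable_add[OF conjunct1[OF est[of 0]] sq[of 0]] by simp
  define Y where "Y = L2_class F"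
  have Y: "norm (Y - X (r k)) \<le> (1/2) ^ k" for k
    using est[of k] L2_class_arith(2)[OF sqF sq, of k] by (simp add: Y_def cl)
  have "X \<longlonglongrightarrow> Y"
  proof (rule LIMSEQ_I)
    fix e :: real assume "e > 0"
    then obtain k where k: "(1/2::real) ^ k < e / 2"
      using real_arch_pow_inv[of "e / 2" "1/2"] by auto
    have "norm (X n - Y) < e" if "n \<ge> M k" for n
    proof -
      have "norm (X n - Y) \<le> norm (X n - X (r k)) + norm (Y - X (r k))"
        using norm_triangle_ineq4[of "X n - X (r k)" "Y - X (r k)"] by simp
      also have "\<dots> < e" using M[OF that r_ge[OF order_refl]] Y[of k] k by linarith
      finally show ?thesis .
    qed
    then show "\<exists>no. \<forall>n\<ge>no. norm (X n - Y) < e" by blast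
  qed
  then show "convergent X" by (auto simp: convergent_def)
qed

instance wL2 :: banach ..

section \<open>Density of the test functions\<close>

text \<open>The exponential series dominates each of its terms.\<close>

lemma power_times_exp_bounded:
  fixes c :: real
  assumes c: "c > 0" and y: "y \<ge> 0"
  shows "y ^ n * exp (- c * y) \<le> fact n / c ^ n"
proof -
  have "(c * y) ^ n / fact n \<le> (\<Sum>k<Suc n. (c * y) ^ k / fact k)"
    using c y by (intro member_le_sum) auto
  also have "\<dots> \<le> (\<Sum>k. (c * y) ^ k / fact k)"
    using c y summable_exp[of "c * y"] by (intro sum_le_suminf) (auto simp: divide_inverse mult.commute)
  also have "\<dots> = exp (c * y)" by (simp add: exp_def divide_inverse mult.commute)
  finally have "(c * y) ^ n \<le> fact n * exp (c * y)" by (simp add: field_simps)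
  then have "c ^ n * (y ^ n * exp (- (c * y))) \<le> fact n"
    by (simp add: power_mult_distrib exp_minus field_simps)
  then show ?thesis using c by (simp add: field_simps)
qed

text \<open>The functions \<open>p q\<^sup>-\<^sup>m exp (-c/q)\<close> with \<open>q = (x-a)(b-x)\<close>, extended by \<open>0\<close>. This family contains the
bump \<open>exp (-c/q)\<close> and, unlike the bump itself, is closed under differentiation, which makes smoothness
an induction.\<close>

definition bump_term :: "real \<Rightarrow> real \<Rightarrow> real \<Rightarrow> real poly \<Rightarrow> nat \<Rightarrow> real \<Rightarrow> real" where
  "bump_term c a b p m x = (if a < x \<and> x < b
     then poly p x / ((x - a) * (b - x)) ^ m * exp (- c / ((x - a) * (b - x))) else 0)"

text \<open>The exponential beats every power of \<open>1/q\<close>, so that the function is \<open>O(q\<^sup>2)\<close>; this is all that is needed to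
differentiate at the two end points.\<close>

lemma bump_term_flat:
  assumes c: "c > 0" and ab: "a < b"
  shows "\<exists>K\<ge>0. \<forall>x. \<bar>bump_term c a b p m x\<bar> \<le> K * (x - a)\<^sup>2 \<and> \<bar>bump_term c a b p m x\<bar> \<le> K * (x - b)\<^sup>2"
proof -
  have "compact (poly p ` {a..b})" by (intro compact_continuous_image continuous_intros compact_Icc)
  from compact_imp_bounded[OF this] obtain P where P: "P > 0" "\<forall>y\<in>poly p ` {a..b}. norm y \<le> P"
    unfolding bounded_pos by blast
  have P: "\<And>x. x \<in> {a..b} \<Longrightarrow> \<bar>poly p x\<bar> \<le> P" "P > 0" using P by auto
  define F :: real where "F = fact (m + 2) / c ^ (m + 2)"
  have F: "F \<ge> 0" using c by (simp add: F_def)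
  have main: "\<bar>bump_term c a b p m x\<bar> \<le> P * F * ((x - a) * (b - x))\<^sup>2" for x
  proof (cases "a < x \<and> x < b")
    case True
    define q where "q = (x - a) * (b - x)"
    have q: "q > 0" using True by (simp add: q_def)
    have "(1 / q) ^ (m + 2) * exp (- c * (1 / q)) \<le> F"
      unfolding F_def using c q by (intro power_times_exp_bounded) auto
    then have "1 / q ^ m * exp (- c / q) \<le> F * q\<^sup>2"
      using q by (simp add: power_add power_one_over field_simps power2_eq_square)
    then have "\<bar>poly p x\<bar> * (1 / q ^ m * exp (- c / q)) \<le> P * (F * q\<^sup>2)"
      using P(1)[of x] True q P(2) by (intro mult_mono[of _ P "1 / q ^ m * exp (- c / q)"]) auto
    then show ?thesis using True q by (simp add: bump_term_def q_def[symmetric] abs_mult mult.assoc)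
  qed (use P(2) F in \<open>auto simp: bump_term_def\<close>)
  define K where "K = P * F * (b - a)\<^sup>2"
  have "\<bar>bump_term c a b p m x\<bar> \<le> K * (x - a)\<^sup>2 \<and> \<bar>bump_term c a b p m x\<bar> \<le> K * (x - b)\<^sup>2" for x
  proof (cases "a < x \<and> x < b")
    case True
    have "((x - a) * (b - x))\<^sup>2 \<le> (b - a)\<^sup>2 * (x - a)\<^sup>2"
      unfolding power_mult_distrib mult.commute[of "(b - a)\<^sup>2"] using True by (intro mult_left_mono power_mono) auto
    moreover have "((x - a) * (b - x))\<^sup>2 \<le> (b - a)\<^sup>2 * (x - b)\<^sup>2"
      unfolding power_mult_distrib power2_commute[of x b] using True by (intro mult_right_mono power_mono) auto
    moreover have "P * F \<ge> 0" using P(2) F by simp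
    ultimately have "P * F * ((x - a) * (b - x))\<^sup>2 \<le> P * F * ((b - a)\<^sup>2 * (x - a)\<^sup>2)"
      "P * F * ((x - a) * (b - x))\<^sup>2 \<le> P * F * ((b - a)\<^sup>2 * (x - b)\<^sup>2)"
      by (auto intro: mult_left_mono)
    then show ?thesis using main[of x] by (simp add: K_def mult.assoc)
  qed (use P(2) F in \<open>auto simp: bump_term_def K_def\<close>)
  moreover have "K \<ge> 0" using P(2) F by (simp add: K_def)
  ultimately show ?thesis by blast
qed

lemma has_derivative_zero_if_quadratic:
  fixes f :: "real \<Rightarrow> real"
  assumes "\<And>x. \<bar>f x\<bar> \<le> K * (x - x0)\<^sup>2"
  shows "(f has_real_derivative 0) (at x0)"
proof -
  have f0: "f x0 = 0" using assms[of x0] by simp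
  have "((\<lambda>x. (f x - f x0) / (x - x0)) \<longlongrightarrow> 0) (at x0)"
  proof (rule Lim_null_comparison)
    show "\<forall>\<^sub>F x in at x0. norm ((f x - f x0) / (x - x0)) \<le> K * \<bar>x - x0\<bar>"
      unfolding eventually_at_filter
    proof (rule always_eventually, intro allI impI)
      fix x assume "x \<noteq> x0"
      then have "\<bar>x - x0\<bar> > 0" by simp
      moreover have "\<bar>f x\<bar> \<le> K * \<bar>x - x0\<bar> * \<bar>x - x0\<bar>"
        using assms[of x] by (simp add: power2_eq_square mult.assoc)
      ultimately show "norm ((f x - f x0) / (x - x0)) \<le> K * \<bar>x - x0\<bar>"
        by (simp add: f0 abs_divide pos_divide_le_eq)
    qed
    have "((\<lambda>x. K * \<bar>x - x0\<bar>) \<longlongrightarrow> K * \<bar>x0 - x0\<bar>) (at x0)" by (intro tendsto_intros)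
    then show "((\<lambda>x. K * \<bar>x - x0\<bar>) \<longlongrightarrow> 0) (at x0)" by simp
  qed
  then show ?thesis by (simp add: has_field_derivative_iff)
qed

text \<open>Inside the interval this is the quotient rule, outside it is trivial, and at the end points the derivative is
\<open>0\<close> by flatness. The exponent grows by \<open>2\<close> since both factors \<open>q\<^sup>-\<^sup>m\<close> and \<open>exp (-c/q)\<close> are put over
the common denominator \<open>q\<^bsup>m+2\<^esup>\<close>.\<close>

lemma bump_term_has_derivative:
  assumes c: "c > 0" and ab: "a < b"
  defines "Q \<equiv> [:- a * b, a + b, - 1:]"
  shows "(bump_term c a b p m has_real_derivative
     bump_term c a b (pderiv p * Q\<^sup>2 - smult (of_nat m) (p * pderiv Q * Q) + smult c (p * pderiv Q)) (m + 2) x) (at x)"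
    (is "(_ has_real_derivative bump_term c a b ?p' (m + 2) x) _")
proof -
  have Q: "poly Q x = (x - a) * (b - x)" for x by (simp add: Q_def algebra_simps)
  consider "a < x \<and> x < b" | "x < a \<or> b < x" | "x = a" | "x = b" by linarith
  then show ?thesis
  proof cases
    case 1
    define q where "q = poly Q x"
    have q: "q > 0" using 1 by (simp add: q_def Q)
    define g where "g y = poly p y * inverse (poly Q y) ^ m * exp (- c * inverse (poly Q y))" for y
    have "(g has_real_derivative poly ?p' x / q ^ (m + 2) * exp (- c / q)) (at x)"
    proof -
      have "(g has_real_derivative
          (poly (pderiv p) x * inverse q ^ m + poly p x * (of_nat m * inverse q ^ (m - 1) * (- (inverse q * poly (pderiv Q) x * inverse q))))
             * exp (- c * inverse q)
          + poly p x * inverse q ^ m * (exp (- c * inverse q) * (- c * (- (inverse q * poly (pderiv Q) x * inverse q))))) (at x)"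
        unfolding g_def q_def using q
        by (auto intro!: derivative_eq_intros simp: q_def algebra_simps)
      moreover have "(poly (pderiv p) x * inverse q ^ m + poly p x * (of_nat m * inverse q ^ (m - 1) * (- (inverse q * poly (pderiv Q) x * inverse q))))
             * exp (- c * inverse q)
          + poly p x * inverse q ^ m * (exp (- c * inverse q) * (- c * (- (inverse q * poly (pderiv Q) x * inverse q))))
          = poly ?p' x / q ^ (m + 2) * exp (- c / q)"
      proof -
        have "of_nat m * inverse q ^ (m - 1) = of_nat m * (q / q ^ m)"
          using q by (cases m) (auto simp: field_simps)
        then show ?thesis
          using q by (simp add: q_def[symmetric] power_add power_inverse inverse_eq_divide)
            (simp add: field_simps power2_eq_square)
      qed
      ultimately show ?thesis by simp
    qed
    then have "(g has_real_derivative bump_term c a b ?p' (m + 2) x) (at x)"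
      using 1 by (simp add: bump_term_def q_def Q)
    moreover have "g y = bump_term c a b p m y" if "y \<in> {a<..<b}" for y
      using that by (simp add: g_def bump_term_def Q inverse_eq_divide power_divide)
    ultimately show ?thesis
      using 1 by (auto intro: has_field_derivative_transform_within_open[of g _ x "{a<..<b}"])
  next
    case 2
    have "(bump_term c a b p m has_real_derivative 0) (at x)"
      by (rule has_field_derivative_transform_within_open[of "\<lambda>_. 0" _ x "{..<a} \<union> {b<..}"])
        (use 2 in \<open>auto simp: bump_term_def\<close>)
    then show ?thesis using 2 by (auto simp: bump_term_def)
  next
    case 3
    then show ?thesis using bump_term_flat[OF c ab, of p m]
      by (auto simp: bump_term_def[of c a b ?p'] intro: has_derivative_zero_if_quadratic)
  next
    case 4
    then show ?thesis using bump_term_flat[OF c ab, of p m]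
      by (auto simp: bump_term_def[of c a b ?p'] intro: has_derivative_zero_if_quadratic)
  qed
qed

definition bump :: "real \<Rightarrow> real \<Rightarrow> real \<Rightarrow> real \<Rightarrow> real" where
  "bump c a b x = (if a < x \<and> x < b then exp (- c / ((x - a) * (b - x))) else 0)"

lemma bump_in_test_functions:
  assumes c: "c > 0" and ab: "0 < a" "a < b"
  shows "bump c a b \<in> test_functions"
proof -
  have "\<exists>p m. (deriv ^^ k) (bump c a b) = bump_term c a b p m" for k
  proof (induction k)
    case 0
    have "bump c a b = bump_term c a b 1 0" by (auto simp: bump_def bump_term_def)
    then show ?case by auto
  next
    case (Suc k)
    then obtain p m where "(deriv ^^ k) (bump c a b) = bump_term c a b p m" by blast
    then have "\<exists>p' m'. deriv ((deriv ^^ k) (bump c a b)) = bump_term c a b p' m'"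
      using DERIV_imp_deriv[OF bump_term_has_derivative[OF c ab(2), of p m]] by (metis ext)
    then show ?case by simp
  qed
  then have "(deriv ^^ k) (bump c a b) differentiable_on UNIV" for k
    using bump_term_has_derivative[OF c ab(2)]
    by (metis differentiable_on_def differentiable_at_withinI real_differentiable_def)
  moreover have "compact {a..b}" "{a..b} \<subseteq> {0<..}" "\<forall>x. x \<notin> {a..b} \<longrightarrow> bump c a b x = 0"
    using ab by (auto simp: bump_def)
  ultimately show ?thesis unfolding test_functions_def by blast
qed

lemma bump_bounds: "c > 0 \<Longrightarrow> 0 \<le> bump c a b x" "c > 0 \<Longrightarrow> bump c a b x \<le> indicator {a<..<b} x"
  by (auto simp: bump_def indicator_def)

text \<open>The parameter \<open>c\<close> is there for this limit: as \<open>c\<close> tends to \<open>0\<close> the bumps fill the open interval.\<close>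

lemma bump_tendsto_indicator: "(\<lambda>n. bump (1 / real (Suc n)) a b x) \<longlonglongrightarrow> indicator {a<..<b} x"
proof (cases "a < x \<and> x < b")
  case True
  have "(\<lambda>n. exp (- (1 / real (Suc n)) / ((x - a) * (b - x)))) \<longlonglongrightarrow> exp (- 0 / ((x - a) * (b - x)))"
    using True by (intro tendsto_intros LIMSEQ_Suc[OF lim_1_over_n]) auto
  then show ?thesis using True by (simp add: bump_def)
next
  case False
  then have "bump c a b x = 0" for c by (auto simp: bump_def)
  then show ?thesis using False by simp
qed

lemma borel_measurable_test_function:
  assumes "g \<in> test_functions"
  shows "g \<in> borel_measurable borel"
proof -
  have "(deriv ^^ 0) g differentiable_on UNIV" using assms unfolding test_functions_def by blast
  then have "continuous_on UNIV g" by (simp add: differentiable_imp_continuous_on)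
  then show ?thesis by (rule borel_measurable_continuous_onI)
qed

lemma nn_integral_indicator_wmeasure_finite:
  assumes "0 \<le> a" "a \<le> b"
  shows "(\<integral>\<^sup>+x. indicator {a..b} x \<partial>wmeasure) < \<infinity>"
proof -
  have "(\<integral>\<^sup>+x. indicator {a..b} x \<partial>wmeasure) =
      (\<integral>\<^sup>+x. ennreal (indicator {0<..} x * sqrt x) * indicator {a..b} x \<partial>lborel)"
    by (rule nn_integral_wmeasure) simp
  also have "\<dots> \<le> (\<integral>\<^sup>+x. ennreal (sqrt b) * indicator {a..b} x \<partial>lborel)"
  proof (rule nn_integral_mono)
    fix x show "ennreal (indicator {0<..} x * sqrt x) * indicator {a..b} x \<le> ennreal (sqrt b) * indicator {a..b} x"
      by (cases "x \<in> {a..b}") (simp_all add: indicator_def ennreal_leI)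
  qed
  also have "\<dots> = ennreal (sqrt b) * emeasure lborel {a..b}" by (rule nn_integral_cmult_indicator) simp
  also have "\<dots> < \<infinity>" using assms(2) by (simp add: ennreal_mult_less_top)
  finally show ?thesis .
qed

lemma square_integrable_bounded_support:
  assumes [measurable]: "g \<in> borel_measurable borel"
    and b: "\<And>x. \<bar>g x\<bar> \<le> B * indicator {a..b} x" and ab: "0 \<le> a" "a \<le> b"
  shows "square_integrable g"
proof -
  have B0: "0 \<le> B" using b[of a] ab by simp
  have "(\<integral>\<^sup>+x. ennreal ((g x)\<^sup>2) \<partial>wmeasure) \<le> (\<integral>\<^sup>+x. ennreal (B\<^sup>2) * indicator {a..b} x \<partial>wmeasure)"
  proof (rule nn_integral_mono)
    fix x
    have "(g x)\<^sup>2 \<le> (B * indicator {a..b} x)\<^sup>2" using power_mono[OF b[of x], of 2] by simp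
    then show "ennreal ((g x)\<^sup>2) \<le> ennreal (B\<^sup>2) * indicator {a..b} x"
      by (auto simp: indicator_def ennreal_leI)
  qed
  also have "\<dots> = ennreal (B\<^sup>2) * (\<integral>\<^sup>+x. indicator {a..b} x \<partial>wmeasure)" by (rule nn_integral_cmult) simp
  also have "\<dots> < \<infinity>" using nn_integral_indicator_wmeasure_finite[OF ab] by (simp add: ennreal_mult_less_top)
  finally show ?thesis by (simp add: square_integrable_iff_nn_integral)
qed

lemma square_integrable_test_function:
  assumes g: "g \<in> test_functions"
  shows "square_integrable g"
proof -
  obtain C where C: "compact C" "C \<subseteq> {0<..}" "\<And>x. x \<notin> C \<Longrightarrow> g x = 0"
    using g unfolding test_functions_def by blast
  have "(deriv ^^ 0) g differentiable_on UNIV" using g unfolding test_functions_def by blast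
  then have cont: "continuous_on UNIV g" by (simp add: differentiable_imp_continuous_on)
  have "bounded (g ` C)"
    by (intro compact_imp_bounded compact_continuous_image continuous_on_subset[OF cont] C(1) subset_UNIV)
  then obtain B where B: "\<And>x. x \<in> C \<Longrightarrow> \<bar>g x\<bar> \<le> B" "B > 0" by (auto simp: bounded_pos)
  obtain b where b: "\<And>x. x \<in> C \<Longrightarrow> \<bar>x\<bar> \<le> b" "b > 0" using compact_imp_bounded[OF C(1)] by (auto simp: bounded_pos)
  show ?thesis
  proof (rule square_integrable_bounded_support[of g B 0 b])
    fix x show "\<bar>g x\<bar> \<le> B * indicator {0..b} x"
    proof (cases "x \<in> C")
      case True
      then have "x \<in> {0..b}" using C(2) b(1)[OF True] by auto
      then show ?thesis using B(1)[OF True] by simp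
    next
      case False
      then show ?thesis using C(3) B(2) by simp
    qed
  qed (use borel_measurable_test_function[OF g] b in auto)
qed

lemma integrable_on_bounded_interval:
  assumes f: "square_integrable f" and ab: "0 \<le> a" "a \<le> b"
  shows "integrable wmeasure (\<lambda>x. f x * indicator {a..b} x)"
proof -
  have "square_integrable (indicator {a..b} :: real \<Rightarrow> real)"
    by (rule square_integrable_bounded_support[of _ 1 a b]) (use ab in auto)
  then show ?thesis using f by (rule square_integrable_mult[rotated])
qed

lemma integral_over_interval_zero:
  assumes f: "square_integrable f" and perp: "\<And>g. g \<in> test_functions \<Longrightarrow> (LINT x|wmeasure. f x * g x) = 0"
    and ab: "0 < a"
  shows "(LINT x|wmeasure. indicator {a<..<b} x * f x) = 0"
proof (cases "a < b")
  case True
  note [measurable] = square_integrable_borel[OF f]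
  have [measurable]: "bump (1 / real (Suc n)) a b \<in> borel_measurable borel" for n
    by (intro borel_measurable_test_function bump_in_test_functions) (use ab True in auto)
  have [measurable]: "(\<lambda>x. f x * bump (1 / real (Suc n)) a b x) \<in> borel_measurable wmeasure" for n by measurable
  have "(\<lambda>n. LINT x|wmeasure. f x * bump (1 / real (Suc n)) a b x) \<longlonglongrightarrow> (LINT x|wmeasure. f x * indicator {a<..<b} x)"
  proof (rule integral_dominated_convergence[where w = "\<lambda>x. \<bar>f x * indicator {a..b} x\<bar>"])
    show "integrable wmeasure (\<lambda>x. \<bar>f x * indicator {a..b} x\<bar>)"
      using integrable_on_bounded_interval[OF f, of a b] ab True by (intro integrable_abs) auto
    show "AE x in wmeasure. (\<lambda>n. f x * bump (1 / real (Suc n)) a b x) \<longlonglongrightarrow> f x * indicator {a<..<b} x"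
      by (intro AE_I2 tendsto_mult tendsto_const bump_tendsto_indicator)
    fix n
    have "norm (f x * bump (1 / real (Suc n)) a b x) \<le> \<bar>f x * indicator {a..b} x\<bar>" for x
    proof -
      have "bump (1 / real (Suc n)) a b x \<le> indicator {a<..<b} x" by (rule bump_bounds(2)) simp
      also have "\<dots> \<le> indicator {a..b} x" by (auto simp: indicator_def)
      finally show ?thesis using bump_bounds(1)[of "1 / real (Suc n)" a b x] by (simp add: abs_mult mult_left_mono)
    qed
    then show "AE x in wmeasure. norm (f x * bump (1 / real (Suc n)) a b x) \<le> \<bar>f x * indicator {a..b} x\<bar>" by simp
  qed measurable
  moreover have "(LINT x|wmeasure. f x * bump (1 / real (Suc n)) a b x) = 0" for n
    by (intro perp bump_in_test_functions) (use ab True in auto)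
  ultimately have "(\<lambda>n. 0) \<longlonglongrightarrow> (LINT x|wmeasure. f x * indicator {a<..<b} x)" by simp
  then have "(LINT x|wmeasure. f x * indicator {a<..<b} x) = 0" by (simp add: LIMSEQ_const_iff)
  then show ?thesis by (simp add: mult.commute)
qed simp

text \<open>A Dynkin argument: open intervals are closed under intersection and generate the Borel sets. The total
integral is a separate hypothesis because the whole line is not a bounded interval.\<close>

lemma integral_zero_on_all_sets:
  assumes u: "integrable M u" and sets: "sets M = sets (borel :: real measure)"
    and int: "\<And>a b. (LINT x|M. indicator {a<..<b} x * u x) = (0::real)" and tot: "(LINT x|M. u x) = 0"
    and A: "A \<in> sets borel"
  shows "(LINT x|M. indicator A x * u x) = 0"
proof -
  have intA: "integrable M (\<lambda>x. indicator A x * u x)" if "A \<in> sets borel" for A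
    using integrable_mult_indicator[OF _ u, of A] that sets by simp
  define E where "E = range (\<lambda>(a::real, b). {a<..<b})"
  have borel_E: "sets borel = sigma_sets UNIV E"
    unfolding E_def borel_eq_box by (subst sets_measure_of) (simp_all add: box_real[abs_def])
  have "Int_stable E"
  proof (rule Int_stableI)
    fix S T assume "S \<in> E" "T \<in> E"
    then obtain a b c d where "S = {a<..<b}" "T = {c<..<d}" by (auto simp: E_def)
    then have "S \<inter> T = {max a c<..<min b d}" by auto
    then show "S \<inter> T \<in> E" by (auto simp: E_def)
  qed
  moreover have "E \<subseteq> Pow UNIV" by simp
  moreover have "A \<in> sigma_sets UNIV E" using A by (simp add: borel_E)
  ultimately show ?thesis
  proof (induction rule: sigma_sets_induct_disjoint)
    case (basic S)
    then show ?case using int by (auto simp: E_def)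
  next
    case (compl S)
    have S: "S \<in> sets borel" using compl(1) by (simp add: borel_E)
    have "(LINT x|M. indicator (UNIV - S) x * u x) = (LINT x|M. u x - indicator S x * u x)"
      by (intro Bochner_Integration.integral_cong) (auto simp: indicator_def)
    also have "\<dots> = 0" using compl(2) tot intA[OF S] u by simp
    finally show ?case .
  next
    case (union S)
    have S: "S i \<in> sets M" for i using union(2) sets by (auto simp: borel_E)
    have "set_integrable M (\<Union>i. S i) u"
      unfolding set_integrable_def using integrable_mult_indicator[OF _ u, of "\<Union>i. S i"] S by simp
    then have "(LINT x:(\<Union>i. S i)|M. u x) = (\<Sum>i. (LINT x:S i|M. u x))"
      using union(1) S by (intro lebesgue_integral_countable_add) (auto simp: disjoint_family_on_def)
    then show ?case using union(3) by (simp add: set_lebesgue_integral_def)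
  qed simp
qed

text \<open>Orthogonality to bumps gives vanishing integrals over all intervals bounded away from \<open>0\<close> and infinity. As
\<open>f\<close> need not be integrable, the conclusion is first drawn on each \<open>(1/n, n)\<close>.\<close>

lemma AE_zero_if_orthogonal_to_test_functions:
  assumes f: "square_integrable f" and perp: "\<And>g. g \<in> test_functions \<Longrightarrow> (LINT x|wmeasure. f x * g x) = 0"
  shows "AE x in wmeasure. f x = 0"
proof -
  have zero: "AE x in wmeasure. f x * indicator {1 / real (Suc n)<..<real (Suc n)} x = 0" for n
  proof -
    define a b where "a = 1 / real (Suc n)" "b = real (Suc n)"
    have ab: "0 < a" "a \<le> b" by (auto simp: a_b_def field_simps)
    define u where "u x = f x * indicator {a<..<b} x" for x
    have u_eq: "u x = indicator {a<..<b} x * (f x * indicator {a..b} x)" for x by (auto simp: u_def indicator_def)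
    have u: "integrable wmeasure u"
      using integrable_mult_indicator[OF _ integrable_on_bounded_interval[OF f, of a b], of "{a<..<b}"] ab
      by (simp add: u_eq[abs_def])
    have int: "(LINT x|wmeasure. indicator {c<..<d} x * u x) = 0" for c d
    proof -
      have "(LINT x|wmeasure. indicator {c<..<d} x * u x) = (LINT x|wmeasure. indicator {max a c<..<min b d} x * f x)"
        by (intro Bochner_Integration.integral_cong) (auto simp: u_def indicator_def)
      also have "\<dots> = 0" using ab by (intro integral_over_interval_zero[OF f perp]) auto
      finally show ?thesis .
    qed
    have "(LINT x|wmeasure. u x) = 0"
      using integral_over_interval_zero[OF f perp, of a b] ab by (simp add: u_def[abs_def] mult.commute)
    from integral_zero_on_all_sets[OF u sets_wmeasure int this]
    have "(LINT x:A|wmeasure. u x) = (LINT x:A|wmeasure. 0)" if "A \<in> sets wmeasure" for A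
      using that by (simp add: set_lebesgue_integral_def)
    from density_unique_real[OF u _ this] show ?thesis by (simp add: u_def a_b_def)
  qed
  have "AE x in wmeasure. \<forall>n. f x * indicator {1 / real (Suc n)<..<real (Suc n)} x = 0"
    unfolding AE_all_countable using zero by blast
  moreover have "AE x in wmeasure. x > 0" by (simp add: AE_wmeasure_iff)
  ultimately show ?thesis
  proof eventually_elim
    case (elim x)
    obtain n1 where n1: "x < real n1" using reals_Archimedean2 by blast
    obtain n2 where n2: "1 / x < real n2" using reals_Archimedean2 by blast
    define n where "n = max n1 n2"
    have "x < real (Suc n)" "1 / x < real (Suc n)" using n1 n2 by (auto simp: n_def)
    then have "x \<in> {1 / real (Suc n)<..<real (Suc n)}" using elim(2) by (auto simp: field_simps)
    then show ?case using elim(1)[rule_format, of n] by simp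
  qed
qed

lemma test_functions_dense: "closure (span (L2_class ` test_functions)) = UNIV"
proof (rule dense_if_orthogonal_complement_trivial)
  fix f assume f: "\<And>v. v \<in> span (L2_class ` test_functions) \<Longrightarrow> inner f v = 0"
  have "(LINT x|wmeasure. rep_wL2 f x * g x) = 0" if g: "g \<in> test_functions" for g
    using f[OF span_base[OF imageI[OF g]]]
      L2_class_arith(6)[OF square_integrable_rep square_integrable_test_function[OF g], of f] by simp
  then have "AE x in wmeasure. rep_wL2 f x = 0"
    by (intro AE_zero_if_orthogonal_to_test_functions) auto
  then have "L2_class (rep_wL2 f) = L2_class (\<lambda>_. 0)"
    by (intro L2_class_eqI) (auto simp: square_integrable_zero)
  then show "f = 0" using L2_class_arith(5)[OF square_integrable_zero square_integrable_zero] by simp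
qed (rule subspace_span)

text \<open>The set on which two bounded operators agree is a closed subspace.\<close>

lemma bounded_linear_eqI_test_functions:
  assumes S: "bounded_linear S" and T: "bounded_linear T"
    and eq: "\<And>g. g \<in> test_functions \<Longrightarrow> S (L2_class g) = T (L2_class g)"
  shows "S = T"
proof -
  define D where "D f = S f - T f" for f
  have lin: "bounded_linear D" unfolding D_def by (rule bounded_linear_sub[OF S T])
  have "subspace {f. D f = 0}"
    by (rule linear_subspace_kernel[OF bounded_linear.linear[OF lin]])
  moreover have "L2_class ` test_functions \<subseteq> {f. D f = 0}" using eq by (auto simp: D_def)
  ultimately have sub: "span (L2_class ` test_functions) \<subseteq> {f. D f = 0}"
    by (rule span_minimal[rotated])
  have "closed {f. D f = 0}"
    using linear_continuous_on[OF lin, of UNIV] continuous_on_const by (rule closed_Collect_eq)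
  with sub have "closure (span (L2_class ` test_functions)) \<subseteq> {f. D f = 0}"
    by (rule closure_minimal)
  then have "D f = 0" for f unfolding test_functions_dense by blast
  then show ?thesis by (simp add: D_def fun_eq_iff)
qed

lemma extends_formula_unique:
  assumes "extends_formula F S" and "extends_formula F T"
  shows "S = T"
proof (rule bounded_linear_eqI_test_functions)
  show "bounded_linear S" "bounded_linear T" using assms by (simp_all add: extends_formula_def)
  fix g assume g: "g \<in> test_functions"
  have "S (L2_class g) = L2_class (F g)" using assms(1) g unfolding extends_formula_def by blast
  moreover have "T (L2_class g) = L2_class (F g)" using assms(2) g unfolding extends_formula_def by blast
  ultimately show "S (L2_class g) = T (L2_class g)" by simp
qed

lemma extension_eqI:
  assumes "extends_formula F T"
  shows "extension F = T"
  unfolding extension_def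
proof (rule the_equality[of _ T])
  show "extends_formula F T" by (fact assms)
  show "S = T" if "extends_formula F S" for S using that assms by (rule extends_formula_unique)
qed

section \<open>A uniform bound on the collision rate\<close>

text \<open>With \<open>a\<^sup>2 = sqrt z / sqrt x\<close> and \<open>b\<^sup>2 = sqrt w / sqrt x\<close> the left side is the collision weight with one
frequency dropped. The product on the right decouples \<open>z\<close> and \<open>w\<close>, at the price of taking fourth roots.\<close>

lemma min_one_le_product:
  fixes a b :: real
  assumes "0 \<le> a" "0 \<le> b"
  shows "min 1 (min (a\<^sup>2) (b\<^sup>2)) \<le> min 1 a * min 1 b"
proof -
  define L where "L = min 1 (min (a\<^sup>2) (b\<^sup>2))"
  have L: "L \<le> 1" "L \<le> a\<^sup>2" "L \<le> b\<^sup>2" by (auto simp: L_def)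
  have "L \<le> c" if "0 \<le> c" "L \<le> c\<^sup>2" for c
  proof (cases "c \<le> 1")
    case True
    then have "c\<^sup>2 \<le> c" using that by (simp add: power2_eq_square mult_left_le)
    then show ?thesis using that by simp
  qed (use L in simp)
  then have "L \<le> a" "L \<le> b" using L assms by auto
  moreover have "L \<le> a * b"
  proof (cases "a \<le> b")
    case True
    then have "a\<^sup>2 \<le> a * b" using assms by (simp add: power2_eq_square mult_left_mono)
    then show ?thesis using L by linarith
  next
    case False
    then have "b\<^sup>2 \<le> a * b" using assms by (simp add: power2_eq_square mult_right_mono)
    then show ?thesis using L by linarith
  qed
  ultimately show ?thesis using L unfolding L_def[symmetric] by (auto simp: min_def)
qed

text \<open>Near \<open>z = 0\<close> the factor \<open>n(z)\<close> behaves like \<open>1/z\<close> when \<open>\<mu>\<close> is small, which is not integrable. If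
\<open>x \<ge> \<mu>\<close> the weight supplies the missing \<open>z\<^bsup>1/4\<^esup>\<close>, and if \<open>x < \<mu>\<close> the denominator \<open>z + \<mu>\<close> does. The maximum
\<open>m\<close> of \<open>x\<close> and \<open>\<mu>\<close> unifies the two cases.\<close>

lemma damped_weight_le:
  assumes "x > 0" "z > 0" "\<mu> \<ge> 0"
  defines "m \<equiv> max x \<mu>"
  shows "min 1 (z powr (1/4) / x powr (1/4)) * eq_n \<mu> z \<le> z powr (-3/4) * m powr (-1/4)"
proof -
  define Z where "Z = z powr (1/4)"
  define M where "M = m powr (1/4)"
  have m: "m > 0" using assms by (simp add: m_def)
  have pos: "Z > 0" "M > 0" using assms m by (auto simp: Z_def M_def)
  have Z: "z = Z ^ 4" and M: "m = M ^ 4"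
    using assms m by (auto simp: Z_def M_def powr_power)
  have neg: "z powr (-3/4) = 1 / Z ^ 3" "m powr (-1/4) = 1 / M"
    using assms m by (auto simp: Z_def M_def powr_power powr_minus_divide[symmetric])
  have "min 1 (Z / x powr (1/4)) * (Z ^ 3 * M) \<le> z + \<mu>"
  proof (cases "x \<ge> \<mu>")
    case True
    then have "x powr (1/4) = M" by (simp add: M_def m_def)
    then have "min 1 (Z / x powr (1/4)) * (Z ^ 3 * M) \<le> (Z / M) * (Z ^ 3 * M)"
      using pos by (intro mult_right_mono) auto
    also have "\<dots> = z" using pos by (simp add: Z power4_eq_xxxx power3_eq_cube)
    finally show ?thesis using assms by simp
  next
    case False
    then have mu: "\<mu> = M ^ 4" using M by (simp add: m_def)
    have "min 1 (Z / x powr (1/4)) * (Z ^ 3 * M) \<le> 1 * (Z ^ 3 * M)"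
      using pos by (intro mult_right_mono) auto
    also have "Z ^ 3 * M \<le> Z ^ 4 + M ^ 4"
    proof (cases "M \<le> Z")
      case True
      then have "Z ^ 3 * M \<le> Z ^ 3 * Z" using pos by (intro mult_left_mono) auto
      also have "\<dots> = Z ^ 4" by (simp add: power4_eq_xxxx power3_eq_cube)
      also have "\<dots> \<le> Z ^ 4 + M ^ 4" using pos by simp
      finally show ?thesis .
    next
      case False
      then have "Z ^ 3 * M \<le> M ^ 3 * M" using pos by (intro mult_right_mono power_mono) auto
      also have "\<dots> = M ^ 4" by (simp add: power4_eq_xxxx power3_eq_cube)
      also have "\<dots> \<le> Z ^ 4 + M ^ 4" using pos by simp
      finally show ?thesis .
    qed
    finally show ?thesis by (simp add: mu Z)
  qed
  moreover have "z + \<mu> > 0" using assms by simp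
  ultimately show ?thesis
    using pos unfolding neg eq_n_def Z_def[symmetric] by (simp add: field_simps)
qed

text \<open>Dominates \<open>z\<^bsup>-3/4\<^esup> (m + z)\<^bsup>-1/2\<^esup>\<close> by pure powers, whose integrals are explicit.\<close>

definition majorant :: "real \<Rightarrow> real \<Rightarrow> real" where
  "majorant m z = indicator {0..m} z * z powr (-3/4) * m powr (-1/2) + indicator {m..} z * z powr (-5/4)"

lemma majorant_nonneg: "majorant m z \<ge> 0"
  by (simp add: majorant_def)

lemma measurable_majorant [measurable]: "majorant m \<in> borel_measurable borel"
  unfolding majorant_def by measurable

lemma majorant_ge:
  assumes "z > 0" "m > 0"
  shows "z powr (-3/4) / sqrt (m + z) \<le> majorant m z"
proof (cases "z \<le> m")
  case True
  have "1 / sqrt (m + z) \<le> 1 / sqrt m" using assms by (simp add: frac_le)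
  also have "1 / sqrt m = m powr (-1/2)" using assms by (simp add: powr_minus_divide powr_half_sqrt)
  finally have "z powr (-3/4) * (1 / sqrt (m + z)) \<le> z powr (-3/4) * m powr (-1/2)"
    by (rule mult_left_mono) simp
  also have "\<dots> \<le> majorant m z" using True assms by (simp add: majorant_def)
  finally show ?thesis by simp
next
  case False
  have "1 / sqrt (m + z) \<le> 1 / sqrt z" using assms by (simp add: frac_le)
  also have "1 / sqrt z = z powr (-1/2)" using assms by (simp add: powr_minus_divide powr_half_sqrt)
  finally have "z powr (-3/4) * (1 / sqrt (m + z)) \<le> z powr (-3/4) * z powr (-1/2)"
    by (rule mult_left_mono) simp
  also have "\<dots> = z powr (-5/4)" by (simp add: powr_add[symmetric])
  also have "\<dots> \<le> majorant m z" using False by (simp add: majorant_def)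
  finally show ?thesis by simp
qed

lemma nn_integral_majorant:
  assumes m: "m > 0"
  shows "(\<integral>\<^sup>+z. ennreal (majorant m z) \<partial>lborel) = ennreal (8 * m powr (-1/4))"
proof -
  have 1: "(\<integral>\<^sup>+z. ennreal (indicator {0..m} z * z powr (-3/4)) \<partial>lborel) = ennreal (4 * m powr (1/4))"
    using nn_integral_has_integral_lebesgue[OF _ has_integral_powr_from_0[of "-3/4" m]] m
    by (simp add: mult.commute)
  have 2: "(\<integral>\<^sup>+z. ennreal (indicator {m..} z * z powr (-5/4)) \<partial>lborel) = ennreal (4 * m powr (-1/4))"
    using nn_integral_has_integral_lebesgue[OF _ has_integral_powr_to_inf[of "-5/4" m]] m
    by (simp add: mult.commute)
  have "(\<integral>\<^sup>+z. ennreal (majorant m z) \<partial>lborel) =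
     (\<integral>\<^sup>+z. ennreal (m powr (-1/2)) * ennreal (indicator {0..m} z * z powr (-3/4)) + ennreal (indicator {m..} z * z powr (-5/4)) \<partial>lborel)"
    by (intro nn_integral_cong)
      (simp add: majorant_def ennreal_plus[symmetric] ennreal_mult[symmetric] mult_ac del: ennreal_plus)
  also have "\<dots> = ennreal (m powr (-1/2)) * ennreal (4 * m powr (1/4)) + ennreal (4 * m powr (-1/4))"
    by (subst nn_integral_add, simp, simp, subst nn_integral_cmult, simp) (simp only: 1 2)
  also have "\<dots> = ennreal (m powr (-1/2) * (4 * m powr (1/4)) + 4 * m powr (-1/4))"
    by (simp add: ennreal_plus[symmetric] ennreal_mult[symmetric] del: ennreal_plus)
  also have "m powr (-1/2) * (4 * m powr (1/4)) = 4 * m powr (-1/4)"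
    by (simp add: powr_add[symmetric])
  finally show ?thesis by simp
qed

lemma eq_n_pos: "x > 0 \<Longrightarrow> \<mu> \<ge> 0 \<Longrightarrow> eq_n \<mu> x > 0"
  by (simp add: eq_n_def)

lemma eq_n_nonneg: "x \<ge> 0 \<Longrightarrow> \<mu> \<ge> 0 \<Longrightarrow> eq_n \<mu> x \<ge> 0"
  by (simp add: eq_n_def)

lemma coll_weight_eq: "coll_weight x y z = min (min (sqrt x) (sqrt y)) (min (sqrt z) (sqrt (y + z - x))) / sqrt x"
  by (simp add: coll_weight_def min.assoc)

text \<open>Let \<open>w = y + z - x\<close>. Because \<open>x + z + w = y + 2z \<le> 3y\<close>, the factor \<open>n(y)\<close> of the larger outgoing
frequency is small: it produces both the factor \<open>n(x)\<close> and the decay \<open>((m + z) (m + w))\<^bsup>-1/2\<^esup>\<close> at infinity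
in the two remaining frequencies. The weight and the factors \<open>n(z) n(w)\<close> produce the integrable singularities
\<open>(z w)\<^bsup>-3/4\<^esup>\<close>. What remains is a product of a function of \<open>z\<close> and a function of \<open>w\<close>.\<close>

lemma coll_kernel_le_ordered:
  assumes x: "x > 0" and z: "z > 0" and w: "y + z - x > 0" and yz: "z \<le> y" and mu: "\<mu> \<ge> 0"
  defines "m \<equiv> max x \<mu>"
  shows "coll_kernel \<mu> x y z \<le> 6 * m powr (1/2) * eq_n \<mu> x * (majorant m (y + z - x) * majorant m z)"
proof -
  define w where "w = y + z - x"
  have wp: "w > 0" using w by (simp add: w_def)
  have m: "m > 0" using x by (simp add: m_def)
  have y: "y > 0" using yz z by simp
  define s where "s u = min 1 (u powr (1/4) / x powr (1/4))" for u
  have s0: "s u \<ge> 0" for u by (simp add: s_def)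
  have sq: "(u powr (1/4) / x powr (1/4))\<^sup>2 = sqrt u / sqrt x" if "u > 0" for u
    using that x by (simp add: power_divide powr_power powr_half_sqrt)
  have "coll_weight x y z \<le> min 1 (min (sqrt z / sqrt x) (sqrt w / sqrt x))"
    unfolding coll_weight_eq w_def[symmetric] using x by (auto simp: min_def divide_right_mono field_simps)
  also have "\<dots> \<le> s z * s w"
    using min_one_le_product[of "z powr (1/4) / x powr (1/4)" "w powr (1/4) / x powr (1/4)"]
    by (simp add: s_def sq[OF z] sq[OF wp])
  finally have W: "coll_weight x y z \<le> s z * s w" .
  have ny: "eq_n \<mu> y \<le> 6 * m * eq_n \<mu> x * (1 / sqrt (m + z) * (1 / sqrt (m + w)))"
  proof -
    have xm: "x + \<mu> > 0" using x mu by simp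
    have "sqrt (m + z) * sqrt (m + w) \<le> m + z + w"
      unfolding real_sqrt_mult[symmetric] using m z wp
      by (intro real_le_lsqrt) (auto simp: power2_eq_square algebra_simps)
    moreover have "(x + \<mu>) * (m + z + w) \<le> 6 * m * (y + \<mu>)"
    proof -
      have m2: "x + \<mu> \<le> 2 * m" by (simp add: m_def)
      (* x + w = y + z by energy conservation, and z \<le> y *)
      have 3: "x + \<mu> + z + w \<le> 3 * (y + \<mu>)" using yz mu by (simp add: w_def)
      have "(x + \<mu>) * (m + z + w) = (x + \<mu>) * m + (x + \<mu>) * (z + w)" by (simp add: algebra_simps)
      also have "\<dots> \<le> 2 * m * (x + \<mu>) + 2 * m * (z + w)"
        using m2 z wp xm m by (intro add_mono mult_right_mono) (auto simp: mult.commute)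
      also have "\<dots> = 2 * m * (x + \<mu> + z + w)" by (simp add: algebra_simps)
      also have "\<dots> \<le> 2 * m * (3 * (y + \<mu>))" using 3 m by (intro mult_left_mono) auto
      finally show ?thesis by (simp only: mult.assoc mult.left_commute[of 3])
    qed
    ultimately have "(x + \<mu>) * (sqrt (m + z) * sqrt (m + w)) \<le> 6 * m * (y + \<mu>)"
      using xm by (meson less_imp_le mult_left_mono order_trans)
    moreover have "sqrt (m + z) * sqrt (m + w) > 0" "y + \<mu> > 0" using y mu m z wp by auto
    moreover have "1 / (y + \<mu>) \<le> 6 * m * (1 / (x + \<mu>)) * (1 / S)"
      if "(x + \<mu>) * S \<le> 6 * m * (y + \<mu>)" "S > 0" "y + \<mu> > 0" for S
      using that xm by (simp add: divide_simps mult_ac)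
    ultimately have "1 / (y + \<mu>) \<le> 6 * m * (1 / (x + \<mu>)) * (1 / (sqrt (m + z) * sqrt (m + w)))" by blast
    then show ?thesis by (simp add: eq_n_def)
  qed
  have b: "s u * eq_n \<mu> u \<le> u powr (-3/4) * m powr (-1/4)" if "u > 0" for u
    using damped_weight_le[OF x that mu] by (simp add: s_def m_def)
  have "coll_kernel \<mu> x y z = coll_weight x y z * (eq_n \<mu> z * eq_n \<mu> w) * eq_n \<mu> y"
    by (simp add: coll_kernel_def w_def mult_ac)
  also have "\<dots> \<le> (s z * s w) * (eq_n \<mu> z * eq_n \<mu> w) * eq_n \<mu> y"
    using W z wp y mu by (intro mult_right_mono mult_nonneg_nonneg eq_n_nonneg) auto
  also have "\<dots> = (s z * eq_n \<mu> z) * (s w * eq_n \<mu> w) * eq_n \<mu> y" by (simp add: mult_ac)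
  also have "\<dots> \<le> ((z powr (-3/4) * m powr (-1/4)) * (w powr (-3/4) * m powr (-1/4)))
       * (6 * m * eq_n \<mu> x * (1 / sqrt (m + z) * (1 / sqrt (m + w))))"
    using b[OF z] b[OF wp] ny s0 z wp y mu
    by (intro mult_mono[of "s z * eq_n \<mu> z * (s w * eq_n \<mu> w)"] mult_mono[of "s z * eq_n \<mu> z"]
         mult_nonneg_nonneg eq_n_nonneg) auto
  also have "\<dots> = 6 * (m * (m powr (-1/4) * m powr (-1/4))) * eq_n \<mu> x *
       ((w powr (-3/4) / sqrt (m + w)) * (z powr (-3/4) / sqrt (m + z)))" by (simp add: mult_ac)
  also have "m * (m powr (-1/4) * m powr (-1/4)) = m powr (1/2)"
    using m powr_add[of m 1 "-1/2"] by (simp add: powr_add[symmetric])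
  also have "6 * m powr (1/2) * eq_n \<mu> x * ((w powr (-3/4) / sqrt (m + w)) * (z powr (-3/4) / sqrt (m + z)))
      \<le> 6 * m powr (1/2) * eq_n \<mu> x * (majorant m w * majorant m z)"
    using majorant_ge[OF z m] majorant_ge[OF wp m] m x mu z wp
    by (intro mult_left_mono mult_mono[of "w powr (-3/4) / sqrt (m + w)"] mult_nonneg_nonneg majorant_nonneg eq_n_nonneg) auto
  finally show ?thesis by (simp add: w_def)
qed

lemma coll_kernel_swap: "coll_kernel \<mu> x z y = coll_kernel \<mu> x y z"
  by (simp add: coll_kernel_def coll_weight_eq min.commute min.left_commute min.assoc mult_ac add.commute)

definition coll_rate :: "real \<Rightarrow> real \<Rightarrow> real \<times> real \<Rightarrow> real" where
  "coll_rate \<mu> x q = indicator (coll_dom x) q * coll_kernel \<mu> x (fst q) (snd q)"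

lemma coll_rate_nonneg:
  assumes "x > 0" "\<mu> \<ge> 0"
  shows "coll_rate \<mu> x q \<ge> 0"
  using assms unfolding coll_rate_def coll_kernel_def coll_weight_eq coll_dom_def
  by (auto simp: indicator_def split: prod.splits intro!: mult_nonneg_nonneg eq_n_nonneg divide_nonneg_pos)

text \<open>The kernel bound requires an order of the outgoing frequencies, so both orders are added up. On the boundary of the
domain the weight vanishes, whatever the other factors are.\<close>

lemma coll_rate_le:
  assumes x: "x > 0" and mu: "\<mu> \<ge> 0"
  defines "m \<equiv> max x \<mu>"
  shows "coll_rate \<mu> x (y, z) \<le> 6 * m powr (1/2) * eq_n \<mu> x *
     (majorant m (y + z - x) * majorant m y + majorant m (y + z - x) * majorant m z)" (is "_ \<le> ?C * (?A + ?B)")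
proof -
  have nn: "?C \<ge> 0" "?A \<ge> 0" "?B \<ge> 0"
    using x mu by (auto intro!: mult_nonneg_nonneg majorant_nonneg eq_n_nonneg)
  show ?thesis
  proof (cases "y > 0 \<and> z > 0 \<and> y + z - x > 0")
    case True
    then have r: "coll_rate \<mu> x (y, z) = coll_kernel \<mu> x y z" by (simp add: coll_rate_def coll_dom_def)
    consider "z \<le> y" | "y \<le> z" by linarith
    then have "coll_kernel \<mu> x y z \<le> ?C * ?A \<or> coll_kernel \<mu> x y z \<le> ?C * ?B"
    proof cases
      case 1
      then show ?thesis using coll_kernel_le_ordered[OF x, of z y \<mu>] True mu by (simp add: m_def)
    next
      case 2
      then show ?thesis using coll_kernel_le_ordered[OF x, of y z \<mu>] True mu
        by (simp add: m_def coll_kernel_swap add.commute)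
    qed
    moreover have "?C * ?A \<le> ?C * (?A + ?B)" "?C * ?B \<le> ?C * (?A + ?B)" using nn(2,3) by (intro mult_left_mono[OF _ nn(1)], simp)+
    ultimately show ?thesis using r by linarith
  next
    case False
    have "coll_rate \<mu> x (y, z) = 0"
    proof (cases "(y, z) \<in> coll_dom x")
      case True
      then have "y = 0 \<or> z = 0 \<or> y + z - x = 0" using False by (auto simp: coll_dom_def)
      then have "coll_weight x y z = 0"
        using x True by (auto simp: coll_weight_eq coll_dom_def min_def)
      then show ?thesis by (simp add: coll_rate_def coll_kernel_def)
    qed (simp add: coll_rate_def)
    then show ?thesis using nn by simp
  qed
qed

lemma measurable_eq_n [measurable]: "eq_n \<mu> \<in> borel_measurable borel"
  unfolding eq_n_def by measurable

lemma coll_dom_iff: "q \<in> coll_dom x \<longleftrightarrow> 0 \<le> fst q \<and> 0 \<le> snd q \<and> x \<le> fst q + snd q"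
  by (auto simp: coll_dom_def split: prod.splits)

lemma measurable_coll_rate [measurable]:
  assumes [measurable]: "f \<in> borel_measurable M" "g \<in> M \<rightarrow>\<^sub>M (borel :: (real \<times> real) measure)"
  shows "(\<lambda>p. coll_rate \<mu> (f p) (g p)) \<in> borel_measurable M"
proof -
  have [measurable]: "(\<lambda>p. fst (g p)) \<in> borel_measurable M" "(\<lambda>p. snd (g p)) \<in> borel_measurable M"
    using assms(2) by (auto simp: borel_prod[symmetric])
  have "(\<lambda>p. coll_rate \<mu> (f p) (g p)) = (\<lambda>p. if 0 \<le> fst (g p) \<and> 0 \<le> snd (g p) \<and> f p \<le> fst (g p) + snd (g p)
    then coll_kernel \<mu> (f p) (fst (g p)) (snd (g p)) else 0)"
    by (auto simp: coll_rate_def coll_dom_iff indicator_def fun_eq_iff)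
  also have "\<dots> \<in> borel_measurable M"
    unfolding coll_kernel_def coll_weight_eq by measurable
  finally show ?thesis .
qed

lemma nn_integral_lborel2:
  assumes "F \<in> borel_measurable (borel :: (real \<times> real) measure)"
  shows "(\<integral>\<^sup>+q. F q \<partial>lborel) = (\<integral>\<^sup>+y. \<integral>\<^sup>+z. F (y, z) \<partial>lborel \<partial>lborel)"
  unfolding lborel_prod[symmetric]
  by (rule lborel.nn_integral_fst[symmetric]) (use assms in \<open>simp add: lborel_prod\<close>)

lemma nn_integral_lborel2_swap:
  assumes F: "(\<lambda>q. F (fst q) (snd q)) \<in> borel_measurable (borel :: (real \<times> real) measure)"
  shows "(\<integral>\<^sup>+y. \<integral>\<^sup>+z. F y z \<partial>lborel \<partial>lborel) = (\<integral>\<^sup>+z. \<integral>\<^sup>+y. F y z \<partial>lborel \<partial>(lborel :: real measure))"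
  by (rule lborel_pair.Fubini'[symmetric]) (use F in \<open>simp add: lborel_prod split_beta'\<close>)

lemma nn_integral_shift:
  assumes "f \<in> borel_measurable borel"
  shows "(\<integral>\<^sup>+x. f (x + t) \<partial>lborel) = (\<integral>\<^sup>+x. f x \<partial>(lborel :: real measure))"
  using nn_integral_real_affine[OF assms, of 1 t] by (simp add: add.commute)

lemma nn_integral_reflect:
  assumes "f \<in> borel_measurable borel"
  shows "(\<integral>\<^sup>+x. f (t - x) \<partial>lborel) = (\<integral>\<^sup>+x. f x \<partial>(lborel :: real measure))"
  using nn_integral_real_affine[OF assms, of "-1" t] by simp

text \<open>Equivalently, the multiplier \<open>a\<^sub>\<mu>\<close> is bounded by \<open>768\<close>. After the shift \<open>z \<mapsto> y + z - x\<close> the bound on the kernel is a product, and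
the powers of \<open>m\<close> cancel. The constant is \<open>768 = 6 \<cdot> 2 \<cdot> 8\<^sup>2\<close>, from the kernel bound, the two orders of the outgoing
frequencies, and the square of the integral of the majorant.\<close>

lemma nn_integral_coll_rate_le:
  assumes x: "x > 0" and mu: "\<mu> \<ge> 0"
  shows "(\<integral>\<^sup>+q. ennreal (coll_rate \<mu> x q) \<partial>lborel) \<le> ennreal (768 * eq_n \<mu> x)"
proof -
  define m where "m = max x \<mu>"
  define I where "I = ennreal (8 * m powr (-1/4))"
  have m: "m > 0" using x by (simp add: m_def)
  have I: "(\<integral>\<^sup>+z. ennreal (majorant m z) \<partial>lborel) = I" using nn_integral_majorant[OF m] by (simp add: I_def)
  have inner: "(\<integral>\<^sup>+z. ennreal (majorant m (y + z - x)) \<partial>lborel) = I" for y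
    using nn_integral_shift[of "\<lambda>z. ennreal (majorant m z)" "y - x"] by (simp add: I algebra_simps)
  have A: "(\<integral>\<^sup>+y. \<integral>\<^sup>+z. ennreal (majorant m (y + z - x) * majorant m y) \<partial>lborel \<partial>lborel) = I * I"
  proof -
    have "(\<integral>\<^sup>+z. ennreal (majorant m (y + z - x) * majorant m y) \<partial>lborel) = I * ennreal (majorant m y)" for y
      by (simp add: ennreal_mult majorant_nonneg nn_integral_multc inner)
    then show ?thesis by (simp add: nn_integral_cmult I)
  qed
  have B: "(\<integral>\<^sup>+y. \<integral>\<^sup>+z. ennreal (majorant m (y + z - x) * majorant m z) \<partial>lborel \<partial>lborel) = I * I"
  proof -
    have "(\<integral>\<^sup>+y. \<integral>\<^sup>+z. ennreal (majorant m (y + z - x) * majorant m z) \<partial>lborel \<partial>lborel)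
       = (\<integral>\<^sup>+z. \<integral>\<^sup>+y. ennreal (majorant m (y + z - x) * majorant m z) \<partial>lborel \<partial>lborel)"
      by (rule nn_integral_lborel2_swap) (simp add: borel_prod[symmetric])
    also have "\<dots> = I * I" using A by (simp add: add.commute)
    finally show ?thesis .
  qed
  define C where "C = 6 * m powr (1/2) * eq_n \<mu> x"
  have C: "C \<ge> 0" using x mu by (simp add: C_def eq_n_nonneg)
  have "(\<integral>\<^sup>+q. ennreal (coll_rate \<mu> x q) \<partial>lborel) = (\<integral>\<^sup>+y. \<integral>\<^sup>+z. ennreal (coll_rate \<mu> x (y, z)) \<partial>lborel \<partial>lborel)"
    by (rule nn_integral_lborel2) measurable
  also have "\<dots> \<le> (\<integral>\<^sup>+y. \<integral>\<^sup>+z. ennreal C * (ennreal (majorant m (y + z - x) * majorant m y)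
       + ennreal (majorant m (y + z - x) * majorant m z)) \<partial>lborel \<partial>lborel)"
  proof (intro nn_integral_mono)
    fix y z
    have "ennreal (coll_rate \<mu> x (y, z)) \<le> ennreal (C * (majorant m (y + z - x) * majorant m y + majorant m (y + z - x) * majorant m z))"
      using coll_rate_le[OF x mu, of y z] unfolding C_def m_def by (rule ennreal_leI)
    also have "\<dots> = ennreal C * (ennreal (majorant m (y + z - x) * majorant m y) + ennreal (majorant m (y + z - x) * majorant m z))"
      using C by (simp add: ennreal_mult majorant_nonneg)
    finally show "ennreal (coll_rate \<mu> x (y, z)) \<le> \<dots>" .
  qed
  also have "\<dots> = ennreal C * (I * I + I * I)"
    by (simp add: nn_integral_cmult nn_integral_add A B)
  also have "\<dots> = ennreal (C * (2 * (8 * m powr (-1/4)) ^ 2))"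
  proof -
    have "ennreal C * (ennreal r * ennreal r + ennreal r * ennreal r) = ennreal (C * (2 * r ^ 2))" if "r \<ge> 0" for r
      using C that by (simp add: ennreal_mult[symmetric] ennreal_plus[symmetric] power2_eq_square del: ennreal_plus)
    then show ?thesis unfolding I_def by simp
  qed
  also have "C * (2 * (8 * m powr (-1/4)) ^ 2) = 768 * eq_n \<mu> x * (m powr (1/2) * (m powr (-1/4) * m powr (-1/4)))"
    by (simp add: C_def power2_eq_square)
  also have "m powr (1/2) * (m powr (-1/4) * m powr (-1/4)) = 1" using m by (simp add: powr_add[symmetric])
  finally show ?thesis by simp
qed

section \<open>The invariant measure on collisions\<close>

text \<open>A collision is encoded by the three frequencies \<open>(\<omega>, \<omega>\<^sub>1, \<omega>\<^sub>2)\<close>; the fourth follows from energy conservation.\<close>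

definition freq3 :: "real \<times> real \<times> real \<Rightarrow> real" where
  "freq3 p = fst (snd p) + snd (snd p) - fst p"

definition coll_density :: "real \<Rightarrow> real \<times> real \<times> real \<Rightarrow> real" where
  "coll_density \<mu> p = indicator {0<..} (fst p) * sqrt (fst p) * eq_n \<mu> (fst p) * coll_rate \<mu> (fst p) (snd p)"

definition coll_measure :: "real \<Rightarrow> (real \<times> real \<times> real) measure" where
  "coll_measure \<mu> = density lborel (\<lambda>p. ennreal (coll_density \<mu> p))"

lemma measurable_triple [measurable]:
  "(\<lambda>p. fst p) \<in> borel_measurable (borel :: (real \<times> real \<times> real) measure)"
  "(\<lambda>p. snd p) \<in> (borel :: (real \<times> real \<times> real) measure) \<rightarrow>\<^sub>M borel"
  "(\<lambda>p. fst (snd p)) \<in> borel_measurable (borel :: (real \<times> real \<times> real) measure)"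
  "(\<lambda>p. snd (snd p)) \<in> borel_measurable (borel :: (real \<times> real \<times> real) measure)"
  "(\<lambda>q. fst q) \<in> borel_measurable (borel :: (real \<times> real) measure)"
  "(\<lambda>q. snd q) \<in> borel_measurable (borel :: (real \<times> real) measure)"
  by (simp_all add: borel_prod[symmetric])

lemma measurable_freq3 [measurable]: "freq3 \<in> borel_measurable borel"
  unfolding freq3_def by measurable

lemma measurable_coll_density [measurable]: "coll_density \<mu> \<in> borel_measurable borel"
  unfolding coll_density_def by measurable

lemma sets_coll_measure [simp, measurable_cong]: "sets (coll_measure \<mu>) = sets borel"
  by (simp add: coll_measure_def)

lemma space_coll_measure [simp]: "space (coll_measure \<mu>) = UNIV"
  by (simp add: coll_measure_def)

text \<open>The symmetric form of the density. The strict inequalities agree with the closed domain because the minimum of the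
four roots vanishes on its boundary; with them the domain is symmetric as well.\<close>

lemma coll_density_eq:
  "coll_density \<mu> (x, y, z) = (if x > 0 \<and> y > 0 \<and> z > 0 \<and> y + z - x > 0
     then min (min (sqrt x) (sqrt y)) (min (sqrt z) (sqrt (y + z - x)))
       * (eq_n \<mu> x * eq_n \<mu> y * eq_n \<mu> z * eq_n \<mu> (y + z - x)) else 0)"
proof (cases "x > 0 \<and> y \<ge> 0 \<and> z \<ge> 0 \<and> y + z \<ge> x")
  case True
  then have "coll_density \<mu> (x, y, z) = min (min (sqrt x) (sqrt y)) (min (sqrt z) (sqrt (y + z - x)))
       * (eq_n \<mu> x * eq_n \<mu> y * eq_n \<mu> z * eq_n \<mu> (y + z - x))"
    by (simp add: coll_density_def coll_rate_def coll_dom_def coll_kernel_def coll_weight_eq)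
  moreover have "min (min (sqrt x) (sqrt y)) (min (sqrt z) (sqrt (y + z - x))) = 0"
    if "\<not> (x > 0 \<and> y > 0 \<and> z > 0 \<and> y + z - x > 0)"
  proof -
    have "y = 0 \<or> z = 0 \<or> y + z - x = 0" using that True by auto
    then show ?thesis using True by (auto simp: min_def)
  qed
  ultimately show ?thesis by simp
qed (auto simp: coll_density_def coll_rate_def coll_dom_def)

lemma coll_density_nonneg: "\<mu> \<ge> 0 \<Longrightarrow> coll_density \<mu> p \<ge> 0"
  by (cases p rule: prod_cases3) (auto simp: coll_density_eq intro!: mult_nonneg_nonneg eq_n_nonneg)

lemma coll_density_symmetries:
  "coll_density \<mu> (x, z, y) = coll_density \<mu> (x, y, z)"
  "coll_density \<mu> (y, x, y + z - x) = coll_density \<mu> (x, y, z)"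
  "coll_density \<mu> (y + z - x, y, z) = coll_density \<mu> (x, y, z)"
  by (simp_all add: coll_density_eq add.commute min.commute min.left_commute min.assoc mult_ac)

text \<open>The three orders of integration that the changes of variables below need.\<close>

lemma nn_integral_lborel3:
  assumes [measurable]: "F \<in> borel_measurable (borel :: (real \<times> real \<times> real) measure)"
  shows "(\<integral>\<^sup>+p. F p \<partial>lborel) = (\<integral>\<^sup>+x. \<integral>\<^sup>+q. F (x, q) \<partial>lborel \<partial>lborel)"
    "(\<integral>\<^sup>+p. F p \<partial>lborel) = (\<integral>\<^sup>+q. \<integral>\<^sup>+x. F (x, q) \<partial>lborel \<partial>lborel)"
    "(\<integral>\<^sup>+p. F p \<partial>lborel) = (\<integral>\<^sup>+x. \<integral>\<^sup>+y. \<integral>\<^sup>+z. F (x, y, z) \<partial>lborel \<partial>lborel \<partial>lborel)"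
proof -
  have F': "F \<in> borel_measurable (lborel \<Otimes>\<^sub>M lborel)" by (simp add: lborel_prod)
  show 1: "(\<integral>\<^sup>+p. F p \<partial>lborel) = (\<integral>\<^sup>+x. \<integral>\<^sup>+q. F (x, q) \<partial>lborel \<partial>lborel)"
    unfolding lborel_prod[where 'a=real and 'b="real \<times> real", symmetric]
    by (rule lborel.nn_integral_fst[symmetric, OF F'])
  show "(\<integral>\<^sup>+p. F p \<partial>lborel) = (\<integral>\<^sup>+q. \<integral>\<^sup>+x. F (x, q) \<partial>lborel \<partial>lborel)"
    unfolding lborel_prod[where 'a=real and 'b="real \<times> real", symmetric]
    by (rule lborel_pair.nn_integral_snd[symmetric, OF F'])
  have "(\<integral>\<^sup>+q. F (x, q) \<partial>lborel) = (\<integral>\<^sup>+y. \<integral>\<^sup>+z. F (x, y, z) \<partial>lborel \<partial>lborel)" for x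
  proof (rule nn_integral_lborel2)
    have "(\<lambda>q. (x, q)) \<in> borel \<rightarrow>\<^sub>M (borel :: (real \<times> real \<times> real) measure)"
      by (simp add: borel_prod[symmetric])
    from measurable_compose[OF this assms] show "(\<lambda>q. F (x, q)) \<in> borel_measurable borel" .
  qed
  with 1 show "(\<integral>\<^sup>+p. F p \<partial>lborel) = (\<integral>\<^sup>+x. \<integral>\<^sup>+y. \<integral>\<^sup>+z. F (x, y, z) \<partial>lborel \<partial>lborel \<partial>lborel)" by simp
qed

lemma measurable_Pair_borel [measurable (raw)]:
  assumes "f \<in> M \<rightarrow>\<^sub>M borel" "g \<in> M \<rightarrow>\<^sub>M borel"
  shows "(\<lambda>x. (f x :: 'a::second_countable_topology, g x :: 'b::second_countable_topology)) \<in> M \<rightarrow>\<^sub>M borel"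
  unfolding borel_prod[symmetric] using assms by measurable

lemma lborel_symmetry_swap:
  assumes [measurable]: "F \<in> borel_measurable (borel :: (real \<times> real \<times> real) measure)"
  shows "(\<integral>\<^sup>+p. F (fst p, snd (snd p), fst (snd p)) \<partial>lborel) = (\<integral>\<^sup>+p. F p \<partial>lborel)"
proof -
  have "(\<integral>\<^sup>+p. F (fst p, snd (snd p), fst (snd p)) \<partial>lborel)
      = (\<integral>\<^sup>+x. \<integral>\<^sup>+y. \<integral>\<^sup>+z. F (x, z, y) \<partial>lborel \<partial>lborel \<partial>lborel)"
    by (subst nn_integral_lborel3(3)) simp_all
  also have "\<dots> = (\<integral>\<^sup>+x. \<integral>\<^sup>+z. \<integral>\<^sup>+y. F (x, z, y) \<partial>lborel \<partial>lborel \<partial>lborel)"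
    by (rule nn_integral_cong, rule nn_integral_lborel2_swap) measurable
  also have "\<dots> = (\<integral>\<^sup>+p. F p \<partial>lborel)" by (rule nn_integral_lborel3(3)[symmetric]) simp
  finally show ?thesis .
qed

lemma lborel_symmetry_reflect:
  assumes [measurable]: "F \<in> borel_measurable (borel :: (real \<times> real \<times> real) measure)"
  shows "(\<integral>\<^sup>+p. F (freq3 p, snd p) \<partial>lborel) = (\<integral>\<^sup>+p. F p \<partial>lborel)"
proof -
  have "(\<integral>\<^sup>+p. F (freq3 p, snd p) \<partial>lborel) = (\<integral>\<^sup>+q. \<integral>\<^sup>+x. F (fst q + snd q - x, q) \<partial>lborel \<partial>lborel)"
    by (subst nn_integral_lborel3(2)) (simp_all add: freq3_def)
  also have "\<dots> = (\<integral>\<^sup>+q. \<integral>\<^sup>+x. F (x, q) \<partial>lborel \<partial>lborel)"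
    by (intro nn_integral_cong nn_integral_reflect) measurable
  also have "\<dots> = (\<integral>\<^sup>+p. F p \<partial>lborel)" by (rule nn_integral_lborel3(2)[symmetric]) simp
  finally show ?thesis .
qed

lemma lborel_symmetry_exchange:
  assumes [measurable]: "F \<in> borel_measurable (borel :: (real \<times> real \<times> real) measure)"
  shows "(\<integral>\<^sup>+p. F (fst (snd p), fst p, freq3 p) \<partial>lborel) = (\<integral>\<^sup>+p. F p \<partial>lborel)"
proof -
  have "(\<integral>\<^sup>+p. F (fst (snd p), fst p, freq3 p) \<partial>lborel)
      = (\<integral>\<^sup>+x. \<integral>\<^sup>+y. \<integral>\<^sup>+z. F (y, x, z + (y - x)) \<partial>lborel \<partial>lborel \<partial>lborel)"
    by (subst nn_integral_lborel3(3)) (simp_all add: freq3_def algebra_simps)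
  also have "\<dots> = (\<integral>\<^sup>+x. \<integral>\<^sup>+y. \<integral>\<^sup>+z. F (y, x, z) \<partial>lborel \<partial>lborel \<partial>lborel)"
    by (intro nn_integral_cong nn_integral_shift[of "\<lambda>z. F (_, _, z)"]) measurable
  also have "\<dots> = (\<integral>\<^sup>+y. \<integral>\<^sup>+x. \<integral>\<^sup>+z. F (y, x, z) \<partial>lborel \<partial>lborel \<partial>lborel)"
  proof (rule nn_integral_lborel2_swap)
    have "(\<lambda>p. (snd (fst p), fst (fst p), snd p)) \<in> (borel :: (real \<times> real) measure) \<Otimes>\<^sub>M (lborel :: real measure) \<rightarrow>\<^sub>M borel"
      unfolding borel_prod[symmetric] by measurable
    from measurable_compose[OF this assms]
    show "(\<lambda>q. \<integral>\<^sup>+z. F (snd q, fst q, z) \<partial>lborel) \<in> borel_measurable borel"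
      by (intro lborel.borel_measurable_nn_integral) (simp add: split_beta')
  qed
  also have "\<dots> = (\<integral>\<^sup>+p. F p \<partial>lborel)" by (rule nn_integral_lborel3(3)[symmetric]) simp
  finally show ?thesis .
qed

lemma distr_coll_measure:
  assumes [measurable]: "S \<in> borel \<rightarrow>\<^sub>M borel"
    and inv: "\<And>F. F \<in> borel_measurable borel \<Longrightarrow> (\<integral>\<^sup>+p. F (S p) \<partial>lborel) = (\<integral>\<^sup>+p. F p \<partial>lborel)"
    and dens: "\<And>p. coll_density \<mu> (S p) = coll_density \<mu> p"
  shows "distr (coll_measure \<mu>) borel S = coll_measure \<mu>"
proof (rule measure_eqI)
  fix A assume "A \<in> sets (distr (coll_measure \<mu>) borel S)"
  then have [measurable]: "A \<in> sets borel" by simp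
  have [measurable]: "S -` A \<in> sets borel" using measurable_sets[OF assms(1), of A] by simp
  have "emeasure (distr (coll_measure \<mu>) borel S) A = emeasure (coll_measure \<mu>) (S -` A)"
    by (subst emeasure_distr) auto
  also have "\<dots> = (\<integral>\<^sup>+p. ennreal (coll_density \<mu> p) * indicator (S -` A) p \<partial>lborel)"
    unfolding coll_measure_def by (subst emeasure_density) auto
  also have "\<dots> = (\<integral>\<^sup>+p. ennreal (coll_density \<mu> (S p)) * indicator A (S p) \<partial>lborel)"
    by (intro nn_integral_cong) (simp add: dens indicator_def)
  also have "\<dots> = (\<integral>\<^sup>+p. ennreal (coll_density \<mu> p) * indicator A p \<partial>lborel)"
    by (rule inv) measurable
  also have "\<dots> = emeasure (coll_measure \<mu>) A"
    unfolding coll_measure_def by (subst emeasure_density) auto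
  finally show "emeasure (distr (coll_measure \<mu>) borel S) A = emeasure (coll_measure \<mu>) A" .
qed simp

text \<open>In terms of \<open>(\<omega>, \<omega>\<^sub>1, \<omega>\<^sub>2)\<close> these are the exchange of \<open>\<omega>\<^sub>1\<close> and \<open>\<omega>\<^sub>2\<close>, the exchange of \<open>\<omega>\<close> and
\<open>\<omega>\<^sub>3\<close>, and the reversal of the collision, which exchanges \<open>\<omega>\<close> with \<open>\<omega>\<^sub>1\<close> and \<open>\<omega>\<^sub>2\<close> with \<open>\<omega>\<^sub>3\<close>.\<close>

lemma coll_measure_invariant:
  "distr (coll_measure \<mu>) borel (\<lambda>p. (fst p, snd (snd p), fst (snd p))) = coll_measure \<mu>"
  "distr (coll_measure \<mu>) borel (\<lambda>p. (freq3 p, snd p)) = coll_measure \<mu>"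
  "distr (coll_measure \<mu>) borel (\<lambda>p. (fst (snd p), fst p, freq3 p)) = coll_measure \<mu>"
proof -
  show "distr (coll_measure \<mu>) borel (\<lambda>p. (fst p, snd (snd p), fst (snd p))) = coll_measure \<mu>"
    by (rule distr_coll_measure, measurable, rule lborel_symmetry_swap, assumption)
      (auto simp: coll_density_symmetries)
  show "distr (coll_measure \<mu>) borel (\<lambda>p. (freq3 p, snd p)) = coll_measure \<mu>"
    by (rule distr_coll_measure, measurable, rule lborel_symmetry_reflect, assumption)
      (auto simp: coll_density_symmetries freq3_def)
  show "distr (coll_measure \<mu>) borel (\<lambda>p. (fst (snd p), fst p, freq3 p)) = coll_measure \<mu>"
    by (rule distr_coll_measure, measurable, rule lborel_symmetry_exchange, assumption)
      (auto simp: coll_density_symmetries freq3_def)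
qed

text \<open>A coordinate with the same law as \<open>\<omega>\<close>. Treating the four frequencies uniformly, through this property, reduces
the four terms of the operator to one.\<close>

definition collision_frequency :: "real \<Rightarrow> (real \<times> real \<times> real \<Rightarrow> real) \<Rightarrow> bool" where
  "collision_frequency \<mu> X \<longleftrightarrow> X \<in> borel_measurable borel \<and>
     distr (coll_measure \<mu>) borel X = distr (coll_measure \<mu>) borel fst"

lemma collision_frequency_compose:
  assumes X: "collision_frequency \<mu> X" and [measurable]: "S \<in> borel \<rightarrow>\<^sub>M borel"
    and S: "distr (coll_measure \<mu>) borel S = coll_measure \<mu>"
  shows "collision_frequency \<mu> (\<lambda>p. X (S p))"
proof -
  have [measurable]: "X \<in> borel_measurable borel" using X by (simp add: collision_frequency_def)
  have "distr (coll_measure \<mu>) borel (\<lambda>p. X (S p)) = distr (distr (coll_measure \<mu>) borel S) borel X"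
    by (subst distr_distr) (auto simp: comp_def)
  also have "\<dots> = distr (coll_measure \<mu>) borel fst" using X by (simp add: S collision_frequency_def)
  finally show ?thesis by (simp add: collision_frequency_def)
qed

text \<open>The symmetries of the collision measure act transitively on the four frequencies.\<close>

lemma collision_frequencies:
  "collision_frequency \<mu> fst" "collision_frequency \<mu> (\<lambda>p. fst (snd p))"
  "collision_frequency \<mu> (\<lambda>p. snd (snd p))" "collision_frequency \<mu> freq3"
proof -
  show 0: "collision_frequency \<mu> fst" by (simp add: collision_frequency_def)
  show 1: "collision_frequency \<mu> (\<lambda>p. fst (snd p))"
    using collision_frequency_compose[OF 0 _ coll_measure_invariant(3)] by simp
  show "collision_frequency \<mu> (\<lambda>p. snd (snd p))"
    using collision_frequency_compose[OF 1 _ coll_measure_invariant(1)] by simp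
  show "collision_frequency \<mu> freq3"
    using collision_frequency_compose[OF 0 _ coll_measure_invariant(2)] by simp
qed

text \<open>Disintegration of the collision measure over its first coordinate, relative to the measure of the Hilbert space.\<close>

lemma nn_integral_coll_measure:
  assumes mu: "\<mu> \<ge> 0" and [measurable]: "F \<in> borel_measurable borel"
  shows "(\<integral>\<^sup>+p. F p \<partial>coll_measure \<mu>)
     = (\<integral>\<^sup>+x. ennreal (eq_n \<mu> x) * (\<integral>\<^sup>+q. ennreal (coll_rate \<mu> x q) * F (x, q) \<partial>lborel) \<partial>wmeasure)"
proof -
  have "(\<integral>\<^sup>+p. F p \<partial>coll_measure \<mu>) = (\<integral>\<^sup>+p. ennreal (coll_density \<mu> p) * F p \<partial>lborel)"
    unfolding coll_measure_def by (subst nn_integral_density) auto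
  also have "\<dots> = (\<integral>\<^sup>+x. \<integral>\<^sup>+q. ennreal (coll_density \<mu> (x, q)) * F (x, q) \<partial>lborel \<partial>lborel)"
    by (rule nn_integral_lborel3(1)) measurable
  also have "\<dots> = (\<integral>\<^sup>+x. ennreal (indicator {0<..} x * sqrt x) *
      (ennreal (eq_n \<mu> x) * (\<integral>\<^sup>+q. ennreal (coll_rate \<mu> x q) * F (x, q) \<partial>lborel)) \<partial>lborel)"
  proof (rule nn_integral_cong)
    fix x
    show "(\<integral>\<^sup>+q. ennreal (coll_density \<mu> (x, q)) * F (x, q) \<partial>lborel) =
       ennreal (indicator {0<..} x * sqrt x) * (ennreal (eq_n \<mu> x) * (\<integral>\<^sup>+q. ennreal (coll_rate \<mu> x q) * F (x, q) \<partial>lborel))"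
    proof (cases "x > 0")
      case True
      then have "(\<integral>\<^sup>+q. ennreal (coll_density \<mu> (x, q)) * F (x, q) \<partial>lborel)
         = (\<integral>\<^sup>+q. ennreal (sqrt x * eq_n \<mu> x) * (ennreal (coll_rate \<mu> x q) * F (x, q)) \<partial>lborel)"
        using eq_n_pos[OF True mu] coll_rate_nonneg[OF True mu]
        by (intro nn_integral_cong) (simp add: coll_density_def ennreal_mult mult.assoc)
      also have "\<dots> = ennreal (sqrt x * eq_n \<mu> x) * (\<integral>\<^sup>+q. ennreal (coll_rate \<mu> x q) * F (x, q) \<partial>lborel)"
        by (rule nn_integral_cmult) measurable
      finally show ?thesis using True eq_n_pos[OF True mu] by (simp add: ennreal_mult mult.assoc)
    qed (simp add: coll_density_def)
  qed
  also have "\<dots> = (\<integral>\<^sup>+x. ennreal (eq_n \<mu> x) * (\<integral>\<^sup>+q. ennreal (coll_rate \<mu> x q) * F (x, q) \<partial>lborel) \<partial>wmeasure)"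
    by (rule nn_integral_wmeasure[symmetric]) measurable
  finally show ?thesis .
qed

text \<open>For \<open>X = \<omega>\<close> this is the bound on the collision rate; the law of every other frequency is the same.\<close>

lemma nn_integral_frequency_le:
  assumes mu: "\<mu> \<ge> 0" and X: "collision_frequency \<mu> X" and [measurable]: "G \<in> borel_measurable borel"
  shows "(\<integral>\<^sup>+p. G (X p) \<partial>coll_measure \<mu>) \<le> 768 * (\<integral>\<^sup>+x. G x * ennreal ((eq_n \<mu> x)\<^sup>2) \<partial>wmeasure)"
proof -
  have [measurable]: "X \<in> borel_measurable borel" using X by (simp add: collision_frequency_def)
  have "(\<integral>\<^sup>+p. G (X p) \<partial>coll_measure \<mu>) = (\<integral>\<^sup>+x. G x \<partial>distr (coll_measure \<mu>) borel X)"
    by (subst nn_integral_distr) auto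
  also have "\<dots> = (\<integral>\<^sup>+x. G x \<partial>distr (coll_measure \<mu>) borel fst)" using X by (simp add: collision_frequency_def)
  also have "\<dots> = (\<integral>\<^sup>+p. G (fst p) \<partial>coll_measure \<mu>)" by (subst nn_integral_distr) auto
  also have "\<dots> = (\<integral>\<^sup>+x. ennreal (eq_n \<mu> x) * (\<integral>\<^sup>+q. ennreal (coll_rate \<mu> x q) * G x \<partial>lborel) \<partial>wmeasure)"
    by (subst nn_integral_coll_measure[OF mu]) auto
  also have "\<dots> \<le> (\<integral>\<^sup>+x. 768 * (G x * ennreal ((eq_n \<mu> x)\<^sup>2)) \<partial>wmeasure)"
  proof (rule nn_integral_mono_AE)
    have "AE x in wmeasure. x > 0" by (simp add: AE_wmeasure_iff)
    then show "AE x in wmeasure. ennreal (eq_n \<mu> x) * (\<integral>\<^sup>+q. ennreal (coll_rate \<mu> x q) * G x \<partial>lborel)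
        \<le> 768 * (G x * ennreal ((eq_n \<mu> x)\<^sup>2))"
    proof eventually_elim
      case (elim x)
      have "ennreal (eq_n \<mu> x) * (\<integral>\<^sup>+q. ennreal (coll_rate \<mu> x q) * G x \<partial>lborel)
        = ennreal (eq_n \<mu> x) * ((\<integral>\<^sup>+q. ennreal (coll_rate \<mu> x q) \<partial>lborel) * G x)"
        by (subst nn_integral_multc) auto
      also have "\<dots> \<le> ennreal (eq_n \<mu> x) * (ennreal (768 * eq_n \<mu> x) * G x)"
        by (intro mult_left_mono mult_right_mono nn_integral_coll_rate_le elim mu) auto
      also have "\<dots> = 768 * (G x * ennreal ((eq_n \<mu> x)\<^sup>2))"
        using eq_n_pos[OF elim mu] by (simp add: ennreal_mult power2_eq_square mult_ac)
      finally show ?case .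
    qed
  qed
  also have "\<dots> = 768 * (\<integral>\<^sup>+x. G x * ennreal ((eq_n \<mu> x)\<^sup>2) \<partial>wmeasure)" by (rule nn_integral_cmult) measurable
  finally show ?thesis .
qed

section \<open>Boundedness of averages over collisions\<close>

lemma quadratic_nonneg_imp_discriminant:
  fixes A B V :: real
  assumes A: "A \<ge> 0" and q: "\<And>t. B - 2 * t * V + t\<^sup>2 * A \<ge> 0"
  shows "V\<^sup>2 \<le> A * B"
proof (cases "A = 0")
  case True
  have "V = 0"
  proof (rule ccontr)
    assume "V \<noteq> 0"
    then show False using q[of "(B + 1) / (2 * V)"] True by (simp add: field_simps)
  qed
  then show ?thesis using True by simp
next
  case False
  then have "A > 0" using A by simp
  have "A * B - V\<^sup>2 = A * (B - 2 * (V / A) * V + (V / A)\<^sup>2 * A)"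
    using \<open>A > 0\<close> by (simp add: field_simps power2_eq_square)
  also have "\<dots> \<ge> 0" using q[of "V / A"] \<open>A > 0\<close> by (intro mult_nonneg_nonneg) auto
  finally show ?thesis by simp
qed

text \<open>Stated with the weight as a factor instead of a measure, in the form in which the collision rate appears. The
integral of \<open>k (h - t)\<^sup>2\<close> is a nonnegative quadratic polynomial in \<open>t\<close>.\<close>

lemma weighted_Cauchy_Schwarz:
  fixes k h :: "'a \<Rightarrow> real"
  assumes k: "integrable M k" and k0: "\<And>q. k q \<ge> 0" and kh2: "integrable M (\<lambda>q. k q * (h q)\<^sup>2)"
    and [measurable]: "h \<in> borel_measurable M"
  shows "integrable M (\<lambda>q. k q * h q)"
    "(LINT q|M. k q * h q)\<^sup>2 \<le> (LINT q|M. k q) * (LINT q|M. k q * (h q)\<^sup>2)"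
proof -
  have [measurable]: "k \<in> borel_measurable M" using k by simp
  have "integrable M (\<lambda>q. k q + k q * (h q)\<^sup>2)" using k kh2 by simp
  then show kh: "integrable M (\<lambda>q. k q * h q)"
  proof (rule Bochner_Integration.integrable_bound)
    have "norm (k q * h q) \<le> norm (k q + k q * (h q)\<^sup>2)" for q
    proof -
      have "\<bar>h q\<bar> \<le> 1 + (h q)\<^sup>2"
        using sum_squares_bound[of 1 "\<bar>h q\<bar>"] abs_ge_zero[of "h q"] by simp
      then have "k q * \<bar>h q\<bar> \<le> k q * (1 + (h q)\<^sup>2)" using k0 by (rule mult_left_mono)
      then show ?thesis using k0[of q] by (simp add: abs_mult distrib_left)
    qed
    then show "AE q in M. norm (k q * h q) \<le> norm (k q + k q * (h q)\<^sup>2)" by simp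
  qed measurable
  show "(LINT q|M. k q * h q)\<^sup>2 \<le> (LINT q|M. k q) * (LINT q|M. k q * (h q)\<^sup>2)"
  proof (rule quadratic_nonneg_imp_discriminant)
    show "(LINT q|M. k q) \<ge> 0" using k0 by simp
    fix t
    have "0 \<le> (LINT q|M. k q * (h q - t)\<^sup>2)" using k0 by (simp add: mult_nonneg_nonneg)
    also have "(LINT q|M. k q * (h q - t)\<^sup>2) = (LINT q|M. k q * (h q)\<^sup>2 - 2 * t * (k q * h q) + t\<^sup>2 * k q)"
      by (intro Bochner_Integration.integral_cong) (auto simp: power2_diff algebra_simps)
    also have "\<dots> = (LINT q|M. k q * (h q)\<^sup>2) - 2 * t * (LINT q|M. k q * h q) + t\<^sup>2 * (LINT q|M. k q)"
      using k kh kh2 by simp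
    finally show "(LINT q|M. k q * (h q)\<^sup>2) - 2 * t * (LINT q|M. k q * h q) + t\<^sup>2 * (LINT q|M. k q) \<ge> 0" .
  qed
qed

lemma integrable_coll_rate:
  assumes "x > 0" "\<mu> \<ge> 0"
  shows "integrable lborel (coll_rate \<mu> x)" "(LINT q|lborel. coll_rate \<mu> x q) \<le> 768 * eq_n \<mu> x"
proof -
  have fin: "(\<integral>\<^sup>+q. ennreal (coll_rate \<mu> x q) \<partial>lborel) \<le> ennreal (768 * eq_n \<mu> x)"
    by (rule nn_integral_coll_rate_le[OF assms])
  have "(\<integral>\<^sup>+q. ennreal (norm (coll_rate \<mu> x q)) \<partial>lborel) < \<infinity>"
    using fin coll_rate_nonneg[OF assms] by (simp add: le_less_trans)
  then show i: "integrable lborel (coll_rate \<mu> x)" by (intro integrableI_bounded) measurable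
  have "0 \<le> 768 * eq_n \<mu> x" using eq_n_pos[OF assms] by simp
  then show "(LINT q|lborel. coll_rate \<mu> x q) \<le> 768 * eq_n \<mu> x"
    using fin nn_integral_eq_integral[OF i] coll_rate_nonneg[OF assms] by (simp add: ennreal_le_iff)
qed

lemma vector_eq_if_inner_eq:
  fixes a b :: "'a::real_inner"
  assumes "\<And>v. inner a v = inner b v"
  shows "a = b"
proof -
  have "inner (a - b) (a - b) = 0" using assms[of "a - b"] by (simp add: inner_diff_left)
  then show ?thesis by simp
qed

text \<open>The integral over the collisions with given first frequency; all three formulas of the problem have this shape.\<close>

definition coll_average :: "real \<Rightarrow> (real \<times> real \<times> real \<Rightarrow> real) \<Rightarrow> real \<Rightarrow> real" where
  "coll_average \<mu> H x = (LINT q|lborel. coll_rate \<mu> x q * H (x, q))"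

lemma measurable_coll_average [measurable]:
  assumes [measurable]: "H \<in> borel_measurable borel"
  shows "coll_average \<mu> H \<in> borel_measurable borel"
proof -
  have "(\<lambda>(x, q). coll_rate \<mu> x q * H (x, q)) \<in> borel_measurable (borel \<Otimes>\<^sub>M lborel)"
    by measurable
  then show ?thesis unfolding coll_average_def
    by (rule lborel.borel_measurable_lebesgue_integral)
qed

text \<open>By Cauchy-Schwarz the square of the average is at most the total rate, hence at most \<open>768 n(x)\<close>, times the average
of the square; the factor \<open>n(x)\<close> is the one in the disintegration of the collision measure.\<close>

lemma coll_average_bound:
  assumes mu: "\<mu> \<ge> 0" and [measurable]: "H \<in> borel_measurable borel"
    and fin: "(\<integral>\<^sup>+p. ennreal ((H p)\<^sup>2) \<partial>coll_measure \<mu>) < \<infinity>"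
  shows "AE x in wmeasure. integrable lborel (\<lambda>q. coll_rate \<mu> x q * H (x, q))"
    "(\<integral>\<^sup>+x. ennreal ((coll_average \<mu> H x)\<^sup>2) \<partial>wmeasure) \<le> 768 * (\<integral>\<^sup>+p. ennreal ((H p)\<^sup>2) \<partial>coll_measure \<mu>)"
proof -
  define J where "J x = (\<integral>\<^sup>+q. ennreal (coll_rate \<mu> x q) * ennreal ((H (x, q))\<^sup>2) \<partial>lborel)" for x
  have [measurable]: "J \<in> borel_measurable borel" unfolding J_def by measurable
  have J: "(\<integral>\<^sup>+p. ennreal ((H p)\<^sup>2) \<partial>coll_measure \<mu>) = (\<integral>\<^sup>+x. ennreal (eq_n \<mu> x) * J x \<partial>wmeasure)"
    unfolding J_def by (rule nn_integral_coll_measure[OF mu]) measurable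
  have pos: "AE x in wmeasure. x > 0" by (simp add: AE_wmeasure_iff)
  have "AE x in wmeasure. ennreal (eq_n \<mu> x) * J x \<noteq> \<infinity>"
    using fin unfolding J by (intro nn_integral_PInf_AE) auto
  then have both: "AE x in wmeasure. integrable lborel (\<lambda>q. coll_rate \<mu> x q * H (x, q)) \<and>
     ennreal ((coll_average \<mu> H x)\<^sup>2) \<le> 768 * (ennreal (eq_n \<mu> x) * J x)"
    using pos
  proof eventually_elim
    case (elim x)
    note n = eq_n_pos[OF elim(2) mu] and r = coll_rate_nonneg[OF elim(2) mu]
    have Jx: "J x = (\<integral>\<^sup>+q. ennreal (coll_rate \<mu> x q * (H (x, q))\<^sup>2) \<partial>lborel)"
      unfolding J_def using r by (intro nn_integral_cong) (simp add: ennreal_mult)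
    have "J x \<noteq> \<infinity>" using elim(1) n by (auto simp: ennreal_mult_eq_top_iff)
    then have i: "integrable lborel (\<lambda>q. coll_rate \<mu> x q * (H (x, q))\<^sup>2)"
      using r unfolding Jx by (intro integrableI_bounded) (auto simp: top.not_eq_extremum)
    have Jr: "J x = ennreal (LINT q|lborel. coll_rate \<mu> x q * (H (x, q))\<^sup>2)"
      unfolding Jx using i r by (intro nn_integral_eq_integral) auto
    note CS = weighted_Cauchy_Schwarz[OF integrable_coll_rate(1)[OF elim(2) mu] r i]
    have 1: "integrable lborel (\<lambda>q. coll_rate \<mu> x q * H (x, q))" by (rule CS(1)) measurable
    have "(coll_average \<mu> H x)\<^sup>2 \<le> (LINT q|lborel. coll_rate \<mu> x q) * (LINT q|lborel. coll_rate \<mu> x q * (H (x, q))\<^sup>2)"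
      unfolding coll_average_def by (rule CS(2)) measurable
    also have "\<dots> \<le> (768 * eq_n \<mu> x) * (LINT q|lborel. coll_rate \<mu> x q * (H (x, q))\<^sup>2)"
      using integrable_coll_rate(2)[OF elim(2) mu] r by (intro mult_right_mono) auto
    finally have "ennreal ((coll_average \<mu> H x)\<^sup>2) \<le> ennreal ((768 * eq_n \<mu> x) * (LINT q|lborel. coll_rate \<mu> x q * (H (x, q))\<^sup>2))"
      by (rule ennreal_leI)
    also have "\<dots> = 768 * (ennreal (eq_n \<mu> x) * J x)"
      using n r by (simp add: Jr ennreal_mult mult.assoc)
    finally show ?case using 1 by simp
  qed
  then show "AE x in wmeasure. integrable lborel (\<lambda>q. coll_rate \<mu> x q * H (x, q))" by eventually_elim simp
  have "(\<integral>\<^sup>+x. ennreal ((coll_average \<mu> H x)\<^sup>2) \<partial>wmeasure) \<le> (\<integral>\<^sup>+x. 768 * (ennreal (eq_n \<mu> x) * J x) \<partial>wmeasure)"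
    using both by (intro nn_integral_mono_AE) (auto elim: eventually_mono)
  also have "\<dots> = 768 * (\<integral>\<^sup>+x. ennreal (eq_n \<mu> x) * J x \<partial>wmeasure)" by (rule nn_integral_cmult) measurable
  finally show "(\<integral>\<^sup>+x. ennreal ((coll_average \<mu> H x)\<^sup>2) \<partial>wmeasure) \<le> 768 * (\<integral>\<^sup>+p. ennreal ((H p)\<^sup>2) \<partial>coll_measure \<mu>)"
    by (simp add: J)
qed

lemma integrable_product_of_squares:
  fixes f g :: "'a \<Rightarrow> real"
  assumes [measurable]: "f \<in> borel_measurable M" "g \<in> borel_measurable M"
    and fin: "(\<integral>\<^sup>+p. ennreal ((f p)\<^sup>2) \<partial>M) < \<infinity>" "(\<integral>\<^sup>+p. ennreal ((g p)\<^sup>2) \<partial>M) < \<infinity>"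
  shows "integrable M (\<lambda>p. f p * g p)"
proof -
  have "integrable M (\<lambda>p. (f p)\<^sup>2)" "integrable M (\<lambda>p. (g p)\<^sup>2)"
    using fin by (auto intro!: integrableI_bounded)
  then have "integrable M (\<lambda>p. (f p)\<^sup>2 + (g p)\<^sup>2)" by simp
  then show ?thesis
  proof (rule Bochner_Integration.integrable_bound)
    have "norm (f p * g p) \<le> norm ((f p)\<^sup>2 + (g p)\<^sup>2)" for p
    proof -
      have "2 * \<bar>f p * g p\<bar> \<le> (f p)\<^sup>2 + (g p)\<^sup>2"
        using sum_squares_bound[of "\<bar>f p\<bar>" "\<bar>g p\<bar>"] by (simp add: abs_mult mult.assoc)
      then show ?thesis by simp
    qed
    then show "AE p in M. norm (f p * g p) \<le> norm ((f p)\<^sup>2 + (g p)\<^sup>2)" by simp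
  qed measurable
qed

text \<open>The quotient \<open>h = g / n\<close>, whose collision defect determines the operator.\<close>

definition profile :: "real \<Rightarrow> (real \<Rightarrow> real) \<Rightarrow> real \<Rightarrow> real" where
  "profile \<mu> g x = g x / eq_n \<mu> x"

lemma measurable_profile [measurable]:
  "g \<in> borel_measurable borel \<Longrightarrow> profile \<mu> g \<in> borel_measurable borel"
  unfolding profile_def by (intro borel_measurable_divide measurable_eq_n)

text \<open>The factor \<open>n\<^sup>2\<close> in the bound on the law of \<open>X\<close> cancels the denominator of the profile.\<close>

lemma nn_integral_profile_le:
  assumes mu: "\<mu> \<ge> 0" and X: "collision_frequency \<mu> X" and g: "square_integrable g"
  shows "(\<integral>\<^sup>+p. ennreal ((profile \<mu> g (X p))\<^sup>2) \<partial>coll_measure \<mu>) \<le> 768 * ennreal ((norm (L2_class g))\<^sup>2)"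
proof -
  note [measurable] = square_integrable_borel[OF g]
  have "(\<integral>\<^sup>+p. ennreal ((profile \<mu> g (X p))\<^sup>2) \<partial>coll_measure \<mu>)
      \<le> 768 * (\<integral>\<^sup>+x. ennreal ((profile \<mu> g x)\<^sup>2) * ennreal ((eq_n \<mu> x)\<^sup>2) \<partial>wmeasure)"
    by (rule nn_integral_frequency_le[OF mu X]) measurable
  also have "(\<integral>\<^sup>+x. ennreal ((profile \<mu> g x)\<^sup>2) * ennreal ((eq_n \<mu> x)\<^sup>2) \<partial>wmeasure) = (\<integral>\<^sup>+x. ennreal ((g x)\<^sup>2) \<partial>wmeasure)"
  proof (rule nn_integral_cong_AE)
    have "AE x in wmeasure. x > 0" by (simp add: AE_wmeasure_iff)
    then show "AE x in wmeasure. ennreal ((profile \<mu> g x)\<^sup>2) * ennreal ((eq_n \<mu> x)\<^sup>2) = ennreal ((g x)\<^sup>2)"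
    proof eventually_elim
      case (elim x)
      then show ?case using eq_n_pos[OF elim mu]
        by (simp add: profile_def ennreal_mult[symmetric] power_divide)
    qed
  qed
  also have "\<dots> = ennreal ((norm (L2_class g))\<^sup>2)" by (rule nn_integral_norm_L2_class[OF g])
  finally show ?thesis .
qed

lemma profile_square_finite:
  assumes "\<mu> \<ge> 0" "collision_frequency \<mu> X" "square_integrable g"
  shows "(\<integral>\<^sup>+p. ennreal ((profile \<mu> g (X p))\<^sup>2) \<partial>coll_measure \<mu>) < \<infinity>"
  using nn_integral_profile_le[OF assms]
  by (rule le_less_trans) (simp add: ennreal_mult_less_top)

text \<open>Null sets of frequencies are seen by collisions with probability zero, whichever of the four frequencies is
considered. This is what makes the operators independent of representatives.\<close>

lemma AE_collision_frequency:
  assumes mu: "\<mu> \<ge> 0" and X: "collision_frequency \<mu> X" and P: "AE x in wmeasure. P x"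
  shows "AE p in coll_measure \<mu>. P (X p)"
proof -
  have [measurable]: "X \<in> borel_measurable borel" using X by (simp add: collision_frequency_def)
  obtain N where N: "{x. \<not> P x} \<subseteq> N" "emeasure wmeasure N = 0" "N \<in> sets borel"
    using AE_E[OF P] by auto
  have "emeasure (coll_measure \<mu>) (X -` N) = (\<integral>\<^sup>+p. indicator N (X p) \<partial>coll_measure \<mu>)"
  proof -
    have "X -` N \<in> sets (coll_measure \<mu>)" using measurable_sets[of X borel borel N] N(3) by simp
    then have "emeasure (coll_measure \<mu>) (X -` N) = (\<integral>\<^sup>+p. indicator (X -` N) p \<partial>coll_measure \<mu>)" by simp
    also have "\<dots> = (\<integral>\<^sup>+p. indicator N (X p) \<partial>coll_measure \<mu>)"
      by (intro nn_integral_cong) (simp split: split_indicator)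
    finally show ?thesis .
  qed
  also have "\<dots> \<le> 768 * (\<integral>\<^sup>+x. indicator N x * ennreal ((eq_n \<mu> x)\<^sup>2) \<partial>wmeasure)"
    using N(3) by (intro nn_integral_frequency_le[OF mu X] borel_measurable_indicator)
  also have "(\<integral>\<^sup>+x. indicator N x * ennreal ((eq_n \<mu> x)\<^sup>2) \<partial>wmeasure) = 0"
  proof -
    have "AE x in wmeasure. x \<notin> N" using N by (intro AE_not_in) auto
    then have "(\<integral>\<^sup>+x. indicator N x * ennreal ((eq_n \<mu> x)\<^sup>2) \<partial>wmeasure) = (\<integral>\<^sup>+x. 0 \<partial>wmeasure)"
      by (intro nn_integral_cong_AE) (auto elim: eventually_mono)
    then show ?thesis by simp
  qed
  finally have "emeasure (coll_measure \<mu>) (X -` N) = 0" by simp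
  then show ?thesis using N measurable_sets[of X borel borel N]
    by (intro AE_I[of _ _ "X -` N"]) auto
qed

text \<open>Averaging is the adjoint of evaluating a profile at the first frequency; this is Fubini's theorem for the collision
measure.\<close>

lemma coll_average_inner:
  assumes mu: "\<mu> \<ge> 0" and [measurable]: "H \<in> borel_measurable borel"
    and fin: "(\<integral>\<^sup>+p. ennreal ((H p)\<^sup>2) \<partial>coll_measure \<mu>) < \<infinity>" and g: "square_integrable g"
  shows "integrable (coll_measure \<mu>) (\<lambda>p. H p * profile \<mu> g (fst p))"
    "(LINT p|coll_measure \<mu>. H p * profile \<mu> g (fst p)) = (LINT x|wmeasure. coll_average \<mu> H x * g x)"
proof -
  note [measurable] = square_integrable_borel[OF g]
  show i: "integrable (coll_measure \<mu>) (\<lambda>p. H p * profile \<mu> g (fst p))"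
    using fin profile_square_finite[OF mu collision_frequencies(1) g]
    by (intro integrable_product_of_squares) auto
  define F where "F p = coll_density \<mu> p * (H p * profile \<mu> g (fst p))" for p
  have [measurable]: "F \<in> borel_measurable borel" unfolding F_def by measurable
  have iF: "integrable lborel F"
    using i unfolding coll_measure_def F_def
    by (subst (asm) integrable_density) (auto simp: coll_density_nonneg[OF mu])
  have "(LINT p|coll_measure \<mu>. H p * profile \<mu> g (fst p)) = (LINT p|lborel. F p)"
    unfolding coll_measure_def F_def by (subst integral_density) (auto simp: coll_density_nonneg[OF mu])
  also have "\<dots> = (LINT x|lborel. LINT q|lborel. F (x, q))"
    unfolding lborel_prod[where 'a=real and 'b="real \<times> real", symmetric]
    by (rule lborel_pair.integral_fst'[symmetric]) (use iF in \<open>simp add: lborel_prod\<close>)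
  also have "\<dots> = (LINT x|lborel. (indicator {0<..} x * sqrt x) * (coll_average \<mu> H x * g x))"
  proof (rule Bochner_Integration.integral_cong)
    fix x
    show "(LINT q|lborel. F (x, q)) = (indicator {0<..} x * sqrt x) * (coll_average \<mu> H x * g x)"
    proof (cases "x > 0")
      case True
      have "(LINT q|lborel. F (x, q)) = (LINT q|lborel. (sqrt x * g x) * (coll_rate \<mu> x q * H (x, q)))"
        using True eq_n_pos[OF True mu]
        by (intro Bochner_Integration.integral_cong) (auto simp: F_def coll_density_def profile_def)
      also have "\<dots> = (sqrt x * g x) * coll_average \<mu> H x" unfolding coll_average_def by simp
      finally show ?thesis using True by simp
    qed (simp add: F_def coll_density_def)
  qed simp
  also have "\<dots> = (LINT x|wmeasure. coll_average \<mu> H x * g x)"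
    unfolding wmeasure_def by (subst integral_density) (auto simp: indicator_def)
  finally show "(LINT p|coll_measure \<mu>. H p * profile \<mu> g (fst p)) = (LINT x|wmeasure. coll_average \<mu> H x * g x)" .
qed

text \<open>One of the four terms of the operator, selected by the frequency \<open>X\<close>.\<close>

definition freq_fun :: "real \<Rightarrow> (real \<times> real \<times> real \<Rightarrow> real) \<Rightarrow> (real \<Rightarrow> real) \<Rightarrow> real \<Rightarrow> real" where
  "freq_fun \<mu> X g = coll_average \<mu> (\<lambda>p. profile \<mu> g (X p))"

definition freq_op :: "real \<Rightarrow> (real \<times> real \<times> real \<Rightarrow> real) \<Rightarrow> wL2 \<Rightarrow> wL2" where
  "freq_op \<mu> X f = L2_class (freq_fun \<mu> X (rep_wL2 f))"

lemma measurable_profile_frequency: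
  assumes X: "collision_frequency \<mu> X" and g: "square_integrable g"
  shows "(\<lambda>p. profile \<mu> g (X p)) \<in> borel_measurable borel"
proof -
  have "X \<in> borel_measurable borel" using X by (simp add: collision_frequency_def)
  from measurable_compose[OF this measurable_profile[OF square_integrable_borel[OF g]]] show ?thesis .
qed

context
  fixes \<mu> :: real and X :: "real \<times> real \<times> real \<Rightarrow> real"
  assumes mu: "\<mu> \<ge> 0" and X: "collision_frequency \<mu> X"
begin

lemma freq_fun_AE_integrable:
  assumes "square_integrable g"
  shows "AE x in wmeasure. integrable lborel (\<lambda>q. coll_rate \<mu> x q * profile \<mu> g (X (x, q)))"
  using coll_average_bound(1)[OF mu measurable_profile_frequency[OF X assms] profile_square_finite[OF mu X assms]] .

lemma freq_fun_bound:
  assumes g: "square_integrable g"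
  shows "square_integrable (freq_fun \<mu> X g)" "norm (L2_class (freq_fun \<mu> X g)) \<le> 768 * norm (L2_class g)"
proof -
  have "(\<integral>\<^sup>+x. ennreal ((freq_fun \<mu> X g x)\<^sup>2) \<partial>wmeasure) \<le> 768 * (\<integral>\<^sup>+p. ennreal ((profile \<mu> g (X p))\<^sup>2) \<partial>coll_measure \<mu>)"
    unfolding freq_fun_def
    by (rule coll_average_bound(2)[OF mu measurable_profile_frequency[OF X g] profile_square_finite[OF mu X g]])
  also have "\<dots> \<le> 768 * (768 * ennreal ((norm (L2_class g))\<^sup>2))"
    by (intro mult_left_mono nn_integral_profile_le[OF mu X g]) auto
  also have "\<dots> = ennreal ((768 * norm (L2_class g))\<^sup>2)"
    by (simp add: power_mult_distrib ennreal_mult power2_eq_square mult_ac)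
  finally have le: "(\<integral>\<^sup>+x. ennreal ((freq_fun \<mu> X g x)\<^sup>2) \<partial>wmeasure) \<le> ennreal ((768 * norm (L2_class g))\<^sup>2)" .
  have m: "freq_fun \<mu> X g \<in> borel_measurable borel"
    unfolding freq_fun_def by (rule measurable_coll_average[OF measurable_profile_frequency[OF X g]])
  show "square_integrable (freq_fun \<mu> X g)" "norm (L2_class (freq_fun \<mu> X g)) \<le> 768 * norm (L2_class g)"
    using norm_L2_class_le[OF m le] by simp_all
qed

lemma freq_fun_inner:
  assumes g: "square_integrable g" and f: "square_integrable f"
  shows "integrable (coll_measure \<mu>) (\<lambda>p. profile \<mu> g (X p) * profile \<mu> f (fst p))"
    "inner (L2_class (freq_fun \<mu> X g)) (L2_class f) = (LINT p|coll_measure \<mu>. profile \<mu> g (X p) * profile \<mu> f (fst p))"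
  using coll_average_inner[OF mu measurable_profile_frequency[OF X g] profile_square_finite[OF mu X g] f]
    L2_class_arith(6)[OF freq_fun_bound(1)[OF g] f]
  by (simp_all add: freq_fun_def)

lemma inner_freq_op:
  "inner (freq_op \<mu> X f) g = (LINT p|coll_measure \<mu>. profile \<mu> (rep_wL2 f) (X p) * profile \<mu> (rep_wL2 g) (fst p))"
  using freq_fun_inner(2)[of "rep_wL2 f" "rep_wL2 g"] by (simp add: freq_op_def)

lemma profile_cong_AE:
  assumes "AE x in wmeasure. f x = g x"
  shows "AE p in coll_measure \<mu>. profile \<mu> f (X p) = profile \<mu> g (X p)"
  using AE_collision_frequency[OF mu X assms] by eventually_elim (simp add: profile_def)

text \<open>Equality is tested against all vectors, where it becomes an equality of integrals over collisions and the
representatives may be exchanged almost everywhere.\<close>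

lemma freq_op_L2_class:
  assumes g: "square_integrable g"
  shows "freq_op \<mu> X (L2_class g) = L2_class (freq_fun \<mu> X g)"
proof -
  have ae: "AE p in coll_measure \<mu>. profile \<mu> (rep_wL2 (L2_class g)) (X p) = profile \<mu> g (X p)"
    by (rule profile_cong_AE[OF AE_rep_L2_class[OF g]])
  have eq: "inner (freq_op \<mu> X (L2_class g)) v = inner (L2_class (freq_fun \<mu> X g)) v" for v
  proof -
    note [measurable] = measurable_profile_frequency[OF X g] measurable_profile_frequency[OF X square_integrable_rep, of "L2_class g"]
      square_integrable_borel[OF square_integrable_rep, of v]
    have "inner (L2_class (freq_fun \<mu> X g)) v = inner (L2_class (freq_fun \<mu> X g)) (L2_class (rep_wL2 v))" by simp
    also have "\<dots> = (LINT p|coll_measure \<mu>. profile \<mu> g (X p) * profile \<mu> (rep_wL2 v) (fst p))"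
      by (rule freq_fun_inner(2)[OF g]) simp
    also have "\<dots> = inner (freq_op \<mu> X (L2_class g)) v"
      unfolding inner_freq_op using ae
      by (intro integral_cong_AE) (auto elim!: eventually_mono)
    finally show ?thesis by simp
  qed
  then show ?thesis by (rule vector_eq_if_inner_eq)
qed

lemma profile_add: "profile \<mu> (\<lambda>x. f x + g x) y = profile \<mu> f y + profile \<mu> g y"
  and profile_scale: "profile \<mu> (\<lambda>x. c * f x) y = c * profile \<mu> f y"
  by (simp_all add: profile_def add_divide_distrib)

text \<open>Linearity also is verified after pairing with a vector, since the averages themselves are integrals that exist only
for almost every frequency. The bound \<open>768\<close> is the product of two factors \<open>sqrt 768\<close>, from averaging and from
the law of \<open>X\<close>.\<close>

lemma bounded_linear_freq_op: "bounded_linear (freq_op \<mu> X)"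
proof (rule bounded_linear_intro)
  fix f g and c
  let ?f = "rep_wL2 f" and ?g = "rep_wL2 g"
  note i = freq_fun_inner(1)[OF square_integrable_rep square_integrable_rep]
  have add: "f + g = L2_class (\<lambda>x. ?f x + ?g x)" using L2_class_arith(1)[of ?f ?g] by simp
  have sc: "c *\<^sub>R f = L2_class (\<lambda>x. c * ?f x)" using L2_class_arith(4)[of ?f ?f c] by simp
  have "inner (freq_op \<mu> X (f + g)) v = inner (freq_op \<mu> X f + freq_op \<mu> X g) v" for v
  proof -
    have "inner (freq_op \<mu> X (f + g)) v = inner (L2_class (freq_fun \<mu> X (\<lambda>x. ?f x + ?g x))) (L2_class (rep_wL2 v))"
      unfolding add by (subst freq_op_L2_class) (auto intro: square_integrable_add)
    also have "\<dots> = (LINT p|coll_measure \<mu>. profile \<mu> ?f (X p) * profile \<mu> (rep_wL2 v) (fst p) + profile \<mu> ?g (X p) * profile \<mu> (rep_wL2 v) (fst p))"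
      by (subst freq_fun_inner(2)) (auto intro: square_integrable_add simp: profile_add distrib_right)
    also have "\<dots> = inner (freq_op \<mu> X f + freq_op \<mu> X g) v"
      by (simp add: inner_add_left inner_freq_op i)
    finally show ?thesis .
  qed
  then show "freq_op \<mu> X (f + g) = freq_op \<mu> X f + freq_op \<mu> X g"
    by (rule vector_eq_if_inner_eq)
  have "inner (freq_op \<mu> X (c *\<^sub>R f)) v = inner (c *\<^sub>R freq_op \<mu> X f) v" for v
  proof -
    have "inner (freq_op \<mu> X (c *\<^sub>R f)) v = inner (L2_class (freq_fun \<mu> X (\<lambda>x. c * ?f x))) (L2_class (rep_wL2 v))"
      unfolding sc by (subst freq_op_L2_class) (auto intro: square_integrable_scale)
    also have "\<dots> = (LINT p|coll_measure \<mu>. c * (profile \<mu> ?f (X p) * profile \<mu> (rep_wL2 v) (fst p)))"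
      by (subst freq_fun_inner(2)) (auto intro: square_integrable_scale simp: profile_scale mult.assoc)
    also have "\<dots> = inner (c *\<^sub>R freq_op \<mu> X f) v" by (simp add: inner_freq_op)
    finally show ?thesis .
  qed
  then show "freq_op \<mu> X (c *\<^sub>R f) = c *\<^sub>R freq_op \<mu> X f"
    by (rule vector_eq_if_inner_eq)
  show "norm (freq_op \<mu> X f) \<le> norm f * 768"
    using freq_fun_bound(2)[of ?f] by (simp add: freq_op_def mult.commute)
qed

end

section \<open>The linearised operator and its quadratic form\<close>

definition gain :: "real \<Rightarrow> (real \<Rightarrow> real) \<Rightarrow> real \<times> real \<times> real \<Rightarrow> real" where
  "gain \<mu> g p = - profile \<mu> g (freq3 p) + profile \<mu> g (fst (snd p)) + profile \<mu> g (snd (snd p))"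

text \<open>Vanishes for all collisions when the profile is an affine function of the frequency.\<close>

definition defect :: "real \<Rightarrow> (real \<Rightarrow> real) \<Rightarrow> real \<times> real \<times> real \<Rightarrow> real" where
  "defect \<mu> g p = profile \<mu> g (fst p) + profile \<mu> g (freq3 p) - profile \<mu> g (fst (snd p)) - profile \<mu> g (snd (snd p))"

lemma A_formula_eq: "A_formula \<mu> g x = freq_fun \<mu> fst g x"
  by (simp add: A_formula_def a_mult_def freq_fun_def coll_average_def set_lebesgue_integral_def
      coll_rate_def profile_def split_beta')

lemma K_formula_eq: "K_formula \<mu> g x = coll_average \<mu> (gain \<mu> g) x"
  unfolding K_formula_def coll_average_def set_lebesgue_integral_def
  by (intro Bochner_Integration.integral_cong)
    (auto simp: coll_rate_def gain_def profile_def freq3_def Let_def split_beta')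

lemma L_formula_eq: "L_formula \<mu> g x = coll_average \<mu> (\<lambda>p. - profile \<mu> g (fst p) + gain \<mu> g p) x"
  unfolding L_formula_def coll_average_def set_lebesgue_integral_def
  by (intro Bochner_Integration.integral_cong)
    (auto simp: coll_rate_def gain_def profile_def freq3_def Let_def split_beta')

text \<open>Bounded operators on the whole space, written as combinations of the four terms; \<open>operators_eq_bounded\<close> identifies
them with the extensions of the formulas.\<close>

definition A_bdd :: "real \<Rightarrow> wL2 \<Rightarrow> wL2" where
  "A_bdd \<mu> = freq_op \<mu> fst"

definition K_bdd :: "real \<Rightarrow> wL2 \<Rightarrow> wL2" where
  "K_bdd \<mu> f = - freq_op \<mu> freq3 f + freq_op \<mu> (\<lambda>p. fst (snd p)) f + freq_op \<mu> (\<lambda>p. snd (snd p)) f"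

lemma measurable_gain: "square_integrable g \<Longrightarrow> gain \<mu> g \<in> borel_measurable borel"
  and measurable_defect: "square_integrable g \<Longrightarrow> defect \<mu> g \<in> borel_measurable borel"
proof -
  assume g: "square_integrable g"
  note [measurable] = measurable_profile_frequency[OF collision_frequencies(1) g, of \<mu>]
    measurable_profile_frequency[OF collision_frequencies(2) g, of \<mu>]
    measurable_profile_frequency[OF collision_frequencies(3) g, of \<mu>]
    measurable_profile_frequency[OF collision_frequencies(4) g, of \<mu>]
  show "gain \<mu> g \<in> borel_measurable borel" "defect \<mu> g \<in> borel_measurable borel"
    unfolding gain_def[abs_def] defect_def[abs_def] by measurable
qed

lemma coll_average_add:
  assumes "integrable lborel (\<lambda>q. coll_rate \<mu> x q * F (x, q))" "integrable lborel (\<lambda>q. coll_rate \<mu> x q * G (x, q))"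
  shows "coll_average \<mu> (\<lambda>p. F p + G p) x = coll_average \<mu> F x + coll_average \<mu> G x"
  using assms by (simp add: coll_average_def distrib_left)

lemma coll_average_uminus: "coll_average \<mu> (\<lambda>p. - F p) x = - coll_average \<mu> F x"
  by (simp add: coll_average_def)

text \<open>The integral of the combination splits only where the four separate integrals exist, that is almost everywhere.\<close>

lemma gain_average_AE:
  assumes mu: "\<mu> \<ge> 0" and g: "square_integrable g"
  shows "AE x in wmeasure. coll_average \<mu> (gain \<mu> g) x
      = - freq_fun \<mu> freq3 g x + freq_fun \<mu> (\<lambda>p. fst (snd p)) g x + freq_fun \<mu> (\<lambda>p. snd (snd p)) g x
    \<and> coll_average \<mu> (\<lambda>p. - profile \<mu> g (fst p) + gain \<mu> g p) x = - freq_fun \<mu> fst g x + coll_average \<mu> (gain \<mu> g) x"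
  using freq_fun_AE_integrable[OF mu collision_frequencies(1) g] freq_fun_AE_integrable[OF mu collision_frequencies(2) g]
    freq_fun_AE_integrable[OF mu collision_frequencies(3) g] freq_fun_AE_integrable[OF mu collision_frequencies(4) g]
proof eventually_elim
  case (elim x)
  let ?h = "\<lambda>X p. profile \<mu> g (X p)"
  have 3: "integrable lborel (\<lambda>q. coll_rate \<mu> x q * - ?h freq3 (x, q))" using elim(4) by simp
  have 31: "integrable lborel (\<lambda>q. coll_rate \<mu> x q * (- ?h freq3 (x, q) + ?h (\<lambda>p. fst (snd p)) (x, q)))"
    unfolding distrib_left by (rule Bochner_Integration.integrable_add[OF 3 elim(2)])
  have gain: "integrable lborel (\<lambda>q. coll_rate \<mu> x q * gain \<mu> g (x, q))"
    unfolding gain_def distrib_left[of _ "_ + _"] by (rule Bochner_Integration.integrable_add[OF 31 elim(3)])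
  have 0: "integrable lborel (\<lambda>q. coll_rate \<mu> x q * - ?h fst (x, q))" using elim(1) by simp
  have "coll_average \<mu> (gain \<mu> g) x = coll_average \<mu> (\<lambda>p. - ?h freq3 p + ?h (\<lambda>p. fst (snd p)) p) x
      + coll_average \<mu> (?h (\<lambda>p. snd (snd p))) x"
    unfolding gain_def using coll_average_add[OF 31 elim(3)] by simp
  also have "coll_average \<mu> (\<lambda>p. - ?h freq3 p + ?h (\<lambda>p. fst (snd p)) p) x
      = coll_average \<mu> (\<lambda>p. - ?h freq3 p) x + coll_average \<mu> (?h (\<lambda>p. fst (snd p))) x"
    using coll_average_add[OF 3 elim(2)] by simp
  finally have 1: "coll_average \<mu> (gain \<mu> g) x
      = - freq_fun \<mu> freq3 g x + freq_fun \<mu> (\<lambda>p. fst (snd p)) g x + freq_fun \<mu> (\<lambda>p. snd (snd p)) g x"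
    by (simp add: coll_average_uminus freq_fun_def)
  have "coll_average \<mu> (\<lambda>p. - profile \<mu> g (fst p) + gain \<mu> g p) x = coll_average \<mu> (\<lambda>p. - ?h fst p) x + coll_average \<mu> (gain \<mu> g) x"
    using coll_average_add[OF 0 gain] by simp
  then show ?case using 1 by (simp add: coll_average_uminus freq_fun_def)
qed

lemma square_integrable_cong_AE:
  assumes "square_integrable f" "g \<in> borel_measurable borel" "AE x in wmeasure. g x = f x"
  shows "square_integrable g"
proof -
  have "(\<integral>\<^sup>+x. ennreal ((g x)\<^sup>2) \<partial>wmeasure) = (\<integral>\<^sup>+x. ennreal ((f x)\<^sup>2) \<partial>wmeasure)"
    using assms(3) by (intro nn_integral_cong_AE) (auto elim: eventually_mono)
  then show ?thesis using assms by (simp add: square_integrable_iff_nn_integral)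
qed

text \<open>The formulas represent the bounded operators on all square integrable functions, not only on test functions.\<close>

lemma L2_class_formulas:
  assumes mu: "\<mu> \<ge> 0" and g: "square_integrable g"
  shows "square_integrable (K_formula \<mu> g)" "K_bdd \<mu> (L2_class g) = L2_class (K_formula \<mu> g)"
    "square_integrable (L_formula \<mu> g)" "- A_bdd \<mu> (L2_class g) + K_bdd \<mu> (L2_class g) = L2_class (L_formula \<mu> g)"
    "square_integrable (A_formula \<mu> g)" "A_bdd \<mu> (L2_class g) = L2_class (A_formula \<mu> g)"
proof -
  note fr = collision_frequencies
  note si = freq_fun_bound(1)[OF mu fr(1) g] freq_fun_bound(1)[OF mu fr(2) g]
    freq_fun_bound(1)[OF mu fr(3) g] freq_fun_bound(1)[OF mu fr(4) g]
  note op = freq_op_L2_class[OF mu fr(1) g] freq_op_L2_class[OF mu fr(2) g]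
    freq_op_L2_class[OF mu fr(3) g] freq_op_L2_class[OF mu fr(4) g]
  have A: "A_formula \<mu> g = freq_fun \<mu> fst g" by (simp add: A_formula_eq fun_eq_iff)
  show "square_integrable (A_formula \<mu> g)" "A_bdd \<mu> (L2_class g) = L2_class (A_formula \<mu> g)"
    using si(1) op(1) by (simp_all add: A A_bdd_def)
  let ?K = "\<lambda>x. - freq_fun \<mu> freq3 g x + freq_fun \<mu> (\<lambda>p. fst (snd p)) g x + freq_fun \<mu> (\<lambda>p. snd (snd p)) g x"
  have 1: "square_integrable (\<lambda>x. - freq_fun \<mu> freq3 g x)" by (rule square_integrable_uminus[OF si(4)])
  have 2: "square_integrable (\<lambda>x. - freq_fun \<mu> freq3 g x + freq_fun \<mu> (\<lambda>p. fst (snd p)) g x)"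
    by (rule square_integrable_add[OF 1 si(2)])
  have sK: "square_integrable ?K" by (rule square_integrable_add[OF 2 si(3)])
  have cK: "K_bdd \<mu> (L2_class g) = L2_class ?K"
    unfolding K_bdd_def op
    by (simp only: L2_class_arith(3)[OF si(4) si(4)] L2_class_arith(1)[OF 1 si(2)] L2_class_arith(1)[OF 2 si(3)])
  have mK: "K_formula \<mu> g \<in> borel_measurable borel"
    using measurable_coll_average[OF measurable_gain[OF g]] by (simp add: K_formula_eq[abs_def])
  have aeK: "AE x in wmeasure. K_formula \<mu> g x = ?K x"
    using gain_average_AE[OF mu g] by eventually_elim (simp add: K_formula_eq)
  show K: "square_integrable (K_formula \<mu> g)" by (rule square_integrable_cong_AE[OF sK mK aeK])
  show K': "K_bdd \<mu> (L2_class g) = L2_class (K_formula \<mu> g)"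
    unfolding cK using aeK by (intro L2_class_eqI sK K) (auto elim: eventually_mono)
  have sL: "square_integrable (\<lambda>x. - freq_fun \<mu> fst g x + K_formula \<mu> g x)"
    by (rule square_integrable_add[OF square_integrable_uminus[OF si(1)] K])
  have mL: "L_formula \<mu> g \<in> borel_measurable borel"
    using measurable_coll_average[OF borel_measurable_add[OF borel_measurable_uminus[OF measurable_profile_frequency[OF fr(1) g]] measurable_gain[OF g]]]
    unfolding L_formula_eq[abs_def] by simp
  have aeL: "AE x in wmeasure. L_formula \<mu> g x = - freq_fun \<mu> fst g x + K_formula \<mu> g x"
    using gain_average_AE[OF mu g] by eventually_elim (simp add: K_formula_eq L_formula_eq)
  show L: "square_integrable (L_formula \<mu> g)" by (rule square_integrable_cong_AE[OF sL mL aeL])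
  have "- A_bdd \<mu> (L2_class g) + K_bdd \<mu> (L2_class g) = L2_class (\<lambda>x. - freq_fun \<mu> fst g x + K_formula \<mu> g x)"
    unfolding A_bdd_def op K'
    by (simp only: L2_class_arith(3)[OF si(1) si(1)] L2_class_arith(1)[OF square_integrable_uminus[OF si(1)] K])
  also have "\<dots> = L2_class (L_formula \<mu> g)"
    using aeL by (intro L2_class_eqI sL L) (auto elim: eventually_mono)
  finally show "- A_bdd \<mu> (L2_class g) + K_bdd \<mu> (L2_class g) = L2_class (L_formula \<mu> g)" .
qed

lemma bounded_linear_A_K:
  assumes mu: "\<mu> \<ge> 0"
  shows "bounded_linear (A_bdd \<mu>)" "bounded_linear (K_bdd \<mu>)" "bounded_linear (\<lambda>f. - A_bdd \<mu> f + K_bdd \<mu> f)"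
proof -
  note bl = bounded_linear_freq_op[OF mu collision_frequencies(1)] bounded_linear_freq_op[OF mu collision_frequencies(2)]
    bounded_linear_freq_op[OF mu collision_frequencies(3)] bounded_linear_freq_op[OF mu collision_frequencies(4)]
  show A: "bounded_linear (A_bdd \<mu>)" unfolding A_bdd_def by (rule bl)
  show K: "bounded_linear (K_bdd \<mu>)" unfolding K_bdd_def
    by (intro bounded_linear_add bounded_linear_minus bl)
  show "bounded_linear (\<lambda>f. - A_bdd \<mu> f + K_bdd \<mu> f)"
    by (intro bounded_linear_add bounded_linear_minus A K)
qed

lemma extends_formulas:
  assumes mu: "\<mu> \<ge> 0"
  shows "extends_formula (A_formula \<mu>) (A_bdd \<mu>)" "extends_formula (K_formula \<mu>) (K_bdd \<mu>)"
    "extends_formula (L_formula \<mu>) (\<lambda>f. - A_bdd \<mu> f + K_bdd \<mu> f)"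
  unfolding extends_formula_def
  using bounded_linear_A_K[OF mu] L2_class_formulas[OF mu square_integrable_test_function] by auto

lemma operators_eq_bounded:
  assumes mu: "\<mu> \<ge> 0"
  shows "A_op \<mu> = A_bdd \<mu>" "K_op \<mu> = K_bdd \<mu>" "L_op \<mu> = (\<lambda>f. - A_bdd \<mu> f + K_bdd \<mu> f)"
  unfolding A_op_def K_op_def L_op_def by (intro extension_eqI extends_formulas mu)+

lemma integral_coll_measure_invariant:
  fixes F :: "_ \<Rightarrow> real"
  assumes [measurable]: "S \<in> borel \<rightarrow>\<^sub>M borel" "F \<in> borel_measurable borel"
    and S: "distr (coll_measure \<mu>) borel S = coll_measure \<mu>"
  shows "(LINT p|coll_measure \<mu>. F (S p)) = (LINT p|coll_measure \<mu>. F p)"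
proof -
  have "(LINT p|coll_measure \<mu>. F p) = (LINT p|distr (coll_measure \<mu>) borel S. F p)" by (simp add: S)
  also have "\<dots> = (LINT p|coll_measure \<mu>. F (S p))" by (subst integral_distr) auto
  finally show ?thesis by simp
qed

lemma profile_products_integrable:
  assumes mu: "\<mu> \<ge> 0" and X: "collision_frequency \<mu> X" and Y: "collision_frequency \<mu> Y"
    and f: "square_integrable f" and g: "square_integrable g"
  shows "integrable (coll_measure \<mu>) (\<lambda>p. profile \<mu> f (X p) * profile \<mu> g (Y p))"
  using profile_square_finite[OF mu X f] profile_square_finite[OF mu Y g]
    measurable_profile_frequency[OF X f] measurable_profile_frequency[OF Y g]
  by (intro integrable_product_of_squares) auto

lemma defect_products_integrable:
  assumes mu: "\<mu> \<ge> 0" and Y: "collision_frequency \<mu> Y"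
    and f: "square_integrable f" and g: "square_integrable g"
  shows "integrable (coll_measure \<mu>) (\<lambda>p. defect \<mu> f p * profile \<mu> g (Y p))"
  unfolding defect_def left_diff_distrib distrib_right
  by (intro Bochner_Integration.integrable_add Bochner_Integration.integrable_diff
      profile_products_integrable[OF mu _ Y f g] collision_frequencies)

lemma inner_L_op_defect:
  assumes mu: "\<mu> \<ge> 0"
  shows "inner (L_op \<mu> f) g = - (LINT p|coll_measure \<mu>. defect \<mu> (rep_wL2 f) p * profile \<mu> (rep_wL2 g) (fst p))"
proof -
  note i = profile_products_integrable[OF mu _ collision_frequencies(1) square_integrable_rep square_integrable_rep, of _ f g]
  have "inner (L_op \<mu> f) g = - (LINT p|coll_measure \<mu>. profile \<mu> (rep_wL2 f) (fst p) * profile \<mu> (rep_wL2 g) (fst p))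
     + (- (LINT p|coll_measure \<mu>. profile \<mu> (rep_wL2 f) (freq3 p) * profile \<mu> (rep_wL2 g) (fst p))
     + (LINT p|coll_measure \<mu>. profile \<mu> (rep_wL2 f) (fst (snd p)) * profile \<mu> (rep_wL2 g) (fst p))
     + (LINT p|coll_measure \<mu>. profile \<mu> (rep_wL2 f) (snd (snd p)) * profile \<mu> (rep_wL2 g) (fst p)))"
    unfolding operators_eq_bounded[OF mu] A_bdd_def K_bdd_def inner_add_left inner_minus_left
    by (simp only: inner_freq_op[OF mu collision_frequencies(1)] inner_freq_op[OF mu collision_frequencies(2)]
        inner_freq_op[OF mu collision_frequencies(3)] inner_freq_op[OF mu collision_frequencies(4)])
  also have "\<dots> = - (LINT p|coll_measure \<mu>. defect \<mu> (rep_wL2 f) p * profile \<mu> (rep_wL2 g) (fst p))"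
    unfolding defect_def left_diff_distrib distrib_right
    using i[OF collision_frequencies(1)] i[OF collision_frequencies(2)] i[OF collision_frequencies(3)] i[OF collision_frequencies(4)]
    by simp
  finally show ?thesis .
qed

lemma defect_symmetries:
  "defect \<mu> g (fst p, snd (snd p), fst (snd p)) = defect \<mu> g p"
  "defect \<mu> g (freq3 p, snd p) = defect \<mu> g p"
  "defect \<mu> g (fst (snd p), fst p, freq3 p) = - defect \<mu> g p"
  by (simp_all add: defect_def freq3_def add.commute)

text \<open>By the symmetries of the collision measure, the test profile at \<open>\<omega>\<close> may be replaced by the one at \<open>\<omega>\<^sub>3\<close>,
or, with opposite sign, by the one at \<open>\<omega>\<^sub>1\<close> or \<open>\<omega>\<^sub>2\<close>. The average over the four choices is the symmetric form.\<close>

lemma L_op_form: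
  assumes mu: "\<mu> \<ge> 0"
  shows "inner (L_op \<mu> f) g = - (1/4) * (LINT p|coll_measure \<mu>. defect \<mu> (rep_wL2 f) p * defect \<mu> (rep_wL2 g) p)"
proof -
  define h where "h = profile \<mu> (rep_wL2 g)"
  define d where "d = defect \<mu> (rep_wL2 f)"
  note [measurable] = measurable_defect[OF square_integrable_rep, of \<mu> f, folded d_def]
    measurable_profile[OF square_integrable_borel[OF square_integrable_rep], of \<mu> g, folded h_def]
  let ?I = "\<lambda>X. (LINT p|coll_measure \<mu>. d p * h (X p))"
  have m0: "(\<lambda>p. d p * h (fst p)) \<in> borel_measurable borel" by measurable
  have m1: "(\<lambda>p. d p * h (fst (snd p))) \<in> borel_measurable borel" by measurable
  (* The next three equations move the test profile from the first frequency to the others; the reversal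
     of the collision changes the sign. *)
  note ds = defect_symmetries[of \<mu> "rep_wL2 f", folded d_def]
  have 3: "?I freq3 = ?I fst"
    using integral_coll_measure_invariant[OF _ m0 coll_measure_invariant(2)[of \<mu>]] by (simp add: ds)
  have 1: "?I (\<lambda>p. fst (snd p)) = - ?I fst"
    using integral_coll_measure_invariant[OF _ m0 coll_measure_invariant(3)[of \<mu>]] by (simp add: ds)
  have 2: "?I (\<lambda>p. snd (snd p)) = ?I (\<lambda>p. fst (snd p))"
    using integral_coll_measure_invariant[OF _ m1 coll_measure_invariant(1)[of \<mu>]] by (simp add: ds)
  note i = defect_products_integrable[OF mu _ square_integrable_rep square_integrable_rep, of _ f g, folded d_def h_def]
  have "(LINT p|coll_measure \<mu>. d p * defect \<mu> (rep_wL2 g) p) = ?I fst + ?I freq3 - ?I (\<lambda>p. fst (snd p)) - ?I (\<lambda>p. snd (snd p))"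
    unfolding defect_def[of \<mu> "rep_wL2 g"] h_def[symmetric] right_diff_distrib distrib_left
    using i[OF collision_frequencies(1)] i[OF collision_frequencies(2)] i[OF collision_frequencies(3)] i[OF collision_frequencies(4)]
    by simp
  also have "\<dots> = 4 * ?I fst" using 1 2 3 by simp
  finally show ?thesis by (simp add: inner_L_op_defect[OF mu] d_def h_def)
qed

lemma L_op_symmetric: "\<mu> \<ge> 0 \<Longrightarrow> inner (L_op \<mu> f) g = inner f (L_op \<mu> g)"
  by (simp add: L_op_form inner_commute[of f] mult.commute)

lemma L_op_nonpositive: "\<mu> \<ge> 0 \<Longrightarrow> inner (L_op \<mu> f) f \<le> 0"
  by (simp add: L_op_form)

lemma bounded_linear_L_op: "\<mu> \<ge> 0 \<Longrightarrow> bounded_linear (L_op \<mu>)"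
  using bounded_linear_A_K(3) by (simp add: operators_eq_bounded)

text \<open>For an arbitrary representative, and as a nonnegative integral, which is the form used for the spectral gap.\<close>

lemma dissipation_L2_class:
  assumes mu: "\<mu> \<ge> 0" and g: "square_integrable g"
  shows "(\<integral>\<^sup>+p. ennreal ((defect \<mu> g p)\<^sup>2) \<partial>coll_measure \<mu>) = ennreal (4 * dissipation \<mu> (L2_class g))"
proof -
  let ?g = "rep_wL2 (L2_class g)"
  have ae: "AE x in wmeasure. ?g x = g x" by (rule AE_rep_L2_class[OF g])
  have "AE p in coll_measure \<mu>. defect \<mu> ?g p = defect \<mu> g p"
    using profile_cong_AE[OF mu collision_frequencies(1) ae] profile_cong_AE[OF mu collision_frequencies(2) ae]
      profile_cong_AE[OF mu collision_frequencies(3) ae] profile_cong_AE[OF mu collision_frequencies(4) ae]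
    by eventually_elim (simp add: defect_def)
  then have "(\<integral>\<^sup>+p. ennreal ((defect \<mu> g p)\<^sup>2) \<partial>coll_measure \<mu>) = (\<integral>\<^sup>+p. ennreal ((defect \<mu> ?g p)\<^sup>2) \<partial>coll_measure \<mu>)"
    by (intro nn_integral_cong_AE) (auto elim: eventually_mono)
  also have "\<dots> = ennreal (LINT p|coll_measure \<mu>. (defect \<mu> ?g p)\<^sup>2)"
  proof (rule nn_integral_eq_integral)
    have "integrable (coll_measure \<mu>) (\<lambda>p. defect \<mu> ?g p * defect \<mu> ?g p)"
    proof -
      note i = defect_products_integrable[OF mu _ square_integrable_rep square_integrable_rep, of _ "L2_class g" "L2_class g"]
      have "integrable (coll_measure \<mu>) (\<lambda>p. defect \<mu> ?g p * profile \<mu> ?g (fst p) + defect \<mu> ?g p * profile \<mu> ?g (freq3 p)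
          - defect \<mu> ?g p * profile \<mu> ?g (fst (snd p)) - defect \<mu> ?g p * profile \<mu> ?g (snd (snd p)))"
        by (intro Bochner_Integration.integrable_add Bochner_Integration.integrable_diff
          i[OF collision_frequencies(1)] i[OF collision_frequencies(2)] i[OF collision_frequencies(3)] i[OF collision_frequencies(4)])
      then show ?thesis
        by (simp add: defect_def[of \<mu> ?g, abs_def] right_diff_distrib distrib_left)
    qed
    then show "integrable (coll_measure \<mu>) (\<lambda>p. (defect \<mu> ?g p)\<^sup>2)" by (simp add: power2_eq_square)
  qed simp
  also have "(LINT p|coll_measure \<mu>. (defect \<mu> ?g p)\<^sup>2) = 4 * dissipation \<mu> (L2_class g)"
    by (simp add: dissipation_def L_op_form[OF mu] power2_eq_square)
  finally show ?thesis .
qed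

section \<open>Increments of the profile and the collision energy\<close>

lemma nn_integral_pair:
  assumes [measurable]: "(\<lambda>q. F (fst q) (snd q)) \<in> borel_measurable (borel :: (real \<times> real) measure)"
  shows "(\<integral>\<^sup>+q. F (fst q) (snd q) \<partial>lborel) = (\<integral>\<^sup>+x. \<integral>\<^sup>+y. F x y \<partial>lborel \<partial>lborel)"
    "(\<integral>\<^sup>+q. F (fst q) (snd q) \<partial>lborel) = (\<integral>\<^sup>+y. \<integral>\<^sup>+x. F x y \<partial>lborel \<partial>lborel)"
  using nn_integral_lborel2[OF assms] nn_integral_lborel2_swap[of F, OF assms] by simp_all

lemma nn_integral_interval_const:
  fixes a b K :: real
  assumes "a \<le> b" "K \<ge> 0"
  shows "(\<integral>\<^sup>+u. ennreal (if a \<le> u \<and> u \<le> b then K else 0) \<partial>lborel) = ennreal (K * (b - a))"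
proof -
  have "(\<integral>\<^sup>+u. ennreal (if a \<le> u \<and> u \<le> b then K else 0) \<partial>lborel) = (\<integral>\<^sup>+u. ennreal K * indicator {a..b} u \<partial>lborel)"
    by (intro nn_integral_cong) (auto simp: indicator_def)
  also have "\<dots> = ennreal K * ennreal (b - a)" using assms by (simp add: nn_integral_cmult_indicator)
  finally show ?thesis using assms by (simp add: ennreal_mult)
qed

lemma nn_integral_le_lincomb:
  fixes f g h :: "'a \<Rightarrow> real"
  assumes [measurable]: "g \<in> borel_measurable M" "h \<in> borel_measurable M"
    and "a \<ge> 0" "b \<ge> 0" "\<And>x. g x \<ge> 0" "\<And>x. h x \<ge> 0" and le: "\<And>x. f x \<le> a * g x + b * h x"
  shows "(\<integral>\<^sup>+x. ennreal (f x) \<partial>M) \<le> ennreal a * (\<integral>\<^sup>+x. ennreal (g x) \<partial>M) + ennreal b * (\<integral>\<^sup>+x. ennreal (h x) \<partial>M)"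
proof -
  have "(\<integral>\<^sup>+x. ennreal (f x) \<partial>M) \<le> (\<integral>\<^sup>+x. ennreal a * ennreal (g x) + ennreal b * ennreal (h x) \<partial>M)"
  proof (rule nn_integral_mono)
    fix x
    have "ennreal (f x) \<le> ennreal (a * g x + b * h x)" by (rule ennreal_leI[OF le])
    also have "\<dots> = ennreal a * ennreal (g x) + ennreal b * ennreal (h x)"
      using assms(3-6) by (simp add: ennreal_mult)
    finally show "ennreal (f x) \<le> \<dots>" .
  qed
  also have "\<dots> = ennreal a * (\<integral>\<^sup>+x. ennreal (g x) \<partial>M) + ennreal b * (\<integral>\<^sup>+x. ennreal (h x) \<partial>M)"
    by (simp add: nn_integral_add nn_integral_cmult)
  finally show ?thesis .
qed

text \<open>Precise enough for the two absorption arguments below, which need \<open>2\<^bsup>5/2\<^esup> / 2 < 16/5\<close> and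
\<open>(7/4)\<^bsup>3/2\<^esup> / 8 > 11/40\<close>.\<close>

lemma two_powr_bounds: "(2::real) powr (5/2) \<le> 566/100" "(2::real) powr (3/2) \<le> 283/100"
  "(6::real) powr (3/2) \<le> 15" "(7/4 :: real) powr (3/2) \<ge> 23/10"
proof -
  have p: "x powr (3/2) = x * sqrt x" if "x > 0" for x :: real
    using that powr_add[of x 1 "1/2"] by (simp add: powr_half_sqrt)
  have q: "x powr (5/2) = x\<^sup>2 * sqrt x" if "x > 0" for x :: real
    using that powr_add[of x 2 "1/2"] by (simp add: powr_half_sqrt powr_numeral)
  have s2: "sqrt 2 \<le> 1415/1000" by (rule real_le_lsqrt) (auto simp: power2_eq_square)
  have s6: "sqrt 6 \<le> 25/10" by (rule real_le_lsqrt) (auto simp: power2_eq_square)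
  have s7: "sqrt (7/4) \<ge> 1315/1000" by (rule real_le_rsqrt) (auto simp: power2_eq_square)
  show "(2::real) powr (5/2) \<le> 566/100" using s2 by (simp add: q)
  show "(2::real) powr (3/2) \<le> 283/100" using s2 by (simp add: p)
  show "(6::real) powr (3/2) \<le> 15" using s6 by (simp add: p)
  show "(7/4 :: real) powr (3/2) \<ge> 23/10" using s7 p[of "7/4"] by simp
qed

text \<open>This map and the next one take the pair of the first two points of a collision chain to the first two frequencies
of its collisions; both are composed of reflections in one variable and exchanges of the variables.\<close>

lemma lborel_shear1:
  assumes [measurable]: "(\<lambda>q. G (fst q) (snd q)) \<in> borel_measurable (borel :: (real \<times> real) measure)"
  shows "(\<integral>\<^sup>+x. \<integral>\<^sup>+u. G (2 * u - x) u \<partial>lborel \<partial>lborel) = (\<integral>\<^sup>+x. \<integral>\<^sup>+u. G x u \<partial>lborel \<partial>(lborel :: real measure))"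
proof -
  have m: "(\<lambda>q. G (f q) (g q)) \<in> borel_measurable M" if "f \<in> borel_measurable M" "g \<in> borel_measurable M" for f g and M :: "'z measure"
    using measurable_compose[OF measurable_Pair_borel[OF that] assms] by simp
  have "(\<integral>\<^sup>+x. \<integral>\<^sup>+u. G (2 * u - x) u \<partial>lborel \<partial>lborel) = (\<integral>\<^sup>+u. \<integral>\<^sup>+x. G (2 * u - x) u \<partial>lborel \<partial>lborel)"
    by (rule nn_integral_lborel2_swap) (intro m; measurable)
  also have "\<dots> = (\<integral>\<^sup>+u. \<integral>\<^sup>+x. G x u \<partial>lborel \<partial>lborel)"
    by (intro nn_integral_cong nn_integral_reflect m) measurable
  also have "\<dots> = (\<integral>\<^sup>+x. \<integral>\<^sup>+u. G x u \<partial>lborel \<partial>lborel)"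
    by (rule nn_integral_lborel2_swap[symmetric]) fact
  finally show ?thesis .
qed

lemma lborel_shear2:
  assumes [measurable]: "(\<lambda>q. G (fst q) (snd q)) \<in> borel_measurable (borel :: (real \<times> real) measure)"
  shows "(\<integral>\<^sup>+x. \<integral>\<^sup>+u. G (3 * u - 2 * x) (2 * u - x) \<partial>lborel \<partial>lborel) = (\<integral>\<^sup>+x. \<integral>\<^sup>+u. G x u \<partial>lborel \<partial>(lborel :: real measure))"
proof -
  have m: "(\<lambda>q. G (f q) (g q)) \<in> borel_measurable M" if "f \<in> borel_measurable M" "g \<in> borel_measurable M" for f g and M :: "'z measure"
    using measurable_compose[OF measurable_Pair_borel[OF that] assms] by simp
  have "(\<integral>\<^sup>+x. \<integral>\<^sup>+u. G (3 * u - 2 * x) (2 * u - x) \<partial>lborel \<partial>lborel)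
      = (\<integral>\<^sup>+u. \<integral>\<^sup>+x. G (2 * (2 * u - x) - u) (2 * u - x) \<partial>lborel \<partial>lborel)"
  proof -
    have "(\<lambda>q. G (3 * snd q - 2 * fst q) (2 * snd q - fst q)) \<in> borel_measurable (borel :: (real \<times> real) measure)"
      by (intro m) measurable
    from nn_integral_lborel2_swap[of "\<lambda>x u. G (3 * u - 2 * x) (2 * u - x)", OF this] show ?thesis
      by (simp add: algebra_simps)
  qed
  also have "\<dots> = (\<integral>\<^sup>+u. \<integral>\<^sup>+a. G (2 * a - u) a \<partial>lborel \<partial>lborel)"
    by (intro nn_integral_cong nn_integral_reflect m) measurable
  also have "\<dots> = (\<integral>\<^sup>+x. \<integral>\<^sup>+u. G x u \<partial>lborel \<partial>lborel)" by (rule lborel_shear1) fact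
  finally show ?thesis .
qed

definition energy_density :: "real \<Rightarrow> (real \<Rightarrow> real) \<Rightarrow> real \<Rightarrow> real \<Rightarrow> real \<Rightarrow> real" where
  "energy_density \<mu> h a b c = coll_density \<mu> (a, b, c) * (h a + h (b + c - a) - h b - h c)\<^sup>2"

definition total_energy :: "real \<Rightarrow> (real \<Rightarrow> real) \<Rightarrow> ennreal" where
  "total_energy \<mu> h = (\<integral>\<^sup>+p. ennreal (energy_density \<mu> h (fst p) (fst (snd p)) (snd (snd p))) \<partial>lborel)"

text \<open>With \<open>e(x,u) = h(u) - h(x)\<close> this is \<open>e(u, 3u - 2x) - 2 e(x, u)\<close>: the points \<open>x\<close>, \<open>u\<close> and
\<open>3u - 2x\<close> have gaps \<open>u - x\<close> and \<open>2 (u - x)\<close>, so it vanishes for affine \<open>h\<close>.\<close>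

definition doubling_defect :: "(real \<Rightarrow> real) \<Rightarrow> real \<Rightarrow> real \<Rightarrow> real" where
  "doubling_defect h x u = h (3 * u - 2 * x) - 3 * h u + 2 * h x"

lemma measurable_doubling_defect:
  assumes [measurable]: "h \<in> borel_measurable borel" "f \<in> borel_measurable M" "g \<in> borel_measurable M"
  shows "(\<lambda>x. doubling_defect h (f x) (g x)) \<in> borel_measurable M"
  unfolding doubling_defect_def by measurable

context
  fixes \<mu> :: real and h :: "real \<Rightarrow> real"
  assumes mu: "\<mu> \<ge> 0" and h [measurable]: "h \<in> borel_measurable borel"
begin

lemma energy_density_nonneg: "energy_density \<mu> h a b c \<ge> 0"
  unfolding energy_density_def by (intro mult_nonneg_nonneg coll_density_nonneg mu) auto

lemma measurable_energy_density:
  assumes [measurable]: "f \<in> borel_measurable M" "g \<in> borel_measurable M" "k \<in> borel_measurable M"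
  shows "(\<lambda>x. energy_density \<mu> h (f x) (g x) (k x)) \<in> borel_measurable M"
  unfolding energy_density_def by measurable

lemma total_energy_iterated: "total_energy \<mu> h = (\<integral>\<^sup>+x. \<integral>\<^sup>+y. \<integral>\<^sup>+z. ennreal (energy_density \<mu> h x y z) \<partial>lborel \<partial>lborel \<partial>lborel)"
  unfolding total_energy_def
  by (subst nn_integral_lborel3(3)) (auto intro!: measurable_compose[OF _ measurable_ennreal] measurable_energy_density)

text \<open>In the variables \<open>(x, u, v)\<close> let \<open>p\<close> be \<open>x\<close>, \<open>u\<close> or \<open>2u - x\<close>. The three collisions have incoming
frequencies \<open>p + (u - x)\<close> and \<open>v\<close>, outgoing frequencies \<open>p\<close> and \<open>u + v - x\<close>: they compare the increment of
\<open>h\<close> over the step \<open>u - x\<close> starting at \<open>p\<close> with the one starting at \<open>v\<close>. Each of the maps from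
\<open>(x, u, v)\<close> to the collision preserves volume.\<close>

lemma total_energy_transforms:
  "(\<integral>\<^sup>+p. ennreal (energy_density \<mu> h (fst (snd p)) (fst p) (fst (snd p) + snd (snd p) - fst p)) \<partial>lborel) = total_energy \<mu> h"
  "(\<integral>\<^sup>+p. ennreal (energy_density \<mu> h (2 * fst (snd p) - fst p) (fst (snd p)) (fst (snd p) + snd (snd p) - fst p)) \<partial>lborel) = total_energy \<mu> h"
  "(\<integral>\<^sup>+p. ennreal (energy_density \<mu> h (3 * fst (snd p) - 2 * fst p) (2 * fst (snd p) - fst p) (fst (snd p) + snd (snd p) - fst p)) \<partial>lborel) = total_energy \<mu> h"
proof -
  note m = measurable_compose[OF measurable_energy_density measurable_ennreal]
  define G where "G a b = (\<integral>\<^sup>+z. ennreal (energy_density \<mu> h a b z) \<partial>lborel)" for a b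
  have mG: "(\<lambda>q. G (fst q) (snd q)) \<in> borel_measurable (borel :: (real \<times> real) measure)"
    unfolding G_def by (intro lborel.borel_measurable_nn_integral) (simp add: split_beta', intro m; measurable)
  have sh: "(\<integral>\<^sup>+p. ennreal (energy_density \<mu> h (a (fst p) (fst (snd p))) (b (fst p) (fst (snd p))) (fst (snd p) + snd (snd p) - fst p)) \<partial>lborel)
     = (\<integral>\<^sup>+x. \<integral>\<^sup>+u. G (a x u) (b x u) \<partial>lborel \<partial>lborel)"
    if ab: "(\<lambda>p. a (fst p) (fst (snd p))) \<in> borel_measurable (borel :: (real \<times> real \<times> real) measure)"
      "(\<lambda>p. b (fst p) (fst (snd p))) \<in> borel_measurable (borel :: (real \<times> real \<times> real) measure)" for a b
  proof -
    have "(\<integral>\<^sup>+z. ennreal (energy_density \<mu> h c d (u + z - x)) \<partial>lborel) = G c d" for c d u x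
    proof -
      have "(\<lambda>z. ennreal (energy_density \<mu> h c d z)) \<in> borel_measurable borel"
        by (rule m) simp_all
      from nn_integral_shift[OF this, of "u - x"] show ?thesis
        by (simp add: G_def add_diff_eq add.commute)
    qed
    moreover have "(\<lambda>p. ennreal (energy_density \<mu> h (a (fst p) (fst (snd p))) (b (fst p) (fst (snd p))) (fst (snd p) + snd (snd p) - fst p)))
      \<in> borel_measurable (borel :: (real \<times> real \<times> real) measure)"
      by (rule m, rule ab, rule ab) measurable
    ultimately show ?thesis by (simp add: nn_integral_lborel3(3))
  qed
  have Q: "total_energy \<mu> h = (\<integral>\<^sup>+x. \<integral>\<^sup>+u. G x u \<partial>lborel \<partial>lborel)" by (simp add: total_energy_iterated G_def)
  show "(\<integral>\<^sup>+p. ennreal (energy_density \<mu> h (fst (snd p)) (fst p) (fst (snd p) + snd (snd p) - fst p)) \<partial>lborel) = total_energy \<mu> h"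
    unfolding Q using sh[of "\<lambda>x u. u" "\<lambda>x u. x"] nn_integral_lborel2_swap[OF mG] by simp
  show "(\<integral>\<^sup>+p. ennreal (energy_density \<mu> h (2 * fst (snd p) - fst p) (fst (snd p)) (fst (snd p) + snd (snd p) - fst p)) \<partial>lborel) = total_energy \<mu> h"
    unfolding Q using sh[of "\<lambda>x u. 2 * u - x" "\<lambda>x u. u"] lborel_shear1[OF mG] by simp
  show "(\<integral>\<^sup>+p. ennreal (energy_density \<mu> h (3 * fst (snd p) - 2 * fst p) (2 * fst (snd p) - fst p) (fst (snd p) + snd (snd p) - fst p)) \<partial>lborel) = total_energy \<mu> h"
    unfolding Q using sh[of "\<lambda>x u. 3 * u - 2 * x" "\<lambda>x u. 2 * u - x"] lborel_shear2[OF mG] by simp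
qed

text \<open>If all four frequencies are comparable to \<open>x \<ge> 1\<close>, each of them contributes \<open>n \<ge> ((4 + \<mu>) x)\<^bsup>-1\<^esup>\<close> and the
minimum of the roots is at least \<open>sqrt x\<close>.\<close>

lemma coll_density_scale_lower:
  assumes x: "x \<ge> 1" and r: "x \<le> a" "a \<le> 4 * x" "x \<le> b" "b \<le> 4 * x" "x \<le> c" "c \<le> 4 * x" "x \<le> b + c - a" "b + c - a \<le> 4 * x"
  shows "x powr (-7/2) \<le> (4 + \<mu>) ^ 4 * coll_density \<mu> (a, b, c)"
proof -
  have "1 \<le> (4 + \<mu>) * x * eq_n \<mu> w" if "x \<le> w" "w \<le> 4 * x" for w
  proof -
    have "\<mu> * 1 \<le> \<mu> * x" using mu x by (intro mult_left_mono) auto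
    then have "w + \<mu> \<le> (4 + \<mu>) * x" using that by (simp add: distrib_right)
    then show ?thesis using that x mu by (simp add: eq_n_def)
  qed
  note n = this[OF r(1,2)] this[OF r(3,4)] this[OF r(5,6)] this[OF r(7,8)]
  have "1 \<le> ((4 + \<mu>) * x * eq_n \<mu> a) * ((4 + \<mu>) * x * eq_n \<mu> b) * ((4 + \<mu>) * x * eq_n \<mu> c) * ((4 + \<mu>) * x * eq_n \<mu> (b + c - a))"
  proof -
    have "1 \<le> r * s" if "1 \<le> r" "1 \<le> s" for r s :: real
      using mult_mono[OF that] that by simp
    then show ?thesis using n by blast
  qed
  also have "\<dots> = ((4 + \<mu>) ^ 4 * (eq_n \<mu> a * eq_n \<mu> b * eq_n \<mu> c * eq_n \<mu> (b + c - a))) * x ^ 4"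
    by (simp add: power4_eq_xxxx mult_ac)
  finally have 1: "1 \<le> \<dots>" .
  have p4: "x powr (-4) * x ^ 4 = 1" using x powr_add[of x "-4" 4] by (simp add: powr_numeral)
  have "x powr (-4) * 1 \<le> x powr (-4) * (((4 + \<mu>) ^ 4 * (eq_n \<mu> a * eq_n \<mu> b * eq_n \<mu> c * eq_n \<mu> (b + c - a))) * x ^ 4)"
    using 1 by (intro mult_left_mono) auto
  also have "\<dots> = (4 + \<mu>) ^ 4 * (eq_n \<mu> a * eq_n \<mu> b * eq_n \<mu> c * eq_n \<mu> (b + c - a)) * (x powr (-4) * x ^ 4)"
    by (simp only: mult_ac)
  finally have 2: "x powr (-4) \<le> (4 + \<mu>) ^ 4 * (eq_n \<mu> a * eq_n \<mu> b * eq_n \<mu> c * eq_n \<mu> (b + c - a))" by (simp add: p4)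
  have "x powr (-7/2) = sqrt x * x powr (-4)"
    using x powr_add[of x "1/2" "-4"] by (simp add: powr_half_sqrt)
  also have "\<dots> \<le> min (min (sqrt a) (sqrt b)) (min (sqrt c) (sqrt (b + c - a)))
      * ((4 + \<mu>) ^ 4 * (eq_n \<mu> a * eq_n \<mu> b * eq_n \<mu> c * eq_n \<mu> (b + c - a)))"
    using 2 r x by (intro mult_mono) auto
  also have "\<dots> = (4 + \<mu>) ^ 4 * coll_density \<mu> (a, b, c)"
    using r x by (simp add: coll_density_eq mult_ac)
  finally show ?thesis .
qed

text \<open>The step from \<open>u\<close> to \<open>3u - 2x\<close> consists of two steps of length \<open>u - x\<close>, from \<open>u\<close> and from \<open>2u - x\<close>. Comparing
these, and twice the step from \<open>x\<close>, with the step from an auxiliary point \<open>v\<close> expresses the doubling defect by three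
collision defects, in which the increment at \<open>v\<close> cancels. Averaging over \<open>v \<in> [x, 2x]\<close>, an interval of
length \<open>x\<close>, turns the weight \<open>x\<^bsup>-5/2\<^esup>\<close> into the collision density, of order \<open>x\<^bsup>-7/2\<^esup>\<close>. The constant
is \<open>18 = 3 + 3 + 12\<close>, from \<open>(a + b - 2c)\<^sup>2 \<le> 3 (a\<^sup>2 + b\<^sup>2) + 12 c\<^sup>2\<close>.\<close>

lemma doubling_defect_bound:
  "(\<integral>\<^sup>+q. ennreal (if 1 \<le> fst q \<and> fst q \<le> snd q \<and> snd q \<le> 2 * fst q
      then (doubling_defect h (fst q) (snd q))\<^sup>2 * fst q powr (-5/2) else 0) \<partial>lborel) \<le> ennreal (18 * (4 + \<mu>) ^ 4) * total_energy \<mu> h"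
proof -
  note m = measurable_energy_density
  define B where "B x u v = (if 1 \<le> x \<and> x \<le> u \<and> u \<le> 2 * x \<and> x \<le> v \<and> v \<le> 2 * x
      then (doubling_defect h x u)\<^sup>2 * x powr (-7/2) else 0)" for x u v :: real
  define c1 where "c1 p = energy_density \<mu> h (fst (snd p)) (fst p) (fst (snd p) + snd (snd p) - fst p)" for p :: "real \<times> real \<times> real"
  define c2 where "c2 p = energy_density \<mu> h (2 * fst (snd p) - fst p) (fst (snd p)) (fst (snd p) + snd (snd p) - fst p)" for p :: "real \<times> real \<times> real"
  define c3 where "c3 p = energy_density \<mu> h (3 * fst (snd p) - 2 * fst p) (2 * fst (snd p) - fst p) (fst (snd p) + snd (snd p) - fst p)" for p :: "real \<times> real \<times> real"
  have mc: "c1 \<in> borel_measurable borel" "c2 \<in> borel_measurable borel" "c3 \<in> borel_measurable borel"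
    unfolding c1_def c2_def c3_def by (intro m; measurable)+
  note [measurable] = mc
  have [measurable]: "(\<lambda>q. doubling_defect h (fst q) (snd q)) \<in> borel_measurable (borel :: (real \<times> real) measure)"
    "(\<lambda>p. doubling_defect h (fst p) (fst (snd p))) \<in> borel_measurable (borel :: (real \<times> real \<times> real) measure)"
    by (intro measurable_doubling_defect h; measurable)+
  have B: "B x u v \<le> 3 * (4 + \<mu>) ^ 4 * (c3 (x, u, v) + c2 (x, u, v)) + 12 * (4 + \<mu>) ^ 4 * c1 (x, u, v)" for x u v
  proof (cases "1 \<le> x \<and> x \<le> u \<and> u \<le> 2 * x \<and> x \<le> v \<and> v \<le> 2 * x")
    case True
    (* d is the reference increment at v, and e p compares the increment at p with it; up to the sign
       convention e p is the defect of one collision. *)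
    define d where "d = h (v + u - x) - h v"
    define e where "e p = h (p + (u - x)) - h p - d" for p
    have low: "(e p)\<^sup>2 * x powr (-7/2) \<le> (4 + \<mu>) ^ 4 * energy_density \<mu> h (p + (u - x)) p (u + v - x)"
      if "x \<le> p" "p \<le> 3 * x" for p
    proof -
      have "(e p)\<^sup>2 * x powr (-7/2) \<le> (e p)\<^sup>2 * ((4 + \<mu>) ^ 4 * coll_density \<mu> (p + (u - x), p, u + v - x))"
        using True that by (intro mult_left_mono coll_density_scale_lower) auto
      also have "\<dots> = (4 + \<mu>) ^ 4 * energy_density \<mu> h (p + (u - x)) p (u + v - x)"
        by (simp add: energy_density_def e_def d_def algebra_simps)
      finally show ?thesis .
    qed
    have T: "doubling_defect h x u = e (2 * u - x) + e u - 2 * e x"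
      by (simp add: doubling_defect_def e_def algebra_simps)
    have "(doubling_defect h x u)\<^sup>2 \<le> 3 * ((e (2 * u - x))\<^sup>2 + (e u)\<^sup>2) + 12 * (e x)\<^sup>2"
    proof -
      have "0 \<le> (e (2 * u - x) - e u)\<^sup>2 + (e (2 * u - x) + 2 * e x)\<^sup>2 + (e u + 2 * e x)\<^sup>2" by simp
      then show ?thesis unfolding T by (simp add: power2_eq_square algebra_simps)
    qed
    then have "(doubling_defect h x u)\<^sup>2 * x powr (-7/2) \<le> (3 * ((e (2 * u - x))\<^sup>2 + (e u)\<^sup>2) + 12 * (e x)\<^sup>2) * x powr (-7/2)"
      by (rule mult_right_mono) simp
    also have "\<dots> = 3 * ((e (2 * u - x))\<^sup>2 * x powr (-7/2)) + 3 * ((e u)\<^sup>2 * x powr (-7/2)) + 12 * ((e x)\<^sup>2 * x powr (-7/2))"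
      by (simp add: algebra_simps)
    also have "\<dots> \<le> 3 * ((4 + \<mu>) ^ 4 * energy_density \<mu> h (2 * u - x + (u - x)) (2 * u - x) (u + v - x))
        + 3 * ((4 + \<mu>) ^ 4 * energy_density \<mu> h (u + (u - x)) u (u + v - x)) + 12 * ((4 + \<mu>) ^ 4 * energy_density \<mu> h (x + (u - x)) x (u + v - x))"
      using True by (intro add_mono mult_left_mono low) auto
    also have "\<dots> = 3 * (4 + \<mu>) ^ 4 * (c3 (x, u, v) + c2 (x, u, v)) + 12 * (4 + \<mu>) ^ 4 * c1 (x, u, v)"
      by (simp add: c1_def c2_def c3_def algebra_simps)
    finally show ?thesis using True by (simp add: B_def)
  next
    case False
    then show ?thesis using mu energy_density_nonneg
      by (auto simp: B_def c1_def c2_def c3_def intro!: add_nonneg_nonneg mult_nonneg_nonneg)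
  qed
  have "(\<integral>\<^sup>+q. ennreal (if 1 \<le> fst q \<and> fst q \<le> snd q \<and> snd q \<le> 2 * fst q
      then (doubling_defect h (fst q) (snd q))\<^sup>2 * fst q powr (-5/2) else 0) \<partial>lborel)
    = (\<integral>\<^sup>+x. \<integral>\<^sup>+u. ennreal (if 1 \<le> x \<and> x \<le> u \<and> u \<le> 2 * x
      then (doubling_defect h x u)\<^sup>2 * x powr (-5/2) else 0) \<partial>lborel \<partial>lborel)"
    by (rule nn_integral_pair(1)) measurable
  also have "\<dots> = (\<integral>\<^sup>+x. \<integral>\<^sup>+u. \<integral>\<^sup>+v. ennreal (B x u v) \<partial>lborel \<partial>lborel \<partial>lborel)"
  proof (intro nn_integral_cong)
    fix x u :: real
    show "ennreal (if 1 \<le> x \<and> x \<le> u \<and> u \<le> 2 * x then (doubling_defect h x u)\<^sup>2 * x powr (-5/2) else 0) = (\<integral>\<^sup>+v. ennreal (B x u v) \<partial>lborel)"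
    proof (cases "1 \<le> x \<and> x \<le> u \<and> u \<le> 2 * x")
      case True
      have "(\<integral>\<^sup>+v. ennreal (B x u v) \<partial>lborel) = (\<integral>\<^sup>+v. ennreal (if x \<le> v \<and> v \<le> 2 * x then (doubling_defect h x u)\<^sup>2 * x powr (-7/2) else 0) \<partial>lborel)"
        using True by (intro nn_integral_cong) (simp add: B_def)
      also have "\<dots> = ennreal ((doubling_defect h x u)\<^sup>2 * x powr (-7/2) * (2 * x - x))"
        using True by (intro nn_integral_interval_const) auto
      also have "x powr (-7/2) * (2 * x - x) = x powr (-5/2)"
        using True powr_add[of x "-7/2" 1] by simp
      then have "(doubling_defect h x u)\<^sup>2 * x powr (-7/2) * (2 * x - x) = (doubling_defect h x u)\<^sup>2 * x powr (-5/2)"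
        by (simp only: mult.assoc)
      finally show ?thesis using True by simp
    next
      case False
      then have "B x u v = 0" for v by (auto simp: B_def)
      then show ?thesis using False by auto
    qed
  qed
  also have "\<dots> = (\<integral>\<^sup>+p. ennreal (B (fst p) (fst (snd p)) (snd (snd p))) \<partial>lborel)"
    unfolding B_def by (subst nn_integral_lborel3(3)) (simp_all cong: if_cong)
  also have "\<dots> \<le> ennreal (3 * (4 + \<mu>) ^ 4) * (\<integral>\<^sup>+p. ennreal (c3 p + c2 p) \<partial>lborel) + ennreal (12 * (4 + \<mu>) ^ 4) * (\<integral>\<^sup>+p. ennreal (c1 p) \<partial>lborel)"
  proof (rule nn_integral_le_lincomb)
    show "c3 p + c2 p \<ge> 0" "c1 p \<ge> 0" for p
      unfolding c1_def c2_def c3_def by (intro add_nonneg_nonneg energy_density_nonneg)+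
    show "B (fst p) (fst (snd p)) (snd (snd p)) \<le> 3 * (4 + \<mu>) ^ 4 * (c3 p + c2 p) + 12 * (4 + \<mu>) ^ 4 * c1 p" for p
      using B[of "fst p" "fst (snd p)" "snd (snd p)"] by simp
  qed (use mu in auto)
  also have "(\<integral>\<^sup>+p. ennreal (c3 p + c2 p) \<partial>lborel) = total_energy \<mu> h + total_energy \<mu> h"
  proof -
    have "(\<integral>\<^sup>+p. ennreal (c3 p + c2 p) \<partial>lborel) = (\<integral>\<^sup>+p. ennreal (c3 p) + ennreal (c2 p) \<partial>lborel)"
      by (intro nn_integral_cong ennreal_plus) (simp_all add: c2_def c3_def energy_density_nonneg)
    also have "\<dots> = (\<integral>\<^sup>+p. ennreal (c3 p) \<partial>lborel) + (\<integral>\<^sup>+p. ennreal (c2 p) \<partial>lborel)"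
      by (rule nn_integral_add) measurable
    finally show ?thesis using total_energy_transforms(2,3) by (simp add: c2_def c3_def)
  qed
  also have "(\<integral>\<^sup>+p. ennreal (c1 p) \<partial>lborel) = total_energy \<mu> h" using total_energy_transforms(1) by (simp add: c1_def)
  also have "ennreal (3 * (4 + \<mu>) ^ 4) * (total_energy \<mu> h + total_energy \<mu> h) + ennreal (12 * (4 + \<mu>) ^ 4) * total_energy \<mu> h = ennreal (18 * (4 + \<mu>) ^ 4) * total_energy \<mu> h"
  proof -
    have "ennreal (3 * (4 + \<mu>) ^ 4) * (total_energy \<mu> h + total_energy \<mu> h) + ennreal (12 * (4 + \<mu>) ^ 4) * total_energy \<mu> h
      = (ennreal (3 * (4 + \<mu>) ^ 4) + ennreal (3 * (4 + \<mu>) ^ 4) + ennreal (12 * (4 + \<mu>) ^ 4)) * total_energy \<mu> h"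
      by (simp add: distrib_left distrib_right)
    also have "ennreal (3 * (4 + \<mu>) ^ 4) + ennreal (3 * (4 + \<mu>) ^ 4) + ennreal (12 * (4 + \<mu>) ^ 4) = ennreal (18 * (4 + \<mu>) ^ 4)"
      using mu by (simp add: ennreal_plus[symmetric] del: ennreal_plus)
    finally show ?thesis .
  qed
  finally show ?thesis .
qed

end

section \<open>Coercivity on large frequencies\<close>

text \<open>The squared increments over the cone \<open>1 \<le> x \<le> u \<le> 2x\<close>. Integrating out \<open>u\<close>, which runs
over an interval of length \<open>x\<close>, leaves the weight \<open>x\<^bsup>-3/2\<^esup>\<close> of \<open>tail_energy\<close>.\<close>

definition ratio_energy :: "(real \<Rightarrow> real) \<Rightarrow> ennreal" where
  "ratio_energy h = (\<integral>\<^sup>+q. ennreal (if 1 \<le> fst q \<and> fst q \<le> snd q \<and> snd q \<le> 2 * fst q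
      then (h (snd q) - h (fst q))\<^sup>2 * fst q powr (-5/2) else 0) \<partial>lborel)"

text \<open>For large \<open>x\<close> the weight \<open>x\<^bsup>-3/2\<^esup>\<close> is comparable to \<open>n\<^sup>2 sqrt x\<close>, that is to the norm of \<open>g = n h\<close>.\<close>

definition tail_energy :: "(real \<Rightarrow> real) \<Rightarrow> real \<Rightarrow> ennreal" where
  "tail_energy h c = (\<integral>\<^sup>+x. ennreal (if 1 \<le> x then (h x - c)\<^sup>2 * x powr (-3/2) else 0) \<partial>lborel)"

definition base_energy :: "(real \<Rightarrow> real) \<Rightarrow> real \<Rightarrow> ennreal" where
  "base_energy h c = (\<integral>\<^sup>+x. ennreal (if 1 \<le> x \<and> x \<le> 2 then (h x - c)\<^sup>2 * x powr (-3/2) else 0) \<partial>lborel)"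

definition low_energy :: "(real \<Rightarrow> real) \<Rightarrow> real \<Rightarrow> ennreal" where
  "low_energy h c = (\<integral>\<^sup>+x. ennreal (if 0 < x \<and> x \<le> 1 then (h x - c)\<^sup>2 * sqrt x else 0) \<partial>lborel)"

lemma ennreal_lincomb_leD:
  assumes "ennreal a * ennreal x \<le> ennreal b * ennreal y + ennreal c * ennreal z"
    and "a \<ge> 0" "b \<ge> 0" "c \<ge> 0" "x \<ge> 0" "y \<ge> 0" "z \<ge> 0"
  shows "a * x \<le> b * y + c * z"
proof -
  have "ennreal (a * x) \<le> ennreal (b * y + c * z)"
    using assms by (simp add: ennreal_mult)
  moreover have "0 \<le> b * y + c * z" using assms by simp
  ultimately show ?thesis by (simp only: ennreal_le_iff)
qed

lemma ennreal_lincombI: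
  assumes "x \<le> b * y + c * z" "b \<ge> 0" "c \<ge> 0" "y \<ge> 0" "z \<ge> 0"
  shows "ennreal x \<le> ennreal b * ennreal y + ennreal c * ennreal z"
  using ennreal_leI[OF assms(1)] assms by (simp add: ennreal_mult)

context
  fixes h :: "real \<Rightarrow> real"
  assumes h [measurable]: "h \<in> borel_measurable borel"
begin

lemma ratio_energy_pair:
  "ratio_energy h = (\<integral>\<^sup>+x. \<integral>\<^sup>+u. ennreal (if 1 \<le> x \<and> x \<le> u \<and> u \<le> 2 * x then (h u - h x)\<^sup>2 * x powr (-5/2) else 0) \<partial>lborel \<partial>lborel)"
  "ratio_energy h = (\<integral>\<^sup>+u. \<integral>\<^sup>+x. ennreal (if 1 \<le> x \<and> x \<le> u \<and> u \<le> 2 * x then (h u - h x)\<^sup>2 * x powr (-5/2) else 0) \<partial>lborel \<partial>lborel)"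
  unfolding ratio_energy_def by (rule nn_integral_pair, measurable)+

text \<open>The map \<open>(x,u) \<mapsto> (u, 3u - 2x)\<close> has determinant \<open>2\<close>, and the part of the cone that contributes is mapped into the
cone: for \<open>v = 3u - 2x\<close> the condition \<open>1 \<le> x \<le> u \<le> 2x\<close> gives \<open>u \<le> v \<le> 2u\<close>. As \<open>u \<le> 2x\<close>, the weight at \<open>x\<close> is at most
\<open>2\<^bsup>5/2\<^esup> \<le> 5.66\<close> times the weight at \<open>u\<close>.\<close>

lemma ratio_energy_sheared:
  "2 * (\<integral>\<^sup>+q. ennreal (if 1 \<le> fst q \<and> fst q \<le> snd q \<and> snd q \<le> 2 * fst q
      then (h (3 * snd q - 2 * fst q) - h (snd q))\<^sup>2 * fst q powr (-5/2) else 0) \<partial>lborel)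
    \<le> ennreal (566/100) * ratio_energy h" (is "2 * ?N' \<le> _")
proof -
  (* the integrand in the variables u and v = 3u - 2x, so that x = (3u - v) / 2 *)
  define K where "K v u = (if 1 \<le> (3 * u - v) / 2 \<and> (3 * u - v) / 2 \<le> u \<and> u \<le> 2 * ((3 * u - v) / 2)
    then (h v - h u)\<^sup>2 * ((3 * u - v) / 2) powr (-5/2) else 0)" for v u
  have mK: "(\<lambda>v. ennreal (K v u)) \<in> borel_measurable borel" for u unfolding K_def by measurable
  have "?N' = (\<integral>\<^sup>+u. \<integral>\<^sup>+x. ennreal (K (3 * u - 2 * x) u) \<partial>lborel \<partial>lborel)"
  proof -
    have "?N' = (\<integral>\<^sup>+u. \<integral>\<^sup>+x. ennreal (if 1 \<le> x \<and> x \<le> u \<and> u \<le> 2 * x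
      then (h (3 * u - 2 * x) - h u)\<^sup>2 * x powr (-5/2) else 0) \<partial>lborel \<partial>lborel)"
      by (rule nn_integral_pair(2)) measurable
    then show ?thesis by (simp add: K_def cong: if_cong)
  qed
  also have "2 * \<dots> = (\<integral>\<^sup>+u. 2 * (\<integral>\<^sup>+x. ennreal (K (3 * u - 2 * x) u) \<partial>lborel) \<partial>lborel)"
    by (rule nn_integral_cmult[symmetric]) (simp add: K_def)
  also have "\<dots> = (\<integral>\<^sup>+u. \<integral>\<^sup>+v. ennreal (K v u) \<partial>lborel \<partial>lborel)"
    using nn_integral_real_affine[OF mK, of "-2"] by (intro nn_integral_cong) simp
  also have "\<dots> \<le> (\<integral>\<^sup>+u. \<integral>\<^sup>+v. ennreal (566/100) * ennreal (if 1 \<le> u \<and> u \<le> v \<and> v \<le> 2 * u then (h v - h u)\<^sup>2 * u powr (-5/2) else 0) \<partial>lborel \<partial>lborel)"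
  proof (intro nn_integral_mono)
    fix u v :: real
    have "K v u \<le> 566/100 * (if 1 \<le> u \<and> u \<le> v \<and> v \<le> 2 * u then (h v - h u)\<^sup>2 * u powr (-5/2) else 0)"
    proof (cases "1 \<le> (3 * u - v) / 2 \<and> (3 * u - v) / 2 \<le> u \<and> u \<le> 2 * ((3 * u - v) / 2)")
      case True
      then have c: "1 \<le> u" "u \<le> v" "v \<le> 2 * u" by auto
      have "((3 * u - v) / 2) powr (-5/2) \<le> (u / 2) powr (-5/2)"
        using c True by (intro powr_mono2') auto
      also have "\<dots> = 2 powr (5/2) * u powr (-5/2)"
        using c by (simp add: powr_divide powr_minus field_simps)
      also have "\<dots> \<le> 566/100 * u powr (-5/2)" using two_powr_bounds(1) by (intro mult_right_mono) auto
      finally have "(h v - h u)\<^sup>2 * ((3 * u - v) / 2) powr (-5/2) \<le> (h v - h u)\<^sup>2 * (566/100 * u powr (-5/2))"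
        by (rule mult_left_mono) simp
      then show ?thesis using True c by (simp add: K_def)
    qed (auto simp: K_def)
    then have "ennreal (K v u) \<le> ennreal (566/100 * (if 1 \<le> u \<and> u \<le> v \<and> v \<le> 2 * u then (h v - h u)\<^sup>2 * u powr (-5/2) else 0))"
      by (rule ennreal_leI)
    also have "\<dots> = ennreal (566/100) * ennreal (if 1 \<le> u \<and> u \<le> v \<and> v \<le> 2 * u then (h v - h u)\<^sup>2 * u powr (-5/2) else 0)"
      by (rule ennreal_mult) auto
    finally show "ennreal (K v u) \<le> \<dots>" .
  qed
  also have "\<dots> = ennreal (566/100) * ratio_energy h"
    by (simp add: nn_integral_cmult ratio_energy_pair(1))
  finally show ?thesis .
qed

text \<open>Each end of an increment is weighted at most like the tail energy. Finiteness permits the absorption in the next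
lemma, which fails without it: the profile \<open>h(\<omega>) = \<omega>\<close> has no collision energy but infinite ratio energy.\<close>

lemma ratio_energy_finite:
  assumes fin: "tail_energy h 0 < \<infinity>"
  shows "ratio_energy h < \<infinity>"
proof -
  define f1 where "f1 q = (if 1 \<le> fst q \<and> fst q \<le> snd q \<and> snd q \<le> 2 * fst q then (h (fst q))\<^sup>2 * fst q powr (-5/2) else 0)" for q :: "real \<times> real"
  define f2 where "f2 q = (if 1 \<le> fst q \<and> fst q \<le> snd q \<and> snd q \<le> 2 * fst q then (h (snd q))\<^sup>2 * fst q powr (-5/2) else 0)" for q :: "real \<times> real"
  have [measurable]: "f1 \<in> borel_measurable borel" "f2 \<in> borel_measurable borel" unfolding f1_def f2_def by measurable
  have 1: "ratio_energy h \<le> ennreal 2 * (\<integral>\<^sup>+q. ennreal (f1 q) \<partial>lborel) + ennreal 2 * (\<integral>\<^sup>+q. ennreal (f2 q) \<partial>lborel)"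
    unfolding ratio_energy_def
  proof (rule nn_integral_le_lincomb)
    fix q :: "real \<times> real"
    have "(h (snd q) - h (fst q))\<^sup>2 \<le> 2 * (h (fst q))\<^sup>2 + 2 * (h (snd q))\<^sup>2"
      using zero_le_power2[of "h (snd q) + h (fst q)"] by (simp add: power2_eq_square algebra_simps)
    then have "(h (snd q) - h (fst q))\<^sup>2 * fst q powr (-5/2) \<le> (2 * (h (fst q))\<^sup>2 + 2 * (h (snd q))\<^sup>2) * fst q powr (-5/2)"
      by (rule mult_right_mono) simp
    then show "(if 1 \<le> fst q \<and> fst q \<le> snd q \<and> snd q \<le> 2 * fst q
         then (h (snd q) - h (fst q))\<^sup>2 * fst q powr (-5/2) else 0) \<le> 2 * f1 q + 2 * f2 q"
      by (simp add: f1_def f2_def algebra_simps)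
    show "f1 q \<ge> 0" "f2 q \<ge> 0" by (simp_all add: f1_def f2_def)
  qed simp_all
  have 2: "(\<integral>\<^sup>+q. ennreal (f1 q) \<partial>lborel) \<le> tail_energy h 0"
  proof -
    have "(\<integral>\<^sup>+q. ennreal (f1 q) \<partial>lborel) = (\<integral>\<^sup>+x. \<integral>\<^sup>+u. ennreal (if 1 \<le> x \<and> x \<le> u \<and> u \<le> 2 * x then (h x)\<^sup>2 * x powr (-5/2) else 0) \<partial>lborel \<partial>lborel)"
      unfolding f1_def by (rule nn_integral_pair(1)) measurable
    also have "\<dots> \<le> tail_energy h 0" unfolding tail_energy_def
    proof (rule nn_integral_mono)
      fix x :: real
      show "(\<integral>\<^sup>+u. ennreal (if 1 \<le> x \<and> x \<le> u \<and> u \<le> 2 * x then (h x)\<^sup>2 * x powr (-5/2) else 0) \<partial>lborel)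
         \<le> ennreal (if 1 \<le> x then (h x - 0)\<^sup>2 * x powr (-3/2) else 0)"
      proof (cases "1 \<le> x")
        case True
        then have "x powr (-5/2) * (2 * x - x) = x powr (-3/2)" using powr_add[of x "-5/2" 1] by simp
        then show ?thesis using True nn_integral_interval_const[of x "2 * x" "(h x)\<^sup>2 * x powr (-5/2)"] by (simp add: mult.assoc)
      qed simp
    qed
    finally show ?thesis .
  qed
  have 3: "(\<integral>\<^sup>+q. ennreal (f2 q) \<partial>lborel) \<le> ennreal 3 * tail_energy h 0"
  proof -
    have "(\<integral>\<^sup>+q. ennreal (f2 q) \<partial>lborel) = (\<integral>\<^sup>+u. \<integral>\<^sup>+x. ennreal (if 1 \<le> x \<and> x \<le> u \<and> u \<le> 2 * x then (h u)\<^sup>2 * x powr (-5/2) else 0) \<partial>lborel \<partial>lborel)"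
      unfolding f2_def by (rule nn_integral_pair(2)) measurable
    also have "\<dots> \<le> (\<integral>\<^sup>+u. ennreal 3 * ennreal (if 1 \<le> u then (h u - 0)\<^sup>2 * u powr (-3/2) else 0) \<partial>lborel)"
    proof (rule nn_integral_mono)
      fix u :: real
      show "(\<integral>\<^sup>+x. ennreal (if 1 \<le> x \<and> x \<le> u \<and> u \<le> 2 * x then (h u)\<^sup>2 * x powr (-5/2) else 0) \<partial>lborel)
         \<le> ennreal 3 * ennreal (if 1 \<le> u then (h u - 0)\<^sup>2 * u powr (-3/2) else 0)"
      proof (cases "1 \<le> u")
        case True
        have "(\<integral>\<^sup>+x. ennreal (if 1 \<le> x \<and> x \<le> u \<and> u \<le> 2 * x then (h u)\<^sup>2 * x powr (-5/2) else 0) \<partial>lborel)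
          \<le> (\<integral>\<^sup>+x. ennreal (if u / 2 \<le> x \<and> x \<le> u then (h u)\<^sup>2 * (u / 2) powr (-5/2) else 0) \<partial>lborel)"
        proof (intro nn_integral_mono ennreal_leI)
          fix x
          have "x powr (-5/2) \<le> (u / 2) powr (-5/2)" if "u / 2 \<le> x" using that True by (intro powr_mono2') auto
          then have "(h u)\<^sup>2 * x powr (-5/2) \<le> (h u)\<^sup>2 * (u / 2) powr (-5/2)" if "u / 2 \<le> x" using that by (intro mult_left_mono) auto
          then show "(if 1 \<le> x \<and> x \<le> u \<and> u \<le> 2 * x then (h u)\<^sup>2 * x powr (-5/2) else 0)
            \<le> (if u / 2 \<le> x \<and> x \<le> u then (h u)\<^sup>2 * (u / 2) powr (-5/2) else 0)" by simp
        qed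
        also have "\<dots> = ennreal ((h u)\<^sup>2 * (u / 2) powr (-5/2) * (u - u / 2))"
          using True by (intro nn_integral_interval_const) auto
        also have "\<dots> \<le> ennreal (3 * ((h u)\<^sup>2 * u powr (-3/2)))"
        proof (rule ennreal_leI)
          have "(u / 2) powr (-5/2) * (u / 2) = (u / 2) powr (-3/2)" using True powr_add[of "u / 2" "-5/2" 1] by simp
          also have "\<dots> = 2 powr (3/2) * u powr (-3/2)" using True by (simp add: powr_divide powr_minus field_simps)
          also have "\<dots> \<le> 3 * u powr (-3/2)" using two_powr_bounds(2) by (intro mult_right_mono) auto
          finally have "(h u)\<^sup>2 * ((u / 2) powr (-5/2) * (u / 2)) \<le> (h u)\<^sup>2 * (3 * u powr (-3/2))" by (rule mult_left_mono) simp
          then show "(h u)\<^sup>2 * (u / 2) powr (-5/2) * (u - u / 2) \<le> 3 * ((h u)\<^sup>2 * u powr (-3/2))" by (simp add: mult_ac)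
        qed
        finally show ?thesis using True by (simp add: ennreal_mult)
      next
        case False
        then have "(if 1 \<le> x \<and> x \<le> u \<and> u \<le> 2 * x then (h u)\<^sup>2 * x powr (-5/2) else 0) = 0" for x by auto
        then show ?thesis by simp
      qed
    qed
    also have "\<dots> = ennreal 3 * tail_energy h 0" unfolding tail_energy_def by (rule nn_integral_cmult) measurable
    finally show ?thesis .
  qed
  from 1 have "ratio_energy h \<le> ennreal 2 * (\<integral>\<^sup>+q. ennreal (f1 q) \<partial>lborel) + ennreal 2 * (\<integral>\<^sup>+q. ennreal (f2 q) \<partial>lborel)" .
  also have "ennreal 2 * (\<integral>\<^sup>+q. ennreal (f1 q) \<partial>lborel) + ennreal 2 * (\<integral>\<^sup>+q. ennreal (f2 q) \<partial>lborel)
      \<le> ennreal 2 * tail_energy h 0 + ennreal 2 * (ennreal 3 * tail_energy h 0)"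
    by (intro add_mono mult_left_mono 2 3) auto
  also have "\<dots> < \<infinity>" using fin by (simp add: ennreal_mult_less_top)
  finally show ?thesis .
qed

text \<open>From \<open>2 e = e' - T\<close>, where \<open>e'\<close> is the increment along the sheared pair and \<open>T\<close> the doubling defect, follows
\<open>4 e\<^sup>2 \<le> (5/4) e'\<^sup>2 + 5 T\<^sup>2\<close>. After integration the \<open>e'\<close> term is at most \<open>(5/4) \<cdot> 2.83 < 4\<close> times the ratio
energy, so it can be absorbed; the remaining factor is \<open>5 / (4 - 3.5375) \<le> 11\<close>, and \<open>198 = 11 \<cdot> 18\<close>.\<close>

lemma ratio_energy_bound:
  assumes mu: "\<mu> \<ge> 0" and fin: "tail_energy h 0 < \<infinity>"
  shows "ratio_energy h \<le> ennreal (198 * (4 + \<mu>) ^ 4) * total_energy \<mu> h"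
proof -
  define in_cone where "in_cone q \<longleftrightarrow> 1 \<le> fst q \<and> fst q \<le> snd q \<and> snd q \<le> 2 * fst q" for q :: "real \<times> real"
  have [measurable]: "Measurable.pred borel in_cone" unfolding in_cone_def by measurable
  define F' where "F' q = (if in_cone q then (h (3 * snd q - 2 * fst q) - h (snd q))\<^sup>2 * fst q powr (-5/2) else 0)" for q
  define E where "E q = (if in_cone q then (doubling_defect h (fst q) (snd q))\<^sup>2 * fst q powr (-5/2) else 0)" for q
  have [measurable]: "F' \<in> borel_measurable borel" "E \<in> borel_measurable borel"
    unfolding F'_def E_def doubling_defect_def by measurable
  have "ennreal 4 * ratio_energy h = (\<integral>\<^sup>+q. ennreal 4 * ennreal (if in_cone q then (h (snd q) - h (fst q))\<^sup>2 * fst q powr (-5/2) else 0) \<partial>lborel)"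
    unfolding ratio_energy_def in_cone_def by (rule nn_integral_cmult[symmetric]) measurable
  also have "\<dots> = (\<integral>\<^sup>+q. ennreal (4 * (if in_cone q then (h (snd q) - h (fst q))\<^sup>2 * fst q powr (-5/2) else 0)) \<partial>lborel)"
    by (intro nn_integral_cong ennreal_mult[symmetric]) auto
  also have "\<dots> \<le> ennreal (5/4) * (\<integral>\<^sup>+q. ennreal (F' q) \<partial>lborel) + ennreal 5 * (\<integral>\<^sup>+q. ennreal (E q) \<partial>lborel)"
  proof (rule nn_integral_le_lincomb)
    fix q :: "real \<times> real"
    define e e' T where "e = h (snd q) - h (fst q)" "e' = h (3 * snd q - 2 * fst q) - h (snd q)" "T = doubling_defect h (fst q) (snd q)"
    have T: "T = e' - 2 * e" by (simp add: e_e'_T_def doubling_defect_def)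
    (* Young inequality for 4 e\<^sup>2 = (e' - T)\<^sup>2 with weights 5/4 and 5 *)
    have "0 \<le> (e' / 2 + 2 * T)\<^sup>2" by simp
    then have "4 * e\<^sup>2 \<le> 5/4 * e'\<^sup>2 + 5 * T\<^sup>2"
      unfolding T by (simp add: power2_eq_square algebra_simps)
    then have "4 * e\<^sup>2 * fst q powr (-5/2) \<le> (5/4 * e'\<^sup>2 + 5 * T\<^sup>2) * fst q powr (-5/2)" by (rule mult_right_mono) simp
    then show "4 * (if in_cone q then (h (snd q) - h (fst q))\<^sup>2 * fst q powr (-5/2) else 0) \<le> 5/4 * F' q + 5 * E q"
      by (simp add: F'_def E_def e_e'_T_def algebra_simps)
    show "F' q \<ge> 0" "E q \<ge> 0" by (simp_all add: F'_def E_def)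
  qed simp_all
  finally have 1: "ennreal 4 * ratio_energy h \<le> ennreal (5/4) * (\<integral>\<^sup>+q. ennreal (F' q) \<partial>lborel) + ennreal 5 * (\<integral>\<^sup>+q. ennreal (E q) \<partial>lborel)" .
  have 2: "2 * (\<integral>\<^sup>+q. ennreal (F' q) \<partial>lborel) \<le> ennreal (566/100) * ratio_energy h"
    using ratio_energy_sheared unfolding F'_def in_cone_def .
  have 3: "(\<integral>\<^sup>+q. ennreal (E q) \<partial>lborel) \<le> ennreal (18 * (4 + \<mu>) ^ 4) * total_energy \<mu> h"
    using doubling_defect_bound[OF mu h] unfolding E_def in_cone_def .
  obtain n where n: "ratio_energy h = ennreal n" "n \<ge> 0"
    using ratio_energy_finite[OF fin] by (cases "ratio_energy h") auto
  have C: "18 * (4 + \<mu>) ^ 4 > 0" using mu by simp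
  show ?thesis
  proof (cases "total_energy \<mu> h")
    case top
    then show ?thesis using C by (simp add: ennreal_mult_eq_top_iff ennreal_mult_top)
  next
    case (real q)
    obtain f where f: "(\<integral>\<^sup>+q. ennreal (F' q) \<partial>lborel) = ennreal f" "f \<ge> 0"
    proof (cases "\<integral>\<^sup>+q. ennreal (F' q) \<partial>lborel")
      case top
      then have "2 * (top::ennreal) \<le> ennreal (566/100) * ennreal n" using 2 n by simp
      then show ?thesis by (simp add: ennreal_mult[symmetric] n ennreal_mult_top top_unique)
    qed (use that in auto)
    have "ennreal (18 * (4 + \<mu>) ^ 4) * total_energy \<mu> h = ennreal (18 * (4 + \<mu>) ^ 4 * q)"
      using C real by (simp add: ennreal_mult)
    with 3 obtain e where e: "(\<integral>\<^sup>+q. ennreal (E q) \<partial>lborel) = ennreal e" "e \<ge> 0" "e \<le> 18 * (4 + \<mu>) ^ 4 * q"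
      using C real by (cases "\<integral>\<^sup>+q. ennreal (E q) \<partial>lborel") (auto simp: ennreal_le_iff top_unique)
    have "4 * n \<le> 5/4 * f + 5 * e"
      using 1 n f e by (intro ennreal_lincomb_leD) auto
    moreover have "2 * f \<le> 566/100 * n + 0 * 0"
      using 2 n f by (intro ennreal_lincomb_leD) auto
    ultimately have "n \<le> 11 * e" using n by simp
    then have "n \<le> 198 * (4 + \<mu>) ^ 4 * q" using e by simp
    then have "ennreal n \<le> ennreal (198 * (4 + \<mu>) ^ 4 * q)" by (rule ennreal_leI)
    then show ?thesis using n real mu by (simp add: ennreal_mult)
  qed
qed

text \<open>Constants have finite tail energy since \<open>x\<^bsup>-3/2\<^esup>\<close> is integrable at infinity.\<close>

lemma tail_energy_finite:
  assumes fin: "tail_energy h 0 < \<infinity>"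
  shows "tail_energy h c < \<infinity>"
proof -
  have one: "(\<integral>\<^sup>+x. ennreal (indicator {1..} x * x powr (-3/2)) \<partial>lborel) = ennreal 2"
    using nn_integral_has_integral_lebesgue[OF _ has_integral_powr_to_inf[of "-3/2" 1]] by simp
  have "tail_energy h c \<le> ennreal 2 * tail_energy h 0 + ennreal (2 * c\<^sup>2) * (\<integral>\<^sup>+x. ennreal (indicator {1..} x * x powr (-3/2)) \<partial>lborel)"
    unfolding tail_energy_def
  proof (rule nn_integral_le_lincomb)
    fix x :: real
    have "(h x - c)\<^sup>2 \<le> 2 * (h x)\<^sup>2 + 2 * c\<^sup>2"
      using zero_le_power2[of "h x + c"] by (simp add: power2_eq_square algebra_simps)
    then have "(h x - c)\<^sup>2 * x powr (-3/2) \<le> (2 * (h x)\<^sup>2 + 2 * c\<^sup>2) * x powr (-3/2)" by (rule mult_right_mono) simp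
    then show "(if 1 \<le> x then (h x - c)\<^sup>2 * x powr (-3/2) else 0)
        \<le> 2 * (if 1 \<le> x then (h x - 0)\<^sup>2 * x powr (-3/2) else 0) + 2 * c\<^sup>2 * (indicator {1..} x * x powr (-3/2))"
      by (simp add: algebra_simps)
  qed auto
  also have "\<dots> < \<infinity>" using fin unfolding one by (simp add: ennreal_mult_less_top)
  finally show ?thesis .
qed

text \<open>Compare \<open>h(u)\<close> with \<open>h(x)\<close> for \<open>7/4 \<le> u/x \<le> 2\<close>. Averaged over the pairs, the tail beyond \<open>2\<close>, seen through
\<open>u\<close>, receives at least the factor \<open>(7/4)\<^bsup>3/2\<^esup> / 8 \<ge> 0.2875\<close>, whereas the full tail, seen through \<open>x\<close>,
receives \<open>1/4\<close>, because dilation by \<open>s\<close> multiplies the weighted norm by a positive power of \<open>s\<close>. With the splitting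
\<open>(r + e)\<^sup>2 \<le> 1.1 r\<^sup>2 + 11 e\<^sup>2\<close> the second factor becomes \<open>0.275\<close>, still below the first, and the tail can be absorbed:
\<open>23 = 0.2875 / 0.0125\<close> and \<open>880 = 11 / 0.0125\<close>.\<close>

lemma tail_energy_bound:
  assumes fin: "tail_energy h 0 < \<infinity>"
  shows "tail_energy h c \<le> ennreal 23 * base_energy h c + ennreal 880 * ratio_energy h"
proof -
  define f2 where "f2 q = (if 1 \<le> fst q \<and> 7/4 * fst q \<le> snd q \<and> snd q \<le> 2 * fst q then (h (snd q) - c)\<^sup>2 * fst q powr (-5/2) else 0)" for q :: "real \<times> real"
  define f1 where "f1 q = (if 1 \<le> fst q \<and> 7/4 * fst q \<le> snd q \<and> snd q \<le> 2 * fst q then (h (fst q) - c)\<^sup>2 * fst q powr (-5/2) else 0)" for q :: "real \<times> real"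
  define P2 where "P2 = (\<integral>\<^sup>+u. ennreal (if 2 \<le> u then (h u - c)\<^sup>2 * u powr (-3/2) else 0) \<partial>lborel)"
  have [measurable]: "f1 \<in> borel_measurable borel" "f2 \<in> borel_measurable borel" unfolding f1_def f2_def by measurable
  have low: "ennreal (2875/10000) * P2 \<le> (\<integral>\<^sup>+q. ennreal (f2 q) \<partial>lborel)"
  proof -
    have "ennreal (2875/10000) * P2 = (\<integral>\<^sup>+u. ennreal (2875/10000) * ennreal (if 2 \<le> u then (h u - c)\<^sup>2 * u powr (-3/2) else 0) \<partial>lborel)"
      unfolding P2_def by (rule nn_integral_cmult[symmetric]) measurable
    also have "\<dots> \<le> (\<integral>\<^sup>+u. \<integral>\<^sup>+x. ennreal (if 1 \<le> x \<and> 7/4 * x \<le> u \<and> u \<le> 2 * x then (h u - c)\<^sup>2 * x powr (-5/2) else 0) \<partial>lborel \<partial>lborel)"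
    proof (rule nn_integral_mono)
      fix u :: real
      show "ennreal (2875/10000) * ennreal (if 2 \<le> u then (h u - c)\<^sup>2 * u powr (-3/2) else 0)
        \<le> (\<integral>\<^sup>+x. ennreal (if 1 \<le> x \<and> 7/4 * x \<le> u \<and> u \<le> 2 * x then (h u - c)\<^sup>2 * x powr (-5/2) else 0) \<partial>lborel)"
      proof (cases "2 \<le> u")
        case True
        have "ennreal (2875/10000) * ennreal ((h u - c)\<^sup>2 * u powr (-3/2)) = ennreal (2875/10000 * ((h u - c)\<^sup>2 * u powr (-3/2)))"
          by (rule ennreal_mult[symmetric]) auto
        also have "\<dots> \<le> ennreal ((h u - c)\<^sup>2 * (4/7 * u) powr (-5/2) * (4/7 * u - u / 2))"
        proof (rule ennreal_leI)
          define w where "w = 4/7 * u"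
          have w: "w > 0" "w - u / 2 = w / 8" using True by (simp_all add: w_def)
          have "w powr (-5/2) * (w - u / 2) = w powr (-5/2) * w / 8" using w by simp
          also have "w powr (-5/2) * w = w powr (-3/2)" using w powr_add[of w "-5/2" 1] by simp
          also have "w powr (-3/2) = (7/4) powr (3/2) * u powr (-3/2)"
            using True by (simp add: w_def powr_mult powr_minus powr_divide field_simps)
          finally have "(4/7 * u) powr (-5/2) * (4/7 * u - u / 2) = (7/4) powr (3/2) / 8 * u powr (-3/2)"
            unfolding w_def by simp
          moreover have "2875/10000 * u powr (-3/2) \<le> (7/4) powr (3/2) / 8 * u powr (-3/2)"
            using two_powr_bounds(4) by (intro mult_right_mono) auto
          ultimately have "2875/10000 * u powr (-3/2) \<le> (4/7 * u) powr (-5/2) * (4/7 * u - u / 2)"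
            by (simp only:)
          then have "(h u - c)\<^sup>2 * (2875/10000 * u powr (-3/2)) \<le> (h u - c)\<^sup>2 * ((4/7 * u) powr (-5/2) * (4/7 * u - u / 2))"
            by (rule mult_left_mono) simp
          then show "2875/10000 * ((h u - c)\<^sup>2 * u powr (-3/2)) \<le> (h u - c)\<^sup>2 * (4/7 * u) powr (-5/2) * (4/7 * u - u / 2)"
            by (simp only: mult_ac)
        qed
        also have "\<dots> = (\<integral>\<^sup>+x. ennreal (if u / 2 \<le> x \<and> x \<le> 4/7 * u then (h u - c)\<^sup>2 * (4/7 * u) powr (-5/2) else 0) \<partial>lborel)"
          using True by (intro nn_integral_interval_const[symmetric]) auto
        also have "\<dots> \<le> (\<integral>\<^sup>+x. ennreal (if 1 \<le> x \<and> 7/4 * x \<le> u \<and> u \<le> 2 * x then (h u - c)\<^sup>2 * x powr (-5/2) else 0) \<partial>lborel)"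
        proof (intro nn_integral_mono ennreal_leI)
          fix x
          have "(4/7 * u) powr (-5/2) \<le> x powr (-5/2)" if "u / 2 \<le> x" "x \<le> 4/7 * u" using that True by (intro powr_mono2') auto
          then have "(h u - c)\<^sup>2 * (4/7 * u) powr (-5/2) \<le> (h u - c)\<^sup>2 * x powr (-5/2)" if "u / 2 \<le> x" "x \<le> 4/7 * u" using that by (intro mult_left_mono) auto
          then show "(if u / 2 \<le> x \<and> x \<le> 4/7 * u then (h u - c)\<^sup>2 * (4/7 * u) powr (-5/2) else 0)
            \<le> (if 1 \<le> x \<and> 7/4 * x \<le> u \<and> u \<le> 2 * x then (h u - c)\<^sup>2 * x powr (-5/2) else 0)" using True by simp
        qed
        finally show ?thesis using True by simp
      qed simp
    qed
    also have "\<dots> = (\<integral>\<^sup>+q. ennreal (f2 q) \<partial>lborel)"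
      unfolding f2_def by (rule nn_integral_pair(2)[symmetric]) measurable
    finally show ?thesis .
  qed
  have up: "(\<integral>\<^sup>+q. ennreal (f2 q) \<partial>lborel) \<le> ennreal (11/10) * (\<integral>\<^sup>+q. ennreal (f1 q) \<partial>lborel) + ennreal 11 * ratio_energy h"
    unfolding ratio_energy_def
  proof (rule nn_integral_le_lincomb)
    fix q :: "real \<times> real"
    define r e where "r = h (fst q) - c" "e = h (snd q) - h (fst q)"
    (* Young inequality with weights 11/10 and 11 *)
    have "0 \<le> (r - 10 * e)\<^sup>2" by simp
    then have "(r + e)\<^sup>2 \<le> 11/10 * r\<^sup>2 + 11 * e\<^sup>2" by (simp add: power2_eq_square algebra_simps)
    then have "(r + e)\<^sup>2 * fst q powr (-5/2) \<le> (11/10 * r\<^sup>2 + 11 * e\<^sup>2) * fst q powr (-5/2)" by (rule mult_right_mono) simp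
    then have "(h (snd q) - c)\<^sup>2 * fst q powr (-5/2) \<le> 11/10 * ((h (fst q) - c)\<^sup>2 * fst q powr (-5/2)) + 11 * (e\<^sup>2 * fst q powr (-5/2))"
      by (simp add: r_e_def distrib_right)
    then show "f2 q \<le> 11/10 * f1 q + 11 * (if 1 \<le> fst q \<and> fst q \<le> snd q \<and> snd q \<le> 2 * fst q
         then (h (snd q) - h (fst q))\<^sup>2 * fst q powr (-5/2) else 0)"
      unfolding r_e_def(2) by (simp add: f1_def f2_def)
    show "f1 q \<ge> 0" by (simp add: f1_def)
  qed simp_all
  have f1: "(\<integral>\<^sup>+q. ennreal (f1 q) \<partial>lborel) = ennreal (1/4) * tail_energy h c"
  proof -
    have "(\<integral>\<^sup>+q. ennreal (f1 q) \<partial>lborel) = (\<integral>\<^sup>+x. \<integral>\<^sup>+u. ennreal (if 1 \<le> x \<and> 7/4 * x \<le> u \<and> u \<le> 2 * x then (h x - c)\<^sup>2 * x powr (-5/2) else 0) \<partial>lborel \<partial>lborel)"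
      unfolding f1_def by (rule nn_integral_pair(1)) measurable
    also have "\<dots> = (\<integral>\<^sup>+x. ennreal (1/4) * ennreal (if 1 \<le> x then (h x - c)\<^sup>2 * x powr (-3/2) else 0) \<partial>lborel)"
    proof (rule nn_integral_cong)
      fix x :: real
      show "(\<integral>\<^sup>+u. ennreal (if 1 \<le> x \<and> 7/4 * x \<le> u \<and> u \<le> 2 * x then (h x - c)\<^sup>2 * x powr (-5/2) else 0) \<partial>lborel)
        = ennreal (1/4) * ennreal (if 1 \<le> x then (h x - c)\<^sup>2 * x powr (-3/2) else 0)"
      proof (cases "1 \<le> x")
        case True
        define y where "y = (h x - c)\<^sup>2"
        have y: "y \<ge> 0" by (simp add: y_def)
        have "y * x powr (-5/2) * (2 * x - 7/4 * x) = 1/4 * (y * (x powr (-5/2) * x))" by simp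
        also have "x powr (-5/2) * x = x powr (-3/2)" using True powr_add[of x "-5/2" 1] by simp
        finally have "ennreal (y * x powr (-5/2) * (2 * x - 7/4 * x)) = ennreal (1/4 * (y * x powr (-3/2)))" by (simp only:)
        also have "\<dots> = ennreal (1/4) * ennreal (y * x powr (-3/2))" using y by (intro ennreal_mult) auto
        finally have "ennreal (y * x powr (-5/2) * (2 * x - 7/4 * x)) = ennreal (1/4) * ennreal (y * x powr (-3/2))" .
        moreover have "(\<integral>\<^sup>+u. ennreal (if 7/4 * x \<le> u \<and> u \<le> 2 * x then y * x powr (-5/2) else 0) \<partial>lborel)
          = ennreal (y * x powr (-5/2) * (2 * x - 7/4 * x))"
          using True y by (intro nn_integral_interval_const) auto
        ultimately show ?thesis unfolding y_def by (simp only: True simp_thms if_True)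
      qed simp
    qed
    also have "\<dots> = ennreal (1/4) * tail_energy h c" unfolding tail_energy_def by (rule nn_integral_cmult) measurable
    finally show ?thesis .
  qed
  have split: "tail_energy h c \<le> ennreal 1 * base_energy h c + ennreal 1 * P2"
    unfolding tail_energy_def base_energy_def P2_def by (rule nn_integral_le_lincomb) auto
  obtain p where p: "tail_energy h c = ennreal p" "p \<ge> 0" using tail_energy_finite[OF fin, of c] by (cases "tail_energy h c") auto
  obtain n where n: "ratio_energy h = ennreal n" "n \<ge> 0" using ratio_energy_finite[OF fin] by (cases "ratio_energy h") auto
  have "base_energy h c \<le> tail_energy h c" unfolding base_energy_def tail_energy_def by (intro nn_integral_mono) auto
  then obtain a where a: "base_energy h c = ennreal a" "a \<ge> 0" using p by (cases "base_energy h c") (auto simp: top_unique)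
  have "P2 \<le> tail_energy h c" unfolding P2_def tail_energy_def by (intro nn_integral_mono) auto
  then obtain p2 where p2: "P2 = ennreal p2" "p2 \<ge> 0" using p by (cases P2) (auto simp: top_unique)
  have F: "(\<integral>\<^sup>+q. ennreal (f1 q) \<partial>lborel) = ennreal (1/4 * p)"
    unfolding f1 p(1) using p(2) by (intro ennreal_mult[symmetric]) auto
  have "2875/10000 * p2 \<le> 11/10 * (1/4 * p) + 11 * n"
    using order_trans[OF low up] F p p2 n by (intro ennreal_lincomb_leD) auto
  moreover have "1 * p \<le> 1 * a + 1 * p2"
    using split p p2 a by (intro ennreal_lincomb_leD) auto
  ultimately have "p \<le> 23 * a + 880 * n" by simp
  then show ?thesis unfolding p a n by (rule ennreal_lincombI) (use p a n in auto)
qed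

text \<open>For \<open>s\<close> and \<open>x\<close> in \<open>[1,2]\<close> one of the pairs \<open>(s,x)\<close> and \<open>(x,s)\<close> lies in the cone, and the weights are comparable up
to the factor \<open>2\<^bsup>5/2\<^esup> \<le> 6\<close>. So the value \<open>c = h(s)\<close> is good on average.\<close>

lemma base_energy_average:
  "(\<integral>\<^sup>+s. ennreal (indicator {1..2} s) * base_energy h (h s) \<partial>lborel) \<le> ennreal 12 * ratio_energy h"
proof -
  define R where "R x u = (if 1 \<le> x \<and> x \<le> u \<and> u \<le> 2 * x then (h u - h x)\<^sup>2 * x powr (-5/2) else 0)" for x u
  have mR: "(\<lambda>q. ennreal (R (fst q) (snd q))) \<in> borel_measurable (borel :: (real \<times> real) measure)"
    "(\<lambda>q. ennreal (R (snd q) (fst q))) \<in> borel_measurable (borel :: (real \<times> real) measure)"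
    unfolding R_def by measurable
  have [measurable]: "(\<lambda>q. R (fst q) (snd q)) \<in> borel_measurable (borel :: (real \<times> real) measure)"
    "(\<lambda>q. R (snd q) (fst q)) \<in> borel_measurable (borel :: (real \<times> real) measure)"
    unfolding R_def by measurable
  have R: "(\<integral>\<^sup>+q. ennreal (R (fst q) (snd q)) \<partial>lborel) = ratio_energy h" by (simp add: R_def ratio_energy_def)
  have R': "(\<integral>\<^sup>+q. ennreal (R (snd q) (fst q)) \<partial>lborel) = ratio_energy h"
    using nn_integral_pair(2)[OF mR(2)] nn_integral_pair(1)[OF mR(1)] R by simp
  define b where "b s x = (if 1 \<le> s \<and> s \<le> 2 \<and> 1 \<le> x \<and> x \<le> 2 then (h x - h s)\<^sup>2 * x powr (-3/2) else 0)" for s x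
  have "(\<integral>\<^sup>+s. ennreal (indicator {1..2} s) * base_energy h (h s) \<partial>lborel) = (\<integral>\<^sup>+s. \<integral>\<^sup>+x. ennreal (b s x) \<partial>lborel \<partial>lborel)"
  proof (rule nn_integral_cong)
    fix s
    show "ennreal (indicator {1..2} s) * base_energy h (h s) = (\<integral>\<^sup>+x. ennreal (b s x) \<partial>lborel)"
      by (cases "1 \<le> s \<and> s \<le> 2") (auto simp: b_def base_energy_def indicator_def cong: if_cong)
  qed
  also have "\<dots> = (\<integral>\<^sup>+q. ennreal (b (fst q) (snd q)) \<partial>lborel)"
    unfolding b_def by (rule nn_integral_pair(1)[symmetric]) measurable
  also have "\<dots> \<le> ennreal 6 * (\<integral>\<^sup>+q. ennreal (R (fst q) (snd q)) \<partial>lborel) + ennreal 6 * (\<integral>\<^sup>+q. ennreal (R (snd q) (fst q)) \<partial>lborel)"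
  proof (rule nn_integral_le_lincomb)
    fix q :: "real \<times> real"
    have k: "b s x \<le> 6 * R s x" if "s \<le> x" for s x
    proof (cases "1 \<le> s \<and> x \<le> 2")
      case True
      have "x powr (-3/2) \<le> 1" using True that powr_mono2'[of "-3/2" 1 x] by simp
      moreover have "2 powr (-5/2) \<le> s powr (-5/2)" using True that by (intro powr_mono2') auto
      moreover have "1 \<le> 6 * (2::real) powr (-5/2)" using two_powr_bounds(1) by (simp add: powr_minus field_simps)
      ultimately have "x powr (-3/2) \<le> 6 * s powr (-5/2)" by linarith
      then have "(h x - h s)\<^sup>2 * x powr (-3/2) \<le> (h x - h s)\<^sup>2 * (6 * s powr (-5/2))" by (rule mult_left_mono) simp
      then show ?thesis using True that by (simp add: b_def R_def)
    qed (use that in \<open>auto simp: b_def R_def\<close>)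
    have k': "b s x \<le> 6 * R x s" if "x \<le> s" for s x
    proof (cases "1 \<le> x \<and> s \<le> 2")
      case True
      have "2 powr (-5/2) \<le> x powr (-5/2)" using True that by (intro powr_mono2') auto
      moreover have "x powr (-3/2) \<le> 1" using True that powr_mono2'[of "-3/2" 1 x] by simp
      moreover have "1 \<le> 6 * (2::real) powr (-5/2)" using two_powr_bounds(1) by (simp add: powr_minus field_simps)
      ultimately have "x powr (-3/2) \<le> 6 * x powr (-5/2)" by linarith
      then have "(h s - h x)\<^sup>2 * x powr (-3/2) \<le> (h s - h x)\<^sup>2 * (6 * x powr (-5/2))" by (rule mult_left_mono) simp
      then show ?thesis using True that by (simp add: b_def R_def power2_commute)
    qed (use that in \<open>auto simp: b_def R_def\<close>)
    have "R s x \<ge> 0" for s x by (simp add: R_def)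
    then show "b (fst q) (snd q) \<le> 6 * R (fst q) (snd q) + 6 * R (snd q) (fst q)"
      using k[of "fst q" "snd q"] k'[of "snd q" "fst q"] by (cases "fst q \<le> snd q") (auto intro: order_trans)
  qed (auto simp: R_def)
  also have "\<dots> = ennreal 12 * ratio_energy h"
    unfolding R R' by (simp add: distrib_right[symmetric] ennreal_plus[symmetric] del: ennreal_plus)
  finally show ?thesis .
qed

end

section \<open>Small frequencies and the spectral gap\<close>

lemma coll_density_small_frequency_lower:
  assumes mu: "\<mu> \<ge> 0" and x: "0 < x" "x \<le> 1" and y: "2 \<le> y" "y \<le> 3" and z: "2 \<le> z" "z \<le> 3"
  shows "sqrt x \<le> (6 + \<mu>) ^ 4 * coll_density \<mu> (x, y, z)"
proof -
  have n: "1 \<le> (6 + \<mu>) * eq_n \<mu> w" if "0 < w" "w \<le> 6" for w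
    using that mu by (simp add: eq_n_def)
  have m1: "1 \<le> r * s" if "1 \<le> r" "1 \<le> s" for r s :: real
    using mult_mono[OF that] that by simp
  have "1 \<le> ((6 + \<mu>) * eq_n \<mu> x) * ((6 + \<mu>) * eq_n \<mu> y) * ((6 + \<mu>) * eq_n \<mu> z) * ((6 + \<mu>) * eq_n \<mu> (y + z - x))"
    using x y z by (intro m1 n) auto
  then have "sqrt x * 1 \<le> sqrt x * (((6 + \<mu>) * eq_n \<mu> x) * ((6 + \<mu>) * eq_n \<mu> y) * ((6 + \<mu>) * eq_n \<mu> z) * ((6 + \<mu>) * eq_n \<mu> (y + z - x)))"
    using x by (intro mult_left_mono) auto
  also have "\<dots> = (6 + \<mu>) ^ 4 * (sqrt x * (eq_n \<mu> x * eq_n \<mu> y * eq_n \<mu> z * eq_n \<mu> (y + z - x)))"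
    by (simp add: power4_eq_xxxx mult_ac)
  also have "min (min (sqrt x) (sqrt y)) (min (sqrt z) (sqrt (y + z - x))) = sqrt x"
    using x y z by (simp add: min_def)
  then have "sqrt x * (eq_n \<mu> x * eq_n \<mu> y * eq_n \<mu> z * eq_n \<mu> (y + z - x)) = coll_density \<mu> (x, y, z)"
    using x y z by (simp add: coll_density_eq)
  finally show ?thesis by simp
qed

definition small_box :: "real \<Rightarrow> real \<Rightarrow> real \<Rightarrow> bool" where
  "small_box x y z \<longleftrightarrow> 0 < x \<and> x \<le> 1 \<and> 2 \<le> y \<and> y \<le> 3 \<and> 2 \<le> z \<and> z \<le> 3"

lemma measurable_small_box [measurable]:
  assumes [measurable]: "f \<in> borel_measurable M" "g \<in> borel_measurable M" "k \<in> borel_measurable M"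
  shows "Measurable.pred M (\<lambda>p. small_box (f p) (g p) (k p))"
  unfolding small_box_def by measurable

lemma nn_integral_unit_indicator: "(\<integral>\<^sup>+x. indicator {0<..1::real} x * (c::ennreal) \<partial>lborel) = c"
  "(\<integral>\<^sup>+x. indicator {2..3::real} x * (c::ennreal) \<partial>lborel) = c"
  by (simp_all add: nn_integral_multc)

text \<open>A frequency \<open>x \<le> 1\<close> collides with \<open>y\<close> and \<open>z\<close> in \<open>[2,3]\<close> and \<open>y + z - x\<close> in \<open>[3,6]\<close>. The defect expresses
\<open>h(x) - c\<close> by the three other values of \<open>h - c\<close>, all of them in the range of the tail energy, and the density
of these collisions is of order \<open>sqrt x\<close>.\<close>

lemma low_energy_bound:
  assumes mu: "\<mu> \<ge> 0" and h [measurable]: "h \<in> borel_measurable borel"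
  shows "low_energy h c \<le> ennreal (4 * (6 + \<mu>) ^ 4) * total_energy \<mu> h + ennreal 180 * tail_energy h c"
proof -
  define T where "T w = (if 1 \<le> w then (h w - c)\<^sup>2 * w powr (-3/2) else 0)" for w
  have [measurable]: "T \<in> borel_measurable borel" unfolding T_def by measurable
  have T0: "T w \<ge> 0" for w by (simp add: T_def)
  have tail: "tail_energy h c = (\<integral>\<^sup>+w. ennreal (T w) \<partial>lborel)" by (simp add: tail_energy_def T_def)
  have T: "(h w - c)\<^sup>2 \<le> 15 * T w" if "1 \<le> w" "w \<le> 6" for w
  proof -
    have "6 powr (-3/2) \<le> w powr (-3/2)" using that by (intro powr_mono2') auto
    moreover have "1 \<le> 15 * (6::real) powr (-3/2)" using two_powr_bounds(3) by (simp add: powr_minus field_simps)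
    ultimately have "1 \<le> 15 * w powr (-3/2)" by linarith
    then have "(h w - c)\<^sup>2 * 1 \<le> (h w - c)\<^sup>2 * (15 * w powr (-3/2))" by (rule mult_left_mono) simp
    then show ?thesis using that by (simp add: T_def)
  qed
  define ed where "ed p = energy_density \<mu> h (fst p) (fst (snd p)) (snd (snd p))" for p :: "real \<times> real \<times> real"
  define f where "f p = (if small_box (fst p) (fst (snd p)) (snd (snd p)) then (h (fst p) - c)\<^sup>2 * sqrt (fst p) else 0)" for p
  define g where "g p = (if small_box (fst p) (fst (snd p)) (snd (snd p)) then T (fst (snd p)) else 0)
    + ((if small_box (fst p) (fst (snd p)) (snd (snd p)) then T (snd (snd p)) else 0)
    + (if small_box (fst p) (fst (snd p)) (snd (snd p)) then T (freq3 p) else 0))" for p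
  have [measurable]: "ed \<in> borel_measurable borel" unfolding ed_def by (intro measurable_energy_density mu h; measurable)
  have [measurable]: "f \<in> borel_measurable borel" "g \<in> borel_measurable borel" unfolding f_def g_def by measurable
  have "low_energy h c = (\<integral>\<^sup>+p. ennreal (f p) \<partial>lborel)"
  proof -
    have "(\<integral>\<^sup>+y. \<integral>\<^sup>+z. ennreal (f (x, y, z)) \<partial>lborel \<partial>lborel) = ennreal (if 0 < x \<and> x \<le> 1 then (h x - c)\<^sup>2 * sqrt x else 0)" for x
    proof -
      define K where "K = (if 0 < x \<and> x \<le> 1 then (h x - c)\<^sup>2 * sqrt x else 0)"
      have "ennreal (f (x, y, z)) = indicator {2..3::real} z * (indicator {2..3::real} y * ennreal K)" for y z
        by (auto simp: f_def small_box_def K_def indicator_def)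
      then show ?thesis by (simp only: nn_integral_unit_indicator K_def)
    qed
    then show ?thesis unfolding low_energy_def by (subst nn_integral_lborel3(3)) simp_all
  qed
  also have "\<dots> \<le> ennreal (4 * (6 + \<mu>) ^ 4) * (\<integral>\<^sup>+p. ennreal (ed p) \<partial>lborel) + ennreal 60 * (\<integral>\<^sup>+p. ennreal (g p) \<partial>lborel)"
  proof (rule nn_integral_le_lincomb)
    fix p :: "real \<times> real \<times> real"
    obtain x y z where p: "p = (x, y, z)" by (cases p rule: prod_cases3)
    show "0 \<le> ed p" by (simp add: ed_def energy_density_nonneg[OF mu h])
    show "0 \<le> g p" using T0 by (simp add: g_def)
    show "f p \<le> 4 * (6 + \<mu>) ^ 4 * ed p + 60 * g p"
    proof (cases "small_box x y z")
      case True
      define d where "d = h x + h (y + z - x) - h y - h z"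
      define a1 a2 a3 where "a1 = h y - c" "a2 = h z - c" "a3 = h (y + z - x) - c"
      have b: "0 < x" "x \<le> 1" "2 \<le> y" "y \<le> 3" "2 \<le> z" "z \<le> 3" using True by (auto simp: small_box_def)
      have "(h x - c)\<^sup>2 = (d + a1 + a2 - a3)\<^sup>2" by (simp add: d_def a1_a2_a3_def)
      also have "\<dots> \<le> 4 * (d\<^sup>2 + a1\<^sup>2 + a2\<^sup>2 + a3\<^sup>2)"
      proof -
        have "0 \<le> (d - a1)\<^sup>2 + (d - a2)\<^sup>2 + (d + a3)\<^sup>2 + (a1 - a2)\<^sup>2 + (a1 + a3)\<^sup>2 + (a2 + a3)\<^sup>2" by simp
        then show ?thesis by (simp add: power2_eq_square algebra_simps)
      qed
      finally have "(h x - c)\<^sup>2 * sqrt x \<le> 4 * (d\<^sup>2 + a1\<^sup>2 + a2\<^sup>2 + a3\<^sup>2) * sqrt x"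
        using b by (intro mult_right_mono) auto
      also have "\<dots> = 4 * (d\<^sup>2 * sqrt x) + 4 * (a1\<^sup>2 + a2\<^sup>2 + a3\<^sup>2) * sqrt x" by (simp add: algebra_simps)
      also have "\<dots> \<le> 4 * (d\<^sup>2 * ((6 + \<mu>) ^ 4 * coll_density \<mu> (x, y, z))) + 4 * (15 * T y + 15 * T z + 15 * T (y + z - x)) * 1"
        using b T0 T[of y] T[of z] T[of "y + z - x"] coll_density_small_frequency_lower[OF mu b]
        by (intro add_mono mult_mono mult_left_mono) (auto simp: a1_a2_a3_def)
      also have "\<dots> = 4 * (6 + \<mu>) ^ 4 * ed p + 60 * g p"
        using True by (simp add: p ed_def g_def energy_density_def d_def freq3_def algebra_simps)
      finally show ?thesis using True by (simp add: f_def p)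
    next
      case False
      then show ?thesis using mu by (simp add: f_def g_def p ed_def energy_density_nonneg[OF mu h])
    qed
  qed (use mu in auto)
  also have "(\<integral>\<^sup>+p. ennreal (ed p) \<partial>lborel) = total_energy \<mu> h" by (simp add: ed_def total_energy_def)
  finally have 1: "low_energy h c \<le> ennreal (4 * (6 + \<mu>) ^ 4) * total_energy \<mu> h + ennreal 60 * (\<integral>\<^sup>+p. ennreal (g p) \<partial>lborel)" .
  have G: "(\<integral>\<^sup>+p. ennreal (if small_box (fst p) (fst (snd p)) (snd (snd p)) then T (X p) else 0) \<partial>lborel) \<le> tail_energy h c"
    if [measurable]: "X \<in> borel_measurable borel" and
      X: "\<And>x y. (\<integral>\<^sup>+z. ennreal (T (X (x, y, z))) \<partial>lborel) \<le> tail_energy h c" for X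
  proof -
    have "(\<integral>\<^sup>+p. ennreal (if small_box (fst p) (fst (snd p)) (snd (snd p)) then T (X p) else 0) \<partial>lborel)
      = (\<integral>\<^sup>+x. \<integral>\<^sup>+y. \<integral>\<^sup>+z. ennreal (if small_box x y z then T (X (x, y, z)) else 0) \<partial>lborel \<partial>lborel \<partial>lborel)"
      by (subst nn_integral_lborel3(3)) (simp_all cong: if_cong)
    also have "\<dots> \<le> (\<integral>\<^sup>+x. \<integral>\<^sup>+y. indicator {2..3::real} y * (indicator {0<..1::real} x * tail_energy h c) \<partial>lborel \<partial>lborel)"
    proof (intro nn_integral_mono)
      fix x y :: real
      show "(\<integral>\<^sup>+z. ennreal (if small_box x y z then T (X (x, y, z)) else 0) \<partial>lborel) \<le> indicator {2..3::real} y * (indicator {0<..1::real} x * tail_energy h c)"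
      proof (cases "x \<in> {0<..1} \<and> y \<in> {2..3}")
        case True
        have "(\<integral>\<^sup>+z. ennreal (if small_box x y z then T (X (x, y, z)) else 0) \<partial>lborel) \<le> (\<integral>\<^sup>+z. ennreal (T (X (x, y, z))) \<partial>lborel)"
          using T0 by (intro nn_integral_mono ennreal_leI) auto
        also have "\<dots> \<le> tail_energy h c" by (rule X)
        finally show ?thesis using True by simp
      next
        case False
        then have "\<not> small_box x y z" for z by (auto simp: small_box_def)
        then show ?thesis by simp
      qed
    qed
    also have "\<dots> = tail_energy h c" by (simp only: nn_integral_unit_indicator)
    finally show ?thesis .
  qed
  have G2: "(\<integral>\<^sup>+p. ennreal (if small_box (fst p) (fst (snd p)) (snd (snd p)) then T (snd (snd p)) else 0) \<partial>lborel) \<le> tail_energy h c"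
    by (rule G) (simp_all add: tail)
  have G3: "(\<integral>\<^sup>+p. ennreal (if small_box (fst p) (fst (snd p)) (snd (snd p)) then T (freq3 p) else 0) \<partial>lborel) \<le> tail_energy h c"
  proof (rule G)
    show "(\<integral>\<^sup>+z. ennreal (T (freq3 (x, y, z))) \<partial>lborel) \<le> tail_energy h c" for x y
      using nn_integral_shift[of "\<lambda>z. ennreal (T z)" "y - x"] by (simp add: tail freq3_def algebra_simps)
  qed simp
  have G1: "(\<integral>\<^sup>+p. ennreal (if small_box (fst p) (fst (snd p)) (snd (snd p)) then T (fst (snd p)) else 0) \<partial>lborel) \<le> tail_energy h c"
  proof -
    have [measurable]: "(\<lambda>p. ennreal (if small_box (fst p) (fst (snd p)) (snd (snd p)) then T (snd (snd p)) else 0)) \<in> borel_measurable borel"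
      by measurable
    have "(\<integral>\<^sup>+p. ennreal (if small_box (fst p) (fst (snd p)) (snd (snd p)) then T (fst (snd p)) else 0) \<partial>lborel)
      = (\<integral>\<^sup>+p. ennreal (if small_box (fst p) (fst (snd p)) (snd (snd p)) then T (snd (snd p)) else 0) \<partial>lborel)"
      using lborel_symmetry_swap[of "\<lambda>p. ennreal (if small_box (fst p) (fst (snd p)) (snd (snd p)) then T (snd (snd p)) else 0)"]
      by (simp add: small_box_def conj_ac cong: if_cong)
    then show ?thesis using G2 by simp
  qed
  have "(\<integral>\<^sup>+p. ennreal (g p) \<partial>lborel) \<le> tail_energy h c + (tail_energy h c + tail_energy h c)"
  proof -
    have "(\<integral>\<^sup>+p. ennreal (g p) \<partial>lborel) =
      (\<integral>\<^sup>+p. ennreal (if small_box (fst p) (fst (snd p)) (snd (snd p)) then T (fst (snd p)) else 0)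
      + (ennreal (if small_box (fst p) (fst (snd p)) (snd (snd p)) then T (snd (snd p)) else 0)
      + ennreal (if small_box (fst p) (fst (snd p)) (snd (snd p)) then T (freq3 p) else 0)) \<partial>lborel)"
      using T0 by (intro nn_integral_cong) (simp add: g_def)
    also have "\<dots> = (\<integral>\<^sup>+p. ennreal (if small_box (fst p) (fst (snd p)) (snd (snd p)) then T (fst (snd p)) else 0) \<partial>lborel)
      + ((\<integral>\<^sup>+p. ennreal (if small_box (fst p) (fst (snd p)) (snd (snd p)) then T (snd (snd p)) else 0) \<partial>lborel)
      + (\<integral>\<^sup>+p. ennreal (if small_box (fst p) (fst (snd p)) (snd (snd p)) then T (freq3 p) else 0) \<partial>lborel))"
      by (subst nn_integral_add, measurable, subst nn_integral_add, measurable)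
    finally show ?thesis using add_mono[OF G1 add_mono[OF G2 G3]] by simp
  qed
  then have "ennreal 60 * (\<integral>\<^sup>+p. ennreal (g p) \<partial>lborel) \<le> ennreal 60 * (tail_energy h c + (tail_energy h c + tail_energy h c))"
    by (rule mult_left_mono) simp
  also have "\<dots> = ennreal 180 * tail_energy h c"
  proof -
    have "ennreal 60 * (t + (t + t)) = (ennreal 60 + (ennreal 60 + ennreal 60)) * t" for t
      by (simp only: distrib_left distrib_right)
    then show ?thesis by (simp only: ennreal_plus[symmetric]) simp
  qed
  finally show ?thesis using 1 by (meson add_left_mono order_trans)
qed

lemma sqrt_times_inverse_square:
  assumes "x > (0::real)"
  shows "sqrt x * (1 / x)\<^sup>2 = x powr (-3/2)"
proof -
  have "x powr (-3/2) = x powr (1/2) * x powr (-2)" by (simp add: powr_add[symmetric])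
  also have "x powr (1/2) = sqrt x" using assms by (simp add: powr_half_sqrt)
  also have "x powr (-2) = (1 / x)\<^sup>2" using assms by (simp add: powr_minus_divide powr_numeral power_divide)
  finally show ?thesis by simp
qed

text \<open>Fails without \<open>\<mu> > 0\<close>: for \<open>\<mu> = 0\<close> the integral of \<open>n\<^sup>2 sqrt x = x\<^bsup>-3/2\<^esup>\<close> diverges
at \<open>0\<close>.\<close>

lemma eq_n_square_integrable:
  assumes mu: "\<mu> > 0"
  shows "square_integrable (eq_n \<mu>)"
proof -
  have one: "(\<integral>\<^sup>+x. ennreal (indicator {1..} x * x powr (-3/2)) \<partial>lborel) = ennreal 2"
    using nn_integral_has_integral_lebesgue[OF _ has_integral_powr_to_inf[of "-3/2" 1]] by simp
  have unit: "(\<integral>\<^sup>+x. ennreal (indicator {0..1::real} x) \<partial>lborel) = 1" by (simp add: ennreal_indicator)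
  have "(\<integral>\<^sup>+x. ennreal ((eq_n \<mu> x)\<^sup>2) \<partial>wmeasure) = (\<integral>\<^sup>+x. ennreal (indicator {0<..} x * sqrt x) * ennreal ((eq_n \<mu> x)\<^sup>2) \<partial>lborel)"
    by (rule nn_integral_wmeasure) (simp add: measurable_eq_n borel_measurable_power)
  also have "\<dots> = (\<integral>\<^sup>+x. ennreal (indicator {0<..} x * sqrt x * (eq_n \<mu> x)\<^sup>2) \<partial>lborel)"
    by (intro nn_integral_cong) (auto simp: indicator_def ennreal_mult)
  also have "\<dots> \<le> ennreal (1 / \<mu>\<^sup>2) * (\<integral>\<^sup>+x. ennreal (indicator {0..1::real} x) \<partial>lborel)
      + ennreal 1 * (\<integral>\<^sup>+x. ennreal (indicator {1..} x * x powr (-3/2)) \<partial>lborel)"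
  proof (rule nn_integral_le_lincomb)
    fix x :: real
    consider "x \<le> 0" | "0 < x" "x \<le> 1" | "1 < x" by linarith
    then show "indicator {0<..} x * sqrt x * (eq_n \<mu> x)\<^sup>2 \<le> 1 / \<mu>\<^sup>2 * indicator {0..1} x + 1 * (indicator {1..} x * x powr (-3/2))"
    proof cases
      case 2
      have "(eq_n \<mu> x)\<^sup>2 \<le> (1 / \<mu>)\<^sup>2" using 2 mu by (intro power_mono) (auto simp: eq_n_def frac_le)
      then have "sqrt x * (eq_n \<mu> x)\<^sup>2 \<le> 1 * (1 / \<mu>)\<^sup>2" using 2 by (intro mult_mono) auto
      then have A: "sqrt x * (eq_n \<mu> x)\<^sup>2 \<le> 1 / \<mu>\<^sup>2" by (simp add: power_divide)
      have B: "0 \<le> indicator {1..} x * x powr (-3/2)" by simp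
      have "sqrt x * (eq_n \<mu> x)\<^sup>2 \<le> 1 / \<mu>\<^sup>2 + indicator {1..} x * x powr (-3/2)"
        using A B by linarith
      then show ?thesis using 2 by simp
    next
      case 3
      have "sqrt x * (eq_n \<mu> x)\<^sup>2 \<le> sqrt x * (1 / x)\<^sup>2" using 3 mu by (intro mult_left_mono power_mono) (auto simp: eq_n_def frac_le)
      also have "\<dots> = x powr (-3/2)" using 3 by (intro sqrt_times_inverse_square) simp
      finally show ?thesis using 3 by (simp add: indicator_def)
    qed (simp add: indicator_def)
  qed auto
  also have "\<dots> < \<infinity>" unfolding one unit by (simp add: ennreal_mult_less_top)
  finally show ?thesis by (simp add: square_integrable_iff_nn_integral)
qed

text \<open>The profile of \<open>n\<close> is the constant \<open>1\<close>, so its defect vanishes.\<close>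

lemma eq_n_in_kernel:
  assumes mu: "\<mu> > 0"
  shows "L_op \<mu> (L2_class (eq_n \<mu>)) = 0"
proof -
  have mu0: "\<mu> \<ge> 0" using mu by simp
  have "AE p in coll_measure \<mu>. defect \<mu> (eq_n \<mu>) p = 0"
  proof -
    have "AE p in lborel. coll_density \<mu> p > 0 \<longrightarrow> defect \<mu> (eq_n \<mu>) p = 0"
    proof (rule AE_I2, intro impI)
      fix p assume *: "coll_density \<mu> p > 0"
      obtain x y z where p: "p = (x, y, z)" by (cases p rule: prod_cases3)
      have "x > 0" "y > 0" "z > 0" "y + z - x > 0" using * by (auto simp: p coll_density_eq split: if_splits)
      then have "profile \<mu> (eq_n \<mu>) w = 1" if "w \<in> {x, y, z, y + z - x}" for w
        using that eq_n_pos[OF _ mu0, of w] by (auto simp: profile_def)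
      then show "defect \<mu> (eq_n \<mu>) p = 0" by (simp add: p defect_def freq3_def)
    qed
    then show ?thesis unfolding coll_measure_def by (subst AE_density) auto
  qed
  then have "(\<integral>\<^sup>+p. ennreal ((defect \<mu> (eq_n \<mu>) p)\<^sup>2) \<partial>coll_measure \<mu>) = (\<integral>\<^sup>+p. 0 \<partial>coll_measure \<mu>)"
    by (intro nn_integral_cong_AE) (auto elim: eventually_mono)
  then have "ennreal (4 * dissipation \<mu> (L2_class (eq_n \<mu>))) = 0"
    using dissipation_L2_class[OF mu0 eq_n_square_integrable[OF mu]] by simp
  then have "dissipation \<mu> (L2_class (eq_n \<mu>)) \<le> 0" by (simp add: ennreal_eq_0_iff)
  moreover have "inner (L_op \<mu> (L2_class (eq_n \<mu>))) (L2_class (eq_n \<mu>)) \<le> 0" by (rule L_op_nonpositive[OF mu0])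
  ultimately have "inner (L_op \<mu> (L2_class (eq_n \<mu>))) (L2_class (eq_n \<mu>)) = 0" by (simp add: dissipation_def)
  then show ?thesis
    by (intro kernel_if_form_zero[OF bounded_linear_L_op[OF mu0] L_op_symmetric[OF mu0] L_op_nonpositive[OF mu0]])
qed

lemma total_energy_eq_dissipation:
  assumes mu: "\<mu> \<ge> 0" and g: "square_integrable g"
  shows "total_energy \<mu> (profile \<mu> g) = ennreal (4 * dissipation \<mu> (L2_class g))"
proof -
  note [measurable] = measurable_defect[OF g, of \<mu>]
  have "(\<integral>\<^sup>+p. ennreal ((defect \<mu> g p)\<^sup>2) \<partial>coll_measure \<mu>) = (\<integral>\<^sup>+p. ennreal (coll_density \<mu> p) * ennreal ((defect \<mu> g p)\<^sup>2) \<partial>lborel)"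
    unfolding coll_measure_def by (subst nn_integral_density) auto
  also have "\<dots> = total_energy \<mu> (profile \<mu> g)"
    unfolding total_energy_def
    by (intro nn_integral_cong) (simp add: energy_density_def defect_def freq3_def ennreal_mult coll_density_nonneg[OF mu])
  finally show ?thesis using dissipation_L2_class[OF mu g] by simp
qed

lemma tail_energy_profile_finite:
  assumes mu: "\<mu> \<ge> 0" and g: "square_integrable g"
  shows "tail_energy (profile \<mu> g) 0 < \<infinity>"
proof -
  note [measurable] = square_integrable_borel[OF g]
  have "tail_energy (profile \<mu> g) 0 \<le> (\<integral>\<^sup>+x. ennreal ((1 + \<mu>)\<^sup>2) * (ennreal (indicator {0<..} x * sqrt x) * ennreal ((g x)\<^sup>2)) \<partial>lborel)"
    unfolding tail_energy_def
  proof (rule nn_integral_mono)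
    fix x :: real
    show "ennreal (if 1 \<le> x then (profile \<mu> g x - 0)\<^sup>2 * x powr (-3/2) else 0)
      \<le> ennreal ((1 + \<mu>)\<^sup>2) * (ennreal (indicator {0<..} x * sqrt x) * ennreal ((g x)\<^sup>2))"
    proof (cases "1 \<le> x")
      case True
      have "x + \<mu> \<le> (1 + \<mu>) * x" using True mu mult_left_mono[OF True mu] by (simp add: distrib_right)
      then have "(x + \<mu>)\<^sup>2 \<le> ((1 + \<mu>) * x)\<^sup>2" using True mu by (intro power_mono) auto
      then have "(g x)\<^sup>2 * (x + \<mu>)\<^sup>2 * x powr (-3/2) \<le> (g x)\<^sup>2 * ((1 + \<mu>) * x)\<^sup>2 * x powr (-3/2)"
        by (intro mult_right_mono mult_left_mono) auto
      also have "\<dots> = (1 + \<mu>)\<^sup>2 * ((x powr 2 * x powr (-3/2)) * (g x)\<^sup>2)"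
        using True by (simp add: power_mult_distrib powr_numeral mult_ac)
      also have "x powr 2 * x powr (-3/2) = x powr (1/2)" by (simp only: powr_add[symmetric]) simp
      also have "x powr (1/2) = sqrt x" using True by (simp add: powr_half_sqrt)
      finally have "(profile \<mu> g x - 0)\<^sup>2 * x powr (-3/2) \<le> (1 + \<mu>)\<^sup>2 * (sqrt x * (g x)\<^sup>2)"
        by (simp add: profile_def eq_n_def power_mult_distrib)
      then have "ennreal ((profile \<mu> g x - 0)\<^sup>2 * x powr (-3/2)) \<le> ennreal ((1 + \<mu>)\<^sup>2 * (sqrt x * (g x)\<^sup>2))" by (rule ennreal_leI)
      then show ?thesis using True by (simp add: ennreal_mult)
    qed simp
  qed
  also have "\<dots> = ennreal ((1 + \<mu>)\<^sup>2) * (\<integral>\<^sup>+x. ennreal ((g x)\<^sup>2) \<partial>wmeasure)"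
    by (subst nn_integral_cmult, measurable, subst nn_integral_wmeasure, measurable)
  also have "\<dots> < \<infinity>" using g by (simp add: square_integrable_iff_nn_integral ennreal_mult_less_top)
  finally show ?thesis .
qed

text \<open>On \<open>(0,1]\<close> the factor \<open>n\<close> is at most \<open>1/\<mu>\<close>, on \<open>[1,\<infinity>)\<close> at most \<open>1/x\<close>.\<close>

lemma distance_to_equilibrium:
  assumes mu: "\<mu> > 0" and g: "square_integrable g"
  shows "ennreal ((norm (L2_class g - c *\<^sub>R L2_class (eq_n \<mu>)))\<^sup>2)
    \<le> ennreal (1 / \<mu>\<^sup>2) * low_energy (profile \<mu> g) c + ennreal 1 * tail_energy (profile \<mu> g) c"
proof -
  define h where "h = profile \<mu> g"
  have [measurable]: "g \<in> borel_measurable borel" "h \<in> borel_measurable borel"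
    using square_integrable_borel[OF g] measurable_profile by (auto simp: h_def)
  note n = eq_n_square_integrable[OF mu]
  have cn: "square_integrable (\<lambda>x. c * eq_n \<mu> x)" by (rule square_integrable_scale[OF n])
  have d: "square_integrable (\<lambda>x. g x - c * eq_n \<mu> x)" by (rule square_integrable_diff[OF g cn])
  have "L2_class g - c *\<^sub>R L2_class (eq_n \<mu>) = L2_class (\<lambda>x. g x - c * eq_n \<mu> x)"
    by (simp only: L2_class_arith(4)[OF n n] L2_class_arith(2)[OF g cn])
  then have "ennreal ((norm (L2_class g - c *\<^sub>R L2_class (eq_n \<mu>)))\<^sup>2) = (\<integral>\<^sup>+x. ennreal ((g x - c * eq_n \<mu> x)\<^sup>2) \<partial>wmeasure)"
    by (simp only: nn_integral_norm_L2_class[OF d])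
  also have "\<dots> = (\<integral>\<^sup>+x. ennreal (indicator {0<..} x * sqrt x) * ennreal ((g x - c * eq_n \<mu> x)\<^sup>2) \<partial>lborel)"
    using square_integrable_borel[OF d] by (intro nn_integral_wmeasure) auto
  also have "\<dots> = (\<integral>\<^sup>+x. ennreal (indicator {0<..} x * sqrt x * (g x - c * eq_n \<mu> x)\<^sup>2) \<partial>lborel)"
    by (intro nn_integral_cong) (auto simp: indicator_def ennreal_mult)
  also have "\<dots> \<le> ennreal (1 / \<mu>\<^sup>2) * low_energy h c + ennreal 1 * tail_energy h c"
    unfolding low_energy_def tail_energy_def
  proof (rule nn_integral_le_lincomb)
    fix x :: real
    have eq: "(g x - c * eq_n \<mu> x)\<^sup>2 = (eq_n \<mu> x)\<^sup>2 * (h x - c)\<^sup>2" if "0 < x"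
      using eq_n_pos[OF that, of \<mu>] mu by (simp add: h_def profile_def power_mult_distrib[symmetric] field_simps)
    consider "x \<le> 0" | "0 < x" "x \<le> 1" | "1 < x" by linarith
    then show "indicator {0<..} x * sqrt x * (g x - c * eq_n \<mu> x)\<^sup>2
        \<le> 1 / \<mu>\<^sup>2 * (if 0 < x \<and> x \<le> 1 then (h x - c)\<^sup>2 * sqrt x else 0) + 1 * (if 1 \<le> x then (h x - c)\<^sup>2 * x powr (-3/2) else 0)"
    proof cases
      case 2
      have "(eq_n \<mu> x)\<^sup>2 \<le> (1 / \<mu>)\<^sup>2" using 2 mu by (intro power_mono) (auto simp: eq_n_def frac_le)
      then have "(eq_n \<mu> x)\<^sup>2 * ((h x - c)\<^sup>2 * sqrt x) \<le> (1 / \<mu>)\<^sup>2 * ((h x - c)\<^sup>2 * sqrt x)" using 2 by (intro mult_right_mono) auto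
      then have "indicator {0<..} x * sqrt x * (g x - c * eq_n \<mu> x)\<^sup>2 \<le> 1 / \<mu>\<^sup>2 * ((h x - c)\<^sup>2 * sqrt x)"
        using 2 eq by (simp add: power_divide mult_ac)
      moreover have "0 \<le> (if 1 \<le> x then (h x - c)\<^sup>2 * x powr (-3/2) else 0)" by simp
      ultimately show ?thesis using 2 by simp
    next
      case 3
      have "sqrt x * (eq_n \<mu> x)\<^sup>2 \<le> sqrt x * (1 / x)\<^sup>2" using 3 mu by (intro mult_left_mono power_mono) (auto simp: eq_n_def frac_le)
      also have "\<dots> = x powr (-3/2)" using 3 by (intro sqrt_times_inverse_square) simp
      finally have "(sqrt x * (eq_n \<mu> x)\<^sup>2) * (h x - c)\<^sup>2 \<le> x powr (-3/2) * (h x - c)\<^sup>2" by (rule mult_right_mono) simp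
      then show ?thesis using 3 eq by (simp add: mult_ac)
    qed (simp add: indicator_def)
  qed (use mu in auto)
  finally show ?thesis by (simp add: h_def)
qed

lemma ennreal_lincomb_finite:
  assumes "t \<le> ennreal a * ennreal x + ennreal b * ennreal y"
  obtains r where "t = ennreal r" "r \<ge> 0"
proof -
  have "ennreal a * ennreal x + ennreal b * ennreal y < top" by (simp add: ennreal_mult_less_top)
  with assms have "t < top" by (rule le_less_trans)
  then show thesis using that by (cases t) auto
qed

text \<open>The estimates above bound the distance to \<open>c n\<close> by the collision energy and the base energy, for every \<open>c\<close>. Since \<open>d\<close>
is below all these distances, \<open>c = h(s)\<close> may be inserted and the inequality averaged over \<open>s \<in> [1,2]\<close>, which
replaces the base energy by the ratio energy: \<open>1156 = 880 + 23 \<cdot> 12\<close>.\<close>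

lemma equilibrium_distance_bound:
  assumes mu: "\<mu> > 0" and g: "square_integrable g"
    and near: "\<And>c. d \<le> norm (L2_class g - c *\<^sub>R L2_class (eq_n \<mu>))" and d: "d \<ge> 0"
  shows "d\<^sup>2 \<le> 4 * (4 * (6 + \<mu>) ^ 4 / \<mu>\<^sup>2 + (180 / \<mu>\<^sup>2 + 1) * (1156 * (198 * (4 + \<mu>) ^ 4))) * dissipation \<mu> (L2_class g)"
proof -
  define h where "h = profile \<mu> g"
  have [measurable]: "h \<in> borel_measurable borel"
    using measurable_profile[OF square_integrable_borel[OF g]] by (simp add: h_def)
  have mu0: "\<mu> \<ge> 0" using mu by simp
  have fin: "tail_energy h 0 < \<infinity>" using tail_energy_profile_finite[OF mu0 g] by (simp add: h_def)
  define q where "q = 4 * dissipation \<mu> (L2_class g)"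
  have q0: "q \<ge> 0" using L_op_nonpositive[OF mu0] by (simp add: q_def dissipation_def)
  have Q: "total_energy \<mu> h = ennreal q" unfolding h_def q_def by (rule total_energy_eq_dissipation[OF mu0 g])
  obtain n where n: "ratio_energy h = ennreal n" "n \<ge> 0"
    using ratio_energy_finite[OF \<open>h \<in> borel_measurable borel\<close> fin] by (cases "ratio_energy h") auto
  have nq: "n \<le> 198 * (4 + \<mu>) ^ 4 * q"
  proof -
    have "ennreal 1 * ennreal n \<le> ennreal (198 * (4 + \<mu>) ^ 4) * ennreal q + ennreal 0 * ennreal 0"
      using ratio_energy_bound[OF \<open>h \<in> borel_measurable borel\<close> mu0 fin] n Q by simp
    then show ?thesis using ennreal_lincomb_leD[of 1 n "198 * (4 + \<mu>) ^ 4" q 0 0] n q0 mu by simp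
  qed
  define C1 where "C1 = 4 * (6 + \<mu>) ^ 4 / \<mu>\<^sup>2"
  define C2 where "C2 = 180 / \<mu>\<^sup>2 + 1"
  have C: "C1 \<ge> 0" "C2 \<ge> 0" using mu by (auto simp: C1_def C2_def)
  have b_fin: "base_energy h c < \<infinity>" for c
  proof -
    have "base_energy h c \<le> tail_energy h c" unfolding base_energy_def tail_energy_def by (intro nn_integral_mono) auto
    then show ?thesis using tail_energy_finite[OF \<open>h \<in> borel_measurable borel\<close> fin] by (rule le_less_trans)
  qed
  define b where "b c = enn2real (base_energy h c)" for c
  have b: "base_energy h c = ennreal (b c)" "b c \<ge> 0" for c
    using b_fin[of c] by (auto simp: b_def)
  have point: "ennreal (d\<^sup>2) \<le> ennreal (C1 * q + C2 * 880 * n) + ennreal (23 * C2) * base_energy h c" for c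
  proof -
    have "tail_energy h c \<le> ennreal 23 * ennreal (b c) + ennreal 880 * ennreal n"
      using tail_energy_bound[OF \<open>h \<in> borel_measurable borel\<close> fin, of c] by (simp only: b n)
    then obtain p where p: "tail_energy h c = ennreal p" "p \<ge> 0" by (rule ennreal_lincomb_finite)
    have "1 * p \<le> 23 * b c + 880 * n"
      using tail_energy_bound[OF \<open>h \<in> borel_measurable borel\<close> fin, of c] p b n by (intro ennreal_lincomb_leD) auto
    then have p1: "p \<le> 23 * b c + 880 * n" by simp
    have low: "low_energy h c \<le> ennreal (4 * (6 + \<mu>) ^ 4) * ennreal q + ennreal 180 * ennreal p"
      using low_energy_bound[OF mu0 \<open>h \<in> borel_measurable borel\<close>, of c] by (simp only: Q p)
    then obtain l where l: "low_energy h c = ennreal l" "l \<ge> 0" by (rule ennreal_lincomb_finite)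
    have "1 * l \<le> 4 * (6 + \<mu>) ^ 4 * q + 180 * p"
      using low l p q0 mu by (intro ennreal_lincomb_leD) auto
    then have l1: "l \<le> 4 * (6 + \<mu>) ^ 4 * q + 180 * p" by simp
    have "ennreal (d\<^sup>2) \<le> ennreal ((norm (L2_class g - c *\<^sub>R L2_class (eq_n \<mu>)))\<^sup>2)"
      using near d by (intro ennreal_leI power_mono) auto
    also have "\<dots> \<le> ennreal (1 / \<mu>\<^sup>2) * ennreal l + ennreal 1 * ennreal p"
      using distance_to_equilibrium[OF mu g, of c] by (simp only: h_def[symmetric] l p)
    finally have "ennreal 1 * ennreal (d\<^sup>2) \<le> ennreal (1 / \<mu>\<^sup>2) * ennreal l + ennreal 1 * ennreal p" by simp
    then have "1 * d\<^sup>2 \<le> 1 / \<mu>\<^sup>2 * l + 1 * p" using l p mu by (intro ennreal_lincomb_leD) auto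
    also have "\<dots> \<le> 1 / \<mu>\<^sup>2 * (4 * (6 + \<mu>) ^ 4 * q + 180 * p) + 1 * p"
      using l1 by (intro add_mono mult_left_mono) auto
    also have "\<dots> = C1 * q + C2 * p" by (simp add: C1_def C2_def algebra_simps add_divide_distrib)
    also have "\<dots> \<le> C1 * q + C2 * (23 * b c + 880 * n)" using p1 C by (intro add_mono mult_left_mono) auto
    finally have "d\<^sup>2 \<le> (C1 * q + C2 * 880 * n) + (23 * C2) * b c" by (simp add: algebra_simps)
    then have "ennreal (d\<^sup>2) \<le> ennreal ((C1 * q + C2 * 880 * n) + (23 * C2) * b c)" by (rule ennreal_leI)
    also have "\<dots> = ennreal (C1 * q + C2 * 880 * n) + ennreal (23 * C2) * base_energy h c"
      using C q0 n b by (simp add: ennreal_mult)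
    finally show ?thesis .
  qed
  have [measurable]: "(\<lambda>s. base_energy h (h s)) \<in> borel_measurable borel"
    unfolding base_energy_def by measurable
  have one: "(\<integral>\<^sup>+s. ennreal (indicator {1..2::real} s) \<partial>lborel) = 1" by (simp add: ennreal_indicator)
  have "ennreal (d\<^sup>2) = (\<integral>\<^sup>+s. ennreal (d\<^sup>2) * ennreal (indicator {1..2::real} s) \<partial>lborel)"
    by (subst nn_integral_cmult) (simp_all add: one)
  also have "\<dots> \<le> (\<integral>\<^sup>+s. ennreal (C1 * q + C2 * 880 * n) * ennreal (indicator {1..2} s)
      + ennreal (23 * C2) * (ennreal (indicator {1..2} s) * base_energy h (h s)) \<partial>lborel)"
  proof (rule nn_integral_mono)
    fix s :: real
    show "ennreal (d\<^sup>2) * ennreal (indicator {1..2} s) \<le> ennreal (C1 * q + C2 * 880 * n) * ennreal (indicator {1..2} s)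
      + ennreal (23 * C2) * (ennreal (indicator {1..2} s) * base_energy h (h s))"
      using point[of "h s"] by (cases "s \<in> {1..2}") auto
  qed
  also have "\<dots> = ennreal (C1 * q + C2 * 880 * n) + ennreal (23 * C2) * (\<integral>\<^sup>+s. ennreal (indicator {1..2} s) * base_energy h (h s) \<partial>lborel)"
    by (simp add: nn_integral_add nn_integral_cmult one)
  also have "\<dots> \<le> ennreal (C1 * q + C2 * 880 * n) + ennreal (23 * C2) * (ennreal 12 * ennreal n)"
    using base_energy_average[OF \<open>h \<in> borel_measurable borel\<close>] n by (intro add_mono mult_left_mono) auto
  also have "ennreal 12 * ennreal n = ennreal (12 * n)" using n by (intro ennreal_mult[symmetric]) auto
  finally have "ennreal 1 * ennreal (d\<^sup>2) \<le> ennreal 1 * ennreal (C1 * q + C2 * 880 * n) + ennreal (23 * C2) * ennreal (12 * n)" by simp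
  then have "1 * d\<^sup>2 \<le> 1 * (C1 * q + C2 * 880 * n) + 23 * C2 * (12 * n)"
    using C q0 n by (intro ennreal_lincomb_leD) auto
  also have "\<dots> = C1 * q + C2 * (1156 * n)" by (simp add: algebra_simps)
  also have "\<dots> \<le> C1 * q + C2 * (1156 * (198 * (4 + \<mu>) ^ 4 * q))"
    using nq C by (intro add_mono mult_left_mono) auto
  finally show ?thesis by (simp add: q_def C1_def C2_def algebra_simps)
qed

text \<open>As \<open>n\<close> lies in the kernel, the distance to the kernel is at most the distance to each multiple of \<open>n\<close>.\<close>

lemma spectral_gap:
  assumes mu: "\<mu> > 0"
    and P: "orthogonal_projection_onto (ker (L_op \<mu>)) P"
  shows "\<exists>lam>0. \<forall>g. dissipation \<mu> g \<ge> lam * (norm (g - P g))\<^sup>2"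
proof -
  have mu0: "\<mu> \<ge> 0" using mu by simp
  define C where "C = 4 * (4 * (6 + \<mu>) ^ 4 / \<mu>\<^sup>2 + (180 / \<mu>\<^sup>2 + 1) * (1156 * (198 * (4 + \<mu>) ^ 4)))"
  have C: "C > 0" unfolding C_def using mu by (intro mult_pos_pos add_pos_pos divide_pos_pos) auto
  note sub = subspace_ker[OF bounded_linear_L_op[OF mu0] L_op_symmetric[OF mu0] L_op_nonpositive[OF mu0]]
  have "dissipation \<mu> g \<ge> (1 / C) * (norm (g - P g))\<^sup>2" for g
  proof -
    have near: "norm (g - P g) \<le> norm (L2_class (rep_wL2 g) - c *\<^sub>R L2_class (eq_n \<mu>))" for c
    proof -
      have "L2_class (eq_n \<mu>) \<in> ker (L_op \<mu>)" using eq_n_in_kernel[OF mu] by (simp add: ker_def)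
      then have "c *\<^sub>R L2_class (eq_n \<mu>) \<in> ker (L_op \<mu>)" by (rule subspace_scale[OF sub])
      from orthogonal_projection_onto_nearest[OF sub P this, of g] show ?thesis by simp
    qed
    have "(norm (g - P g))\<^sup>2 \<le> C * dissipation \<mu> g"
      using equilibrium_distance_bound[OF mu square_integrable_rep near norm_ge_zero] by (simp add: C_def)
    then show ?thesis using C by (simp add: field_simps)
  qed
  then show ?thesis using C by (intro exI[of _ "1 / C"]) auto
qed

section \<open>Non-compactness of the integral part\<close>

lemma Bessel_inequality:
  fixes e :: "nat \<Rightarrow> 'a::real_inner"
  assumes on: "\<And>j k. inner (e j) (e k) = (if j = k then 1 else 0)"
  shows "(\<Sum>k<n. (inner y (e k))\<^sup>2) \<le> (norm y)\<^sup>2"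
proof -
  define a where "a k = inner y (e k)" for k
  define s where "s = (\<Sum>k<n. a k *\<^sub>R e k)"
  have ys: "inner y s = (\<Sum>k<n. (a k)\<^sup>2)"
    by (simp add: s_def inner_sum_right a_def power2_eq_square)
  have "inner (e j) s = a j" if "j < n" for j
    using that by (simp add: s_def inner_sum_right on if_distrib[of "(*) _"] cong: if_cong)
  moreover have "inner (\<Sum>k<n. a k *\<^sub>R e k) t = (\<Sum>k<n. a k * inner (e k) t)" for t
    by (simp add: inner_sum_left)
  from this[of s] have "inner s s = (\<Sum>k<n. a k * inner (e k) s)" by (simp add: s_def[symmetric])
  ultimately have ss: "inner s s = (\<Sum>k<n. (a k)\<^sup>2)" by (simp add: power2_eq_square)
  have "0 \<le> inner (y - s) (y - s)" by simp
  also have "\<dots> = (norm y)\<^sup>2 - (\<Sum>k<n. (a k)\<^sup>2)"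
    by (simp add: inner_diff_left inner_diff_right ys ss inner_commute[of s y] power2_norm_eq_inner)
  finally show ?thesis by (simp add: a_def)
qed

text \<open>The coefficients are square summable by Bessel's inequality.\<close>

lemma orthonormal_weakly_null:
  fixes e :: "nat \<Rightarrow> 'a::real_inner"
  assumes on: "\<And>j k. inner (e j) (e k) = (if j = k then 1 else 0)"
  shows "(\<lambda>k. inner y (e k)) \<longlonglongrightarrow> 0"
proof -
  have "summable (\<lambda>k. (inner y (e k))\<^sup>2)"
    by (rule summableI_nonneg_bounded[OF _ Bessel_inequality[OF on]]) simp
  then have "(\<lambda>k. (inner y (e k))\<^sup>2) \<longlonglongrightarrow> 0" by (rule summable_LIMSEQ_zero)
  then have "(\<lambda>k. sqrt ((inner y (e k))\<^sup>2)) \<longlonglongrightarrow> sqrt 0" by (rule tendsto_real_sqrt)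
  then show ?thesis by (simp add: tendsto_rabs_zero_iff)
qed

text \<open>If \<open>T (e k)\<close> converged to \<open>y\<close> along a subsequence, \<open>\<langle>T (e k), e k\<rangle>\<close> would have the same limit as
\<open>\<langle>y, e k\<rangle>\<close>, which is \<open>0\<close>.\<close>

lemma not_compact_if_bounded_below_on_orthonormal:
  fixes e :: "nat \<Rightarrow> 'a::real_inner"
  assumes on: "\<And>j k. inner (e j) (e k) = (if j = k then 1 else 0)"
    and low: "\<And>k. inner (T (e k)) (e k) \<ge> c" and c: "c > 0"
  shows "\<not> compact_op T"
proof
  assume T: "compact_op T"
  have n1: "norm (e k) = 1" for k using on[of k k] by (simp add: norm_eq_sqrt_inner)
  have "bounded (range e)" unfolding bounded_iff using n1 by (intro exI[of _ 1]) auto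
  then have "compact (closure (T ` range e))" using T by (simp add: compact_op_def)
  then have sc: "seq_compact (closure (T ` range e))" by (rule compact_imp_seq_compact)
  have "\<forall>n. T (e n) \<in> closure (T ` range e)" using closure_subset[of "T ` range e"] by auto
  then obtain y r where r: "strict_mono r" "((\<lambda>n. T (e n)) \<circ> r) \<longlonglongrightarrow> y"
    using seq_compactE[OF sc] by metis
  have 1: "(\<lambda>k. norm (T (e (r k)) - y)) \<longlonglongrightarrow> 0"
    using r(2) by (simp add: comp_def tendsto_norm_zero LIM_zero)
  have 2: "(\<lambda>k. inner y (e (r k))) \<longlonglongrightarrow> 0"
    using LIMSEQ_subseq_LIMSEQ[OF orthonormal_weakly_null[OF on, of y] r(1)] by (simp add: comp_def)
  have "(\<lambda>k. norm (T (e (r k)) - y) + inner y (e (r k))) \<longlonglongrightarrow> 0 + 0" by (rule tendsto_add[OF 1 2])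
  moreover have "c \<le> norm (T (e (r k)) - y) + inner y (e (r k))" for k
  proof -
    have "c \<le> inner (T (e (r k)) - y) (e (r k)) + inner y (e (r k))" using low[of "r k"] by (simp add: inner_diff_left)
    moreover have "inner (T (e (r k)) - y) (e (r k)) \<le> norm (T (e (r k)) - y)"
      using norm_cauchy_schwarz[of "T (e (r k)) - y" "e (r k)"] n1 by simp
    ultimately show ?thesis by simp
  qed
  ultimately have "c \<le> 0 + 0" by (intro LIMSEQ_le_const) auto
  then show False using c by simp
qed

text \<open>The packets live on intervals of relative length \<open>packet_width\<^sup>2\<close>. For a width \<open>\<delta>\<close> the gain terms are bounded below
by \<open>\<delta>\<^sup>3 / 576\<close> and the loss term above by \<open>6 \<delta>\<^sup>4\<close>, in units of \<open>1 / sqrt R\<close>; so \<open>\<delta> < 1/3456\<close> is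
needed, and a smaller value leaves a margin.\<close>

definition packet_width :: real where "packet_width = 1 / 8000"

definition packet_interval :: "real \<Rightarrow> real set" where
  "packet_interval R = {R..R * (1 + packet_width\<^sup>2)}"

text \<open>Chosen such that the profile is the indicator of the interval.\<close>

definition packet :: "real \<Rightarrow> real \<Rightarrow> real \<Rightarrow> real" where
  "packet \<mu> R x = indicator (packet_interval R) x * eq_n \<mu> x"

context
  fixes \<mu> R :: real
  assumes mu: "\<mu> \<ge> 0" and R: "R > 0" and scale: "\<mu> \<le> packet_width\<^sup>2 * R"
begin

lemma packet_interval_bounds:
  assumes "x \<in> packet_interval R"
  shows "R \<le> x" "x \<le> 2 * R" "x > 0"
  using assms R by (auto simp: packet_interval_def packet_width_def field_simps power2_eq_square)

lemma profile_packet: "profile \<mu> (packet \<mu> R) x = indicator (packet_interval R) x"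
proof (cases "x \<in> packet_interval R")
  case True
  then show ?thesis using eq_n_pos[OF packet_interval_bounds(3)[OF True] mu] by (simp add: profile_def packet_def)
qed (simp add: profile_def packet_def)

lemma measurable_packet_interval [measurable]: "packet_interval R \<in> sets borel"
  by (simp add: packet_interval_def)

lemma packet_square_integrable: "square_integrable (packet \<mu> R)"
proof (rule square_integrable_bounded_support[of _ "1 / R" R "R * (1 + packet_width\<^sup>2)"])
  show "packet \<mu> R \<in> borel_measurable borel" unfolding packet_def[abs_def]
    by (intro borel_measurable_times borel_measurable_indicator measurable_packet_interval measurable_eq_n)
  show "\<bar>packet \<mu> R x\<bar> \<le> 1 / R * indicator {R..R * (1 + packet_width\<^sup>2)} x" for x
  proof (cases "x \<in> packet_interval R")
    case True
    have "eq_n \<mu> x \<le> 1 / R" unfolding eq_n_def using packet_interval_bounds[OF True] mu R by (intro frac_le) auto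
    then show ?thesis using True eq_n_pos[OF packet_interval_bounds(3)[OF True] mu]
      by (simp add: packet_def packet_interval_def[symmetric])
  qed (simp add: packet_def packet_interval_def)
qed (use R in \<open>auto simp: packet_width_def\<close>)

lemma emeasure_packet_interval: "emeasure lborel (packet_interval R) = ennreal (packet_width\<^sup>2 * R)"
  using R by (simp add: packet_interval_def algebra_simps)

lemma norm_packet_le: "(norm (L2_class (packet \<mu> R)))\<^sup>2 \<le> 3/2 * packet_width\<^sup>2 / sqrt R"
proof -
  have mp: "packet \<mu> R \<in> borel_measurable borel" by (rule square_integrable_borel[OF packet_square_integrable])
  have "ennreal ((norm (L2_class (packet \<mu> R)))\<^sup>2) = (\<integral>\<^sup>+x. ennreal ((packet \<mu> R x)\<^sup>2) \<partial>wmeasure)"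
    by (rule nn_integral_norm_L2_class[OF packet_square_integrable, symmetric])
  also have "\<dots> = (\<integral>\<^sup>+x. ennreal (indicator {0<..} x * sqrt x) * ennreal ((packet \<mu> R x)\<^sup>2) \<partial>lborel)"
    using mp by (intro nn_integral_wmeasure) auto
  also have "\<dots> \<le> (\<integral>\<^sup>+x. ennreal (3/2 * sqrt R / R\<^sup>2) * indicator (packet_interval R) x \<partial>lborel)"
  proof (rule nn_integral_mono)
    fix x
    show "ennreal (indicator {0<..} x * sqrt x) * ennreal ((packet \<mu> R x)\<^sup>2) \<le> ennreal (3/2 * sqrt R / R\<^sup>2) * indicator (packet_interval R) x"
    proof (cases "x \<in> packet_interval R")
      case True
      note b = packet_interval_bounds[OF True]
      have "eq_n \<mu> x \<le> 1 / R" unfolding eq_n_def using b mu R by (intro frac_le) auto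
      then have "(eq_n \<mu> x)\<^sup>2 \<le> (1 / R)\<^sup>2" using eq_n_pos[OF b(3) mu] by (intro power_mono) auto
      moreover have "sqrt x \<le> 3/2 * sqrt R"
      proof -
        have "sqrt x \<le> sqrt ((3/2)\<^sup>2 * R)" using b R by (intro real_sqrt_le_mono) (simp add: power2_eq_square)
        then show ?thesis by (simp add: real_sqrt_mult)
      qed
      ultimately have "sqrt x * (eq_n \<mu> x)\<^sup>2 \<le> (3/2 * sqrt R) * (1 / R)\<^sup>2" using b R by (intro mult_mono) auto
      then have "ennreal (sqrt x * (eq_n \<mu> x)\<^sup>2) \<le> ennreal (3/2 * sqrt R / R\<^sup>2)" by (intro ennreal_leI) (simp add: power_divide)
      then show ?thesis using True b by (simp add: packet_def ennreal_mult)
    qed (simp add: packet_def)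
  qed
  also have "\<dots> = ennreal (3/2 * sqrt R / R\<^sup>2) * ennreal (packet_width\<^sup>2 * R)"
    by (subst nn_integral_cmult_indicator) (simp_all add: emeasure_packet_interval)
  also have "\<dots> = ennreal (3/2 * sqrt R / R\<^sup>2 * (packet_width\<^sup>2 * R))" using R by (intro ennreal_mult[symmetric]) auto
  also have "3/2 * sqrt R / R\<^sup>2 * (packet_width\<^sup>2 * R) = 3/2 * packet_width\<^sup>2 / sqrt R"
    using R by (simp add: field_simps power2_eq_square)
  finally show ?thesis using R by (simp add: ennreal_le_iff)
qed

text \<open>The amount of collisions for which both \<open>X\<close> and the first frequency lie in the interval; these numbers are the
matrix elements of the terms of the operator on the packet.\<close>

definition overlap :: "(real \<times> real \<times> real \<Rightarrow> real) \<Rightarrow> real" where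
  "overlap X = (LINT p|coll_measure \<mu>. indicator (packet_interval R) (X p) * indicator (packet_interval R) (fst p))"

lemma nn_integral_overlap:
  assumes X: "collision_frequency \<mu> X"
  shows "ennreal (overlap X) = (\<integral>\<^sup>+p. ennreal (coll_density \<mu> p * (indicator (packet_interval R) (X p) * indicator (packet_interval R) (fst p))) \<partial>lborel)"
proof -
  have [measurable]: "X \<in> borel_measurable borel" using X by (simp add: collision_frequency_def)
  have "integrable (coll_measure \<mu>) (\<lambda>p. indicator (packet_interval R) (X p) * indicator (packet_interval R) (fst p) :: real)"
    using freq_fun_inner(1)[OF mu X packet_square_integrable packet_square_integrable] by (simp add: profile_packet)
  then have "ennreal (overlap X) = (\<integral>\<^sup>+p. ennreal (indicator (packet_interval R) (X p) * indicator (packet_interval R) (fst p)) \<partial>coll_measure \<mu>)"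
    unfolding overlap_def by (intro nn_integral_eq_integral[symmetric]) auto
  also have "\<dots> = (\<integral>\<^sup>+p. ennreal (coll_density \<mu> p) * ennreal (indicator (packet_interval R) (X p) * indicator (packet_interval R) (fst p)) \<partial>lborel)"
    unfolding coll_measure_def by (rule nn_integral_density) measurable
  also have "\<dots> = (\<integral>\<^sup>+p. ennreal (coll_density \<mu> p * (indicator (packet_interval R) (X p) * indicator (packet_interval R) (fst p))) \<partial>lborel)"
    by (intro nn_integral_cong ennreal_mult[symmetric] coll_density_nonneg[OF mu]) simp
  finally show ?thesis .
qed

lemma overlap_nonneg: "overlap X \<ge> 0"
  unfolding overlap_def by simp

text \<open>Two gain terms, equal by symmetry, and one loss term.\<close>

lemma inner_K_packet:
  "inner (K_bdd \<mu> (L2_class (packet \<mu> R))) (L2_class (packet \<mu> R)) = 2 * overlap (\<lambda>p. fst (snd p)) - overlap freq3"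
proof -
  note g = packet_square_integrable
  have i: "inner (freq_op \<mu> X (L2_class (packet \<mu> R))) (L2_class (packet \<mu> R)) = overlap X" if "collision_frequency \<mu> X" for X
    using freq_fun_inner(2)[OF mu that g g] freq_op_L2_class[OF mu that g] by (simp add: overlap_def profile_packet)
  have "overlap (\<lambda>p. snd (snd p)) = overlap (\<lambda>p. fst (snd p))"
    using integral_coll_measure_invariant[OF _ _ coll_measure_invariant(1)[of \<mu>],
        of "\<lambda>p. indicator (packet_interval R) (fst (snd p)) * indicator (packet_interval R) (fst p)"]
    by (simp add: overlap_def)
  then show ?thesis
    unfolding K_bdd_def inner_add_left inner_minus_left
    by (simp add: i collision_frequencies)
qed

text \<open>It suffices to count the collisions in a box: \<open>x\<close> in the left and \<open>y\<close> in the right half of the interval, and \<open>z\<close>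
of the order of its length \<open>\<delta>\<^sup>2 R\<close>. Then \<open>y + z - x\<close> is between \<open>z\<close> and \<open>2z\<close>, so that two of the four frequencies
are small and the corresponding factors \<open>n\<close> are large; this is the singularity of the kernel on the diagonal. The
density is of order \<open>\<delta> sqrt R \<cdot> R\<^sup>-\<^sup>2 (\<delta>\<^sup>2 R)\<^sup>-\<^sup>2\<close> and the volume of the box of order \<open>(\<delta>\<^sup>2 R)\<^sup>3\<close>.\<close>

lemma overlap_exchange_lower: "overlap (\<lambda>p. fst (snd p)) \<ge> packet_width ^ 3 / (1152 * sqrt R)"
proof -
  define \<delta> where "\<delta> = packet_width"
  have d: "\<delta> > 0" "\<delta>\<^sup>2 \<le> 1 / 4" by (simp_all add: \<delta>_def packet_width_def power2_eq_square)
  define A where "A = {R..R * (1 + \<delta>\<^sup>2 / 2)}"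
  define B where "B = {R * (1 + \<delta>\<^sup>2 / 2)..R * (1 + \<delta>\<^sup>2)}"
  (* the range of z, comparable to the length of the interval and to the range of y - x *)
  define C where "C = {\<delta>\<^sup>2 * R..4 * (\<delta>\<^sup>2 * R)}"
  define k where "k = 1 / (864 * \<delta> ^ 3 * (R ^ 3 * sqrt R))"
  have k: "k \<ge> 0" using d R by (simp add: k_def)
  have dR: "\<delta>\<^sup>2 * R > 0" using d R by simp
  have low: "k * (indicator A x * (indicator B y * indicator C z))
     \<le> coll_density \<mu> (x, y, z) * (indicator (packet_interval R) y * indicator (packet_interval R) x)" for x y z
  proof (cases "x \<in> A \<and> y \<in> B \<and> z \<in> C")
    case True
    have eR: "\<delta>\<^sup>2 * R \<le> R / 4" using d(2) R by (simp add: field_simps)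
    have x: "R \<le> x" "x \<le> R + \<delta>\<^sup>2 * R / 2" using True by (auto simp: A_def algebra_simps)
    have y: "R + \<delta>\<^sup>2 * R / 2 \<le> y" "y \<le> R + \<delta>\<^sup>2 * R" using True by (auto simp: B_def algebra_simps)
    have z: "\<delta>\<^sup>2 * R \<le> z" "z \<le> 4 * (\<delta>\<^sup>2 * R)" using True by (auto simp: C_def)
    have zp: "z > 0" using z dR by linarith
    have w: "z \<le> y + z - x" "y + z - x \<le> 2 * z" using x y z by linarith+
    have sc: "\<mu> \<le> \<delta>\<^sup>2 * R" using scale by (simp add: \<delta>_def)
    have xI: "x \<in> packet_interval R" "y \<in> packet_interval R"
      using x y dR by (auto simp: packet_interval_def \<delta>_def algebra_simps)
    have n: "1 / (3 * R) \<le> eq_n \<mu> x" "1 / (3 * R) \<le> eq_n \<mu> y" "1 / (2 * z) \<le> eq_n \<mu> z" "1 / (3 * z) \<le> eq_n \<mu> (y + z - x)"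
      unfolding eq_n_def using x y z w sc mu R eR zp by (intro frac_le; linarith)+
    have "(1 / (3 * R)) * (1 / (3 * R)) * (1 / (2 * z)) * (1 / (3 * z)) \<le> eq_n \<mu> x * eq_n \<mu> y * eq_n \<mu> z * eq_n \<mu> (y + z - x)"
      using n R zp by (intro mult_mono mult_nonneg_nonneg) (auto intro: order_trans[rotated])
    moreover have "\<delta> * sqrt R \<le> min (min (sqrt x) (sqrt y)) (min (sqrt z) (sqrt (y + z - x)))"
    proof -
      have "\<delta> * sqrt R = sqrt (\<delta>\<^sup>2 * R)" using d by (simp add: real_sqrt_mult)
      also have "\<dots> \<le> min (min (sqrt x) (sqrt y)) (min (sqrt z) (sqrt (y + z - x)))"
      proof -
        have "\<delta>\<^sup>2 * R \<le> x" "\<delta>\<^sup>2 * R \<le> y" "\<delta>\<^sup>2 * R \<le> z" "\<delta>\<^sup>2 * R \<le> y + z - x" using x y z w eR R dR by linarith+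
        then show ?thesis by (simp only: min.bounded_iff real_sqrt_le_iff simp_thms)
      qed
      finally show ?thesis .
    qed
    ultimately have "(\<delta> * sqrt R) * ((1 / (3 * R)) * (1 / (3 * R)) * (1 / (2 * z)) * (1 / (3 * z))) \<le> coll_density \<mu> (x, y, z)"
    proof -
      assume prod: "(1 / (3 * R)) * (1 / (3 * R)) * (1 / (2 * z)) * (1 / (3 * z)) \<le> eq_n \<mu> x * eq_n \<mu> y * eq_n \<mu> z * eq_n \<mu> (y + z - x)"
        and m: "\<delta> * sqrt R \<le> min (min (sqrt x) (sqrt y)) (min (sqrt z) (sqrt (y + z - x)))"
      have "0 \<le> \<delta> * sqrt R" using d R by simp
      with m have m0: "0 \<le> min (min (sqrt x) (sqrt y)) (min (sqrt z) (sqrt (y + z - x)))" by (rule order_trans[rotated])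
      have "0 \<le> (1 / (3 * R)) * (1 / (3 * R)) * (1 / (2 * z)) * (1 / (3 * z))" using R zp by simp
      from mult_mono[OF m prod m0 this] have "(\<delta> * sqrt R) * ((1 / (3 * R)) * (1 / (3 * R)) * (1 / (2 * z)) * (1 / (3 * z)))
        \<le> min (min (sqrt x) (sqrt y)) (min (sqrt z) (sqrt (y + z - x))) * (eq_n \<mu> x * eq_n \<mu> y * eq_n \<mu> z * eq_n \<mu> (y + z - x))" .
      moreover have "x > 0" "y > 0" "y + z - x > 0" using x y w zp R dR by linarith+
      ultimately show ?thesis using zp by (simp only: coll_density_eq simp_thms if_True)
    qed
    moreover have "k \<le> (\<delta> * sqrt R) * ((1 / (3 * R)) * (1 / (3 * R)) * (1 / (2 * z)) * (1 / (3 * z)))"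
    proof -
      have "z * z \<le> (4 * (\<delta>\<^sup>2 * R)) * (4 * (\<delta>\<^sup>2 * R))" using z zp by (intro mult_mono) auto
      then have "\<delta> * sqrt R / (54 * R\<^sup>2 * ((4 * (\<delta>\<^sup>2 * R)) * (4 * (\<delta>\<^sup>2 * R)))) \<le> \<delta> * sqrt R / (54 * R\<^sup>2 * (z * z))"
        using d R zp by (intro divide_left_mono mult_left_mono mult_pos_pos) auto
      moreover have "k = \<delta> * sqrt R / (54 * R\<^sup>2 * ((4 * (\<delta>\<^sup>2 * R)) * (4 * (\<delta>\<^sup>2 * R))))"
      proof -
        define s where "s = sqrt R"
        have s: "s > 0" "R = s\<^sup>2" using R by (auto simp: s_def)
        show ?thesis unfolding k_def s_def[symmetric] using d s by (simp add: s(2) field_simps power2_eq_square power3_eq_cube)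
      qed
      ultimately show ?thesis by (simp add: power2_eq_square mult_ac)
    qed
    ultimately show ?thesis using True xI by simp
  next
    case False
    then have "indicator A x * (indicator B y * indicator C z) = (0::real)" by (auto simp: indicator_def)
    then have "k * (indicator A x * (indicator B y * indicator C z)) = 0" by simp
    also have "0 \<le> coll_density \<mu> (x, y, z) * (indicator (packet_interval R) y * indicator (packet_interval R) x)"
      by (intro mult_nonneg_nonneg coll_density_nonneg mu) auto
    finally show ?thesis .
  qed
  have sets [measurable]: "A \<in> sets borel" "B \<in> sets borel" "C \<in> sets borel" by (auto simp: A_def B_def C_def)
  have vol: "emeasure lborel A = ennreal (\<delta>\<^sup>2 * R / 2)" "emeasure lborel B = ennreal (\<delta>\<^sup>2 * R / 2)" "emeasure lborel C = ennreal (3 * (\<delta>\<^sup>2 * R))"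
    using dR by (auto simp: A_def B_def C_def algebra_simps)
  have "ennreal (k * (\<delta>\<^sup>2 * R / 2 * (\<delta>\<^sup>2 * R / 2 * (3 * (\<delta>\<^sup>2 * R))))) = ennreal k * (emeasure lborel A * (emeasure lborel B * emeasure lborel C))"
  proof -
    have e: "ennreal (k * (a * (a * b))) = ennreal k * (ennreal a * (ennreal a * ennreal b))" if "a \<ge> 0" "b \<ge> 0" for a b
      using that k by (simp add: ennreal_mult)
    show ?thesis unfolding vol by (rule e) (use dR in auto)
  qed
  also have "\<dots> = (\<integral>\<^sup>+x. \<integral>\<^sup>+y. \<integral>\<^sup>+z. ennreal k * (indicator A x * (indicator B y * indicator C z)) \<partial>lborel \<partial>lborel \<partial>lborel)"
    by (simp add: nn_integral_cmult nn_integral_multc)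
  also have "\<dots> \<le> (\<integral>\<^sup>+x. \<integral>\<^sup>+y. \<integral>\<^sup>+z. ennreal (coll_density \<mu> (x, y, z) * (indicator (packet_interval R) y * indicator (packet_interval R) x)) \<partial>lborel \<partial>lborel \<partial>lborel)"
  proof (intro nn_integral_mono)
    fix x y z
    have "ennreal k * (indicator A x * (indicator B y * indicator C z)) = ennreal (k * (indicator A x * (indicator B y * indicator C z)))"
      using k by (auto simp: indicator_def)
    also have "\<dots> \<le> ennreal (coll_density \<mu> (x, y, z) * (indicator (packet_interval R) y * indicator (packet_interval R) x))"
      by (rule ennreal_leI[OF low])
    finally show "ennreal k * (indicator A x * (indicator B y * indicator C z)) \<le> \<dots>" .
  qed
  also have "\<dots> = ennreal (overlap (\<lambda>p. fst (snd p)))"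
    unfolding nn_integral_overlap[OF collision_frequencies(2)] by (subst nn_integral_lborel3(3)) simp_all
  finally have "k * (\<delta>\<^sup>2 * R / 2 * (\<delta>\<^sup>2 * R / 2 * (3 * (\<delta>\<^sup>2 * R)))) \<le> overlap (\<lambda>p. fst (snd p))"
    using overlap_nonneg by (simp add: ennreal_le_iff)
  moreover have "k * (\<delta>\<^sup>2 * R / 2 * (\<delta>\<^sup>2 * R / 2 * (3 * (\<delta>\<^sup>2 * R)))) = \<delta> ^ 3 / (1152 * sqrt R)"
    using d R by (simp add: k_def field_simps power2_eq_square power3_eq_cube)
  ultimately show ?thesis by (simp add: \<delta>_def)
qed

text \<open>If \<open>x\<close> and the fourth frequency both lie in the interval, then \<open>y + z\<close> is at least \<open>2R\<close> and only one of \<open>y\<close>, \<open>z\<close> can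
be small. The density is then at most \<open>R\<^sup>-\<^sup>3\<close> times the inverse root of the smaller one, which is integrable, so
that the kernel has no singularity on the diagonal.\<close>

lemma overlap_partner_upper: "overlap freq3 \<le> 6 * packet_width ^ 4 / sqrt R"
proof -
  define P where "P y = indicator {0..2 * R} y * y powr (-1/2)" for y :: real
  have P0: "P y \<ge> 0" for y by (simp add: P_def)
  have [measurable]: "P \<in> borel_measurable borel" unfolding P_def by measurable
  have intP: "(\<integral>\<^sup>+y. ennreal (P y) \<partial>lborel) = ennreal (2 * sqrt (2 * R))"
    using nn_integral_has_integral_lebesgue[OF _ has_integral_powr_from_0[of "-1/2" "2 * R"]] R
    by (simp add: P_def powr_half_sqrt mult.commute)
  define I where "I p = (indicator (packet_interval R) (freq3 p) * indicator (packet_interval R) (fst p) :: real)" for p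
  have [measurable]: "I \<in> borel_measurable borel" unfolding I_def by measurable
  have I0: "I p \<ge> 0" for p by (simp add: I_def)
  have up: "coll_density \<mu> p * I p \<le> 1 / R ^ 3 * (I p * P (fst (snd p))) + 1 / R ^ 3 * (I p * P (snd (snd p)))" for p
  proof -
    obtain x y z where p: "p = (x, y, z)" by (cases p rule: prod_cases3)
    define w where "w = y + z - x"
    show ?thesis
    proof (cases "x \<in> packet_interval R \<and> w \<in> packet_interval R \<and> y > 0 \<and> z > 0")
      case True
      have b: "R \<le> x" "x \<le> 2 * R" "R \<le> w" "w \<le> 2 * R" using packet_interval_bounds True by auto
      have nxw: "eq_n \<mu> x * eq_n \<mu> w \<le> (1 / R) * (1 / R)"
        unfolding eq_n_def using b mu R by (intro mult_mono frac_le) auto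
      (* Here a is the smaller of the two outgoing frequencies: its root bounds the minimum, and the larger one
         is at least R. *)
      have small: "min (min (sqrt x) (sqrt a)) (min (sqrt a') (sqrt w)) * (eq_n \<mu> a * eq_n \<mu> a') \<le> a powr (-1/2) * (1 / R)"
        if a: "0 < a" "a \<le> a'" "a + a' = x + w" for a a'
      proof -
        have "R \<le> a'" using a b by linarith
        then have n': "eq_n \<mu> a' \<le> 1 / R" unfolding eq_n_def using mu R by (intro frac_le) auto
        have "min (min (sqrt x) (sqrt a)) (min (sqrt a') (sqrt w)) \<le> sqrt a" by simp
        moreover have "eq_n \<mu> a \<le> 1 / a" unfolding eq_n_def using mu a by (intro frac_le) auto
        ultimately have "min (min (sqrt x) (sqrt a)) (min (sqrt a') (sqrt w)) * (eq_n \<mu> a * eq_n \<mu> a') \<le> sqrt a * ((1 / a) * (1 / R))"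
          using n' a mu b R \<open>R \<le> a'\<close> by (intro mult_mono mult_nonneg_nonneg eq_n_nonneg) auto
        also have "sqrt a * ((1 / a) * (1 / R)) = a powr (-1/2) * (1 / R)"
        proof -
          define s where "s = sqrt a"
          have s: "s > 0" "a = s * s" using a by (auto simp: s_def)
          have "a powr (-1/2) = 1 / s" using a by (simp add: s_def powr_minus_divide powr_half_sqrt)
          then show ?thesis unfolding s_def[symmetric] using s R by (simp add: field_simps)
        qed
        finally show ?thesis .
      qed
      have sum: "y + z = x + w" by (simp add: w_def)
      have "min (min (sqrt x) (sqrt y)) (min (sqrt z) (sqrt w)) * (eq_n \<mu> y * eq_n \<mu> z) \<le> (P y + P z) * (1 / R)"
      proof (cases "y \<le> z")
        case c: True
        then have "y powr (-1/2) \<le> P y + P z" using True sum b P0[of z] by (simp add: P_def)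
        then show ?thesis using small[of y z] True c sum R
          by (intro order_trans[OF small[of y z] mult_right_mono]) auto
      next
        case c: False
        then have "z powr (-1/2) \<le> P y + P z" using True sum b P0[of y] by (simp add: P_def)
        then have "min (min (sqrt x) (sqrt z)) (min (sqrt y) (sqrt w)) * (eq_n \<mu> z * eq_n \<mu> y) \<le> (P y + P z) * (1 / R)"
          using True c sum R by (intro order_trans[OF small[of z y] mult_right_mono]) auto
        then show ?thesis by (simp add: min.commute min.left_commute min.assoc mult.commute)
      qed
      then have "(min (min (sqrt x) (sqrt y)) (min (sqrt z) (sqrt w)) * (eq_n \<mu> y * eq_n \<mu> z)) * (eq_n \<mu> x * eq_n \<mu> w)
          \<le> ((P y + P z) * (1 / R)) * ((1 / R) * (1 / R))"
      proof (rule mult_mono[OF _ nxw])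
        show "0 \<le> (P y + P z) * (1 / R)" using P0[of y] P0[of z] R by simp
        show "0 \<le> eq_n \<mu> x * eq_n \<mu> w" using b R mu by (intro mult_nonneg_nonneg eq_n_nonneg) auto
      qed
      also have "((P y + P z) * (1 / R)) * ((1 / R) * (1 / R)) = 1 / R ^ 3 * P y + 1 / R ^ 3 * P z"
        using R by (simp add: power3_eq_cube field_simps)
      finally have "(min (min (sqrt x) (sqrt y)) (min (sqrt z) (sqrt w)) * (eq_n \<mu> y * eq_n \<mu> z)) * (eq_n \<mu> x * eq_n \<mu> w)
          \<le> 1 / R ^ 3 * P y + 1 / R ^ 3 * P z" .
      moreover have "coll_density \<mu> p = (min (min (sqrt x) (sqrt y)) (min (sqrt z) (sqrt w)) * (eq_n \<mu> y * eq_n \<mu> z)) * (eq_n \<mu> x * eq_n \<mu> w)"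
        using True b R by (simp add: p coll_density_eq w_def)
      ultimately have "coll_density \<mu> p \<le> 1 / R ^ 3 * P y + 1 / R ^ 3 * P z"
        by (simp only:)
      then show ?thesis using True by (simp add: I_def p freq3_def w_def)
    next
      case False
      then have "coll_density \<mu> p * I p = 0" by (auto simp: I_def p freq3_def w_def coll_density_eq indicator_def)
      moreover have "0 \<le> 1 / R ^ 3 * (I p * P (fst (snd p))) + 1 / R ^ 3 * (I p * P (snd (snd p)))"
        using R by (intro add_nonneg_nonneg mult_nonneg_nonneg I0 P0) auto
      ultimately show ?thesis by (simp only:)
    qed
  qed
  have IP: "(\<integral>\<^sup>+p. ennreal (I p * P (fst (snd p))) \<partial>lborel) = ennreal ((packet_width\<^sup>2 * R) * ((packet_width\<^sup>2 * R) * (2 * sqrt (2 * R))))"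
  proof -
    let ?J = "packet_interval R"
    have "(\<integral>\<^sup>+p. ennreal (I p * P (fst (snd p))) \<partial>lborel)
       = (\<integral>\<^sup>+x. \<integral>\<^sup>+y. \<integral>\<^sup>+z. ennreal (I (x, y, z) * P y) \<partial>lborel \<partial>lborel \<partial>lborel)"
      by (subst nn_integral_lborel3(3)) simp_all
    also have "\<dots> = (\<integral>\<^sup>+x. \<integral>\<^sup>+y. indicator ?J x * ennreal (P y) * emeasure lborel ?J \<partial>lborel \<partial>lborel)"
    proof (intro nn_integral_cong)
      fix x y
      have "(\<integral>\<^sup>+z. ennreal (I (x, y, z) * P y) \<partial>lborel) = (\<integral>\<^sup>+z. indicator ?J x * ennreal (P y) * indicator ?J (z + (y - x)) \<partial>lborel)"
        using P0 by (intro nn_integral_cong) (auto simp: I_def freq3_def indicator_def algebra_simps)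
      also have "\<dots> = indicator ?J x * ennreal (P y) * (\<integral>\<^sup>+z. indicator ?J (z + (y - x)) \<partial>lborel)"
        by (rule nn_integral_cmult) measurable
      also have "(\<integral>\<^sup>+z. indicator ?J (z + (y - x)) \<partial>lborel) = emeasure lborel ?J"
        using nn_integral_shift[of "indicator ?J" "y - x"] by simp
      finally show "(\<integral>\<^sup>+z. ennreal (I (x, y, z) * P y) \<partial>lborel) = indicator ?J x * ennreal (P y) * emeasure lborel ?J" .
    qed
    also have "\<dots> = emeasure lborel ?J * (emeasure lborel ?J * ennreal (2 * sqrt (2 * R)))"
      by (simp add: nn_integral_cmult nn_integral_multc intP mult_ac)
    also have "\<dots> = ennreal ((packet_width\<^sup>2 * R) * ((packet_width\<^sup>2 * R) * (2 * sqrt (2 * R))))"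
      unfolding emeasure_packet_interval using R by (simp add: ennreal_mult)
    finally show ?thesis .
  qed
  have IP': "(\<integral>\<^sup>+p. ennreal (I p * P (snd (snd p))) \<partial>lborel) = (\<integral>\<^sup>+p. ennreal (I p * P (fst (snd p))) \<partial>lborel)"
    using lborel_symmetry_swap[of "\<lambda>p. ennreal (I p * P (fst (snd p)))"]
    by (simp add: I_def freq3_def add.commute)
  have "ennreal (overlap freq3) \<le> ennreal (1 / R ^ 3) * (\<integral>\<^sup>+p. ennreal (I p * P (fst (snd p))) \<partial>lborel)
      + ennreal (1 / R ^ 3) * (\<integral>\<^sup>+p. ennreal (I p * P (snd (snd p))) \<partial>lborel)"
    unfolding nn_integral_overlap[OF collision_frequencies(4)] I_def[symmetric]
    by (rule nn_integral_le_lincomb) (use up I0 P0 R in auto)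
  then have "ennreal 1 * ennreal (overlap freq3) \<le> ennreal (1 / R ^ 3) * ennreal ((packet_width\<^sup>2 * R) * ((packet_width\<^sup>2 * R) * (2 * sqrt (2 * R))))
      + ennreal (1 / R ^ 3) * ennreal ((packet_width\<^sup>2 * R) * ((packet_width\<^sup>2 * R) * (2 * sqrt (2 * R))))"
    unfolding IP' IP by simp
  then have "1 * overlap freq3 \<le> 1 / R ^ 3 * ((packet_width\<^sup>2 * R) * ((packet_width\<^sup>2 * R) * (2 * sqrt (2 * R))))
      + 1 / R ^ 3 * ((packet_width\<^sup>2 * R) * ((packet_width\<^sup>2 * R) * (2 * sqrt (2 * R))))"
    using R overlap_nonneg by (intro ennreal_lincomb_leD) auto
  also have "\<dots> = packet_width ^ 4 * (4 * sqrt (2 * R)) / R"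
    using R by (simp add: field_simps power2_eq_square power3_eq_cube power4_eq_xxxx)
  also have "\<dots> \<le> packet_width ^ 4 * (6 * sqrt R) / R"
  proof -
    have "sqrt (2 * R) \<le> sqrt ((3/2)\<^sup>2 * R)" using R by (intro real_sqrt_le_mono) (simp add: power2_eq_square)
    then have "sqrt (2 * R) \<le> 3/2 * sqrt R" by (simp add: real_sqrt_mult[of "_ ^ 2"] power2_eq_square[symmetric])
    then have "4 * sqrt (2 * R) \<le> 6 * sqrt R" by linarith
    then show ?thesis using R by (intro divide_right_mono mult_left_mono) (auto simp: packet_width_def)
  qed
  also have "\<dots> = 6 * packet_width ^ 4 / sqrt R"
    using R by (simp add: real_div_sqrt field_simps)
  finally show ?thesis by simp
qed

text \<open>The lower bound is a fixed fraction of the squared norm, uniformly in \<open>R\<close>, because both scale like \<open>1 / sqrt R\<close>.\<close>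

lemma inner_K_packet_lower:
  "inner (K_bdd \<mu> (L2_class (packet \<mu> R))) (L2_class (packet \<mu> R)) \<ge> packet_width / 3000 * (norm (L2_class (packet \<mu> R)))\<^sup>2"
  "norm (L2_class (packet \<mu> R)) > 0"
proof -
  have sR: "sqrt R > 0" using R by simp
  (* 1/576 - 6/8000 \<ge> 1/2000 *)
  have d: "packet_width ^ 3 / (1152 * sqrt R) * 2 - 6 * packet_width ^ 4 / sqrt R \<ge> packet_width ^ 3 / (2000 * sqrt R)"
    using sR by (simp add: packet_width_def field_simps)
  have K: "inner (K_bdd \<mu> (L2_class (packet \<mu> R))) (L2_class (packet \<mu> R)) \<ge> packet_width ^ 3 / (2000 * sqrt R)"
    using overlap_exchange_lower overlap_partner_upper d unfolding inner_K_packet by linarith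
  have "packet_width / 3000 * (norm (L2_class (packet \<mu> R)))\<^sup>2 \<le> packet_width / 3000 * (3/2 * packet_width\<^sup>2 / sqrt R)"
    using norm_packet_le by (intro mult_left_mono) (auto simp: packet_width_def)
  also have "\<dots> = packet_width ^ 3 / (2000 * sqrt R)" by (simp add: power2_eq_square power3_eq_cube)
  finally show "inner (K_bdd \<mu> (L2_class (packet \<mu> R))) (L2_class (packet \<mu> R)) \<ge> packet_width / 3000 * (norm (L2_class (packet \<mu> R)))\<^sup>2"
    using K by linarith
  have "packet_width ^ 3 / (2000 * sqrt R) > 0" using sR by (simp add: packet_width_def)
  then have "inner (K_bdd \<mu> (L2_class (packet \<mu> R))) (L2_class (packet \<mu> R)) \<noteq> 0" using K by linarith
  then show "norm (L2_class (packet \<mu> R)) > 0" by auto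
qed

end

text \<open>The packets at \<open>R = 2\<^sup>k R0\<close> have disjoint supports. The base scale \<open>R0\<close> is large enough for \<open>\<mu>\<close> to be
negligible even at the smallest frequencies involved, those of order \<open>packet_width\<^sup>2 R\<close>.\<close>

lemma K_bdd_not_compact:
  assumes mu: "\<mu> \<ge> 0"
  shows "\<not> compact_op (K_bdd \<mu>)"
proof -
  define R0 where "R0 = max 1 (\<mu> / packet_width\<^sup>2)"
  define R where "R k = 2 ^ k * R0" for k :: nat
  have R0: "R0 \<ge> 1" "\<mu> \<le> packet_width\<^sup>2 * R0"
    by (auto simp: R0_def packet_width_def max_def field_simps)
  have R: "R k > 0" "\<mu> \<le> packet_width\<^sup>2 * R k" for k
  proof -
    have "R0 \<le> R k" using R0 by (simp add: R_def)
    then show "R k > 0" "\<mu> \<le> packet_width\<^sup>2 * R k"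
      using R0 mult_left_mono[of R0 "R k" "packet_width\<^sup>2"] by auto
  qed
  define v where "v k = L2_class (packet \<mu> (R k))" for k
  define e where "e k = v k /\<^sub>R norm (v k)" for k
  note low = inner_K_packet_lower[OF mu R, folded v_def]
  have disj: "inner (v j) (v k) = 0" if "j < k" for j k
  proof -
    have "R j * 2 \<le> R k"
    proof -
      have "(2::real) ^ Suc j \<le> 2 ^ k" using that by (intro power_increasing) auto
      then have "2 ^ Suc j * R0 \<le> 2 ^ k * R0" using R0 by (intro mult_right_mono) auto
      then show ?thesis by (simp add: R_def mult_ac)
    qed
    moreover have "R j * (1 + packet_width\<^sup>2) < R j * 2" using R[of j] by (simp add: packet_width_def power2_eq_square)
    ultimately have "(\<lambda>x. packet \<mu> (R j) x * packet \<mu> (R k) x) = (\<lambda>_. 0)"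
      by (auto simp: packet_def packet_interval_def indicator_def)
    then show ?thesis
      using L2_class_arith(6)[OF packet_square_integrable[OF mu R, of j] packet_square_integrable[OF mu R, of k]]
      by (simp add: v_def)
  qed
  have on: "inner (e j) (e k) = (if j = k then 1 else 0)" for j k
  proof (cases j k rule: linorder_cases)
    case less
    then show ?thesis using disj by (simp add: e_def)
  next
    case equal
    have "norm (v k) \<noteq> 0" using low(2)[of k] by linarith
    then show ?thesis using equal by (simp add: e_def power2_norm_eq_inner[symmetric] power2_eq_square)
  next
    case greater
    then show ?thesis using disj[of k j] by (simp add: e_def inner_commute)
  qed
  have "inner (K_bdd \<mu> (e k)) (e k) \<ge> packet_width / 3000" for k
  proof -
    have n: "norm (v k) > 0" using low(2) .
    have "inner (K_bdd \<mu> (e k)) (e k) = inner (K_bdd \<mu> (v k)) (v k) / (norm (v k))\<^sup>2"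
      using linear_scale[OF bounded_linear.linear[OF bounded_linear_A_K(2)[OF mu]]]
      by (simp add: e_def divide_inverse power2_eq_square mult_ac)
    also have "\<dots> \<ge> packet_width / 3000" using low(1)[of k] n by (simp add: pos_le_divide_eq)
    finally show ?thesis .
  qed
  moreover have "packet_width / 3000 > 0" by (simp add: packet_width_def)
  ultimately show ?thesis using not_compact_if_bounded_below_on_orthonormal[OF on] by blast
qed

section \<open>The linearised operator on the weighted space\<close>

theorem theorem1:
  fixes \<mu> :: real
  assumes "\<mu> \<ge> 0"
  shows "extends_formula (L_formula \<mu>) (L_op \<mu>) \<and>
    extends_formula (A_formula \<mu>) (A_op \<mu>) \<and>
    extends_formula (K_formula \<mu>) (K_op \<mu>) \<and>
    (\<forall>f. L_op \<mu> f = - A_op \<mu> f + K_op \<mu> f) \<and>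
    (symmetric_op (\<lambda>f. - L_op \<mu> f) \<and> nonnegative_op (\<lambda>f. - L_op \<mu> f) \<and>
      bounded_linear (L_op \<mu>)) \<and>
    (contraction_semigroup (op_exp (L_op \<mu>)) \<and> generates (L_op \<mu>) (op_exp (L_op \<mu>)) \<and>
      orthogonal_projection_onto (ker (L_op \<mu>)) (Pi_op \<mu>) \<and>
      (\<forall>f. \<forall>t>0. norm (L_op \<mu> (op_exp (L_op \<mu>) t f)) \<le> norm f / (exp 1 * t)) \<and>
      (\<forall>f. ((\<lambda>t. norm (op_exp (L_op \<mu>) t (f - Pi_op \<mu> f))) \<longlongrightarrow> 0) at_top)) \<and>
    \<not> compact_op (K_op \<mu>) \<and>
    (\<mu> > 0 \<longrightarrow> (\<exists>lam>0. \<forall>g. dissipation \<mu> g \<ge> lam * (norm (g - Pi_op \<mu> g))\<^sup>2))"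
proof -
  note mu = assms
  note L = bounded_linear_L_op[OF mu] L_op_symmetric[OF mu] L_op_nonpositive[OF mu]
  have ext: "extends_formula (L_formula \<mu>) (L_op \<mu>)" "extends_formula (A_formula \<mu>) (A_op \<mu>)"
    "extends_formula (K_formula \<mu>) (K_op \<mu>)"
    using extends_formulas[OF mu] by (simp_all add: operators_eq_bounded[OF mu])
  have split: "L_op \<mu> f = - A_op \<mu> f + K_op \<mu> f" for f by (simp add: operators_eq_bounded[OF mu])
  have symneg: "symmetric_op (\<lambda>f. - L_op \<mu> f)" "nonnegative_op (\<lambda>f. - L_op \<mu> f)"
    using L(2,3) by (simp_all add: symmetric_op_def nonnegative_op_def)
  have Pi: "orthogonal_projection_onto (ker (L_op \<mu>)) (Pi_op \<mu>)"
    unfolding Pi_op_def by (rule orthogonal_projection_onto_the[OF subspace_ker[OF L] closed_ker[OF L]])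
  have decay: "norm (L_op \<mu> (op_exp (L_op \<mu>) t f)) \<le> norm f / (exp 1 * t)" if "t > 0" for f t
    by (rule op_exp_decay[OF L that])
  have lim: "((\<lambda>t. norm (op_exp (L_op \<mu>) t (f - Pi_op \<mu> f))) \<longlongrightarrow> 0) at_top" for f
    by (rule op_exp_tendsto_0[OF L]) (use Pi in \<open>auto simp: orthogonal_projection_onto_def orthogonal_def ker_def\<close>)
  have noncompact: "\<not> compact_op (K_op \<mu>)" using K_bdd_not_compact[OF mu] by (simp add: operators_eq_bounded[OF mu])
  have gap: "\<exists>lam>0. \<forall>g. dissipation \<mu> g \<ge> lam * (norm (g - Pi_op \<mu> g))\<^sup>2" if "\<mu> > 0"
    by (rule spectral_gap[OF that Pi])
  show ?thesis
    using ext split symneg L(1) contraction_semigroup_op_exp[OF L] generates_op_exp[OF L] Pi decay lim noncompact gap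
    by blast
qed

end
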